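(* Let $s\in\mathbb{C}$ and let $h$ be a solution on $\mathfrak{H}$ of $\{h,\tau\}=sE_4(\tau)$ having a simple zero at $\infty$, and let $\Gamma=\{\gamma\in\mathrm{SL}_2(\mathbb{Z}):h(\gamma\tau)=h(\tau)\ \forall \tau\in\mathfrak{H}\}$. If $\Gamma$ has finite index in $\mathrm{SL}_2(\mathbb{Z})$, then $\Gamma$ is one of the four groups $\Gamma(m)$, $2\le m\le 5$ (up to $\pm I_2$, i.e. as subgroups of $\mathrm{PSL}_2(\mathbb{Z})$).
   Context: $\{h,\tau\}=\frac{h'''}{h'}-\frac32(\frac{h''}{h'})^2$ is the Schwarz derivative, $E_4$ the weight 4 Eisenstein series $1+240\sum_{k\ge1}\sigma_3(k)e^{2\pi i k\tau}$, $\mathrm{SL}_2(\mathbb{Z})$ acts on $\mathfrak{H}$ by linear fractional transformations. The group $\Gamma$ is normal in $\mathrm{SL}_2(\mathbb{Z})$ (it is the kernel of the representation $\rho$ with $h(\gamma\tau)=\rho(\gamma)h(\tau)$); its level $m$ is the smallest positive integer with $\begin{pmatrix}1&m\\0&1\end{pmatrix}\in\Gamma$, and $q_m=e^{2\pi i\tau/m}$ is the local parameter at $\infty$. "$h$ has a simple zero at $\infty$" means $h$, as a function of $q_m$, has a simple zero at $q_m=0$. $\Gamma(m)$ denotes the principal congruence subgroup of level $m$. *)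

theory Defs
  imports "HOL-Algebra.Coset" "HOL-Complex_Analysis.Complex_Analysis"
begin

definition upper_half_plane :: "complex set" where
  "upper_half_plane = {\<tau>. 0 < Im \<tau>}"

definition SL2Z :: "(int^2^2) monoid" where
  "SL2Z = \<lparr>carrier = {A. det A = 1}, monoid.mult = (**), one = mat 1\<rparr>"

lemma group_SL2Z: "group SL2Z"
proof (rule groupI)
  fix A assume A: "A \<in> carrier SL2Z"
  define B :: "int^2^2" where
    "B = vector [vector [A$2$2, - (A$1$2)], vector [- (A$2$1), A$1$1]]"
  have "det B = 1" "B ** A = mat 1"
    using A by (auto simp: B_def SL2Z_def det_2 vec_eq_iff forall_2 matrix_matrix_mult_def
                           sum_2 mat_def vector_2 algebra_simps)
  then show "\<exists>B\<in>carrier SL2Z. B \<otimes>\<^bsub>SL2Z\<^esub> A = \<one>\<^bsub>SL2Z\<^esub>"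
    by (auto simp: SL2Z_def)
qed (auto simp: SL2Z_def det_mul matrix_mul_assoc)

definition moebius :: "int^2^2 \<Rightarrow> complex \<Rightarrow> complex" where
  "moebius A \<tau> = (of_int (A$1$1) * \<tau> + of_int (A$1$2)) / (of_int (A$2$1) * \<tau> + of_int (A$2$2))"

definition principal_congruence :: "nat \<Rightarrow> (int^2^2) set" where
  "principal_congruence m =
     {A \<in> carrier SL2Z. \<forall>i j. A$i$j mod int m = (mat 1 :: int^2^2)$i$j mod int m}"

text \<open>The image of a subset of \<open>SL\<^sub>2(\<int>)\<close> in \<open>PSL\<^sub>2(\<int>) = SL\<^sub>2(\<int>) / {\<plusminus>I\<^sub>2}\<close>.\<close>
definition PSL2_image :: "(int^2^2) set \<Rightarrow> (int^2^2) set set" where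
  "PSL2_image H = (\<lambda>A. {mat 1, - mat 1} #>\<^bsub>SL2Z\<^esub> A) ` H"

definition E4 :: "complex \<Rightarrow> complex" where
  "E4 \<tau> = 1 + 240 * (\<Sum>n. of_nat (\<Sum>d | d dvd Suc n. d ^ 3)
                            * exp (2 * of_real pi * \<i> * of_nat (Suc n) * \<tau>))"

definition schwarzian :: "(complex \<Rightarrow> complex) \<Rightarrow> complex \<Rightarrow> complex" where
  "schwarzian h \<tau> = (deriv ^^ 3) h \<tau> / deriv h \<tau> - 3 / 2 * ((deriv ^^ 2) h \<tau> / deriv h \<tau>)\<^sup>2"

text \<open>
  Solutions are meromorphic functions, and the equation is an identity of meromorphic functions,
  i.e. it holds off a discrete closed subset of the half-plane.  The condition on \<open>deriv h\<close> says
  that \<open>h\<close> is not constant, so that its Schwarz derivative is defined as a meromorphic function.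
  Requiring \<open>nicely_meromorphic_on\<close> only normalises the representative: removable
  singularities are removed (and the values at poles are set to the dummy value 0).
\<close>
definition schwarz_solution :: "complex \<Rightarrow> (complex \<Rightarrow> complex) \<Rightarrow> bool" where
  "schwarz_solution s h \<longleftrightarrow>
     h nicely_meromorphic_on upper_half_plane \<and>
     (\<forall>\<^sub>\<approx>\<tau>\<in>upper_half_plane. deriv h \<tau> \<noteq> 0 \<and> schwarzian h \<tau> = s * E4 \<tau>)"

text \<open>The value of a meromorphic function in \<open>\<complex> \<union> {\<infinity>}\<close>, with \<open>None\<close> standing for \<open>\<infinity>\<close>.\<close>
definition sphere_value :: "(complex \<Rightarrow> complex) \<Rightarrow> complex \<Rightarrow> complex option" where
  "sphere_value h \<tau> = (if is_pole h \<tau> then None else Some (h \<tau>))"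

definition invariance_group :: "(complex \<Rightarrow> complex) \<Rightarrow> (int^2^2) set" where
  "invariance_group h =
     {A \<in> carrier SL2Z. \<forall>\<tau>\<in>upper_half_plane. sphere_value h (moebius A \<tau>) = sphere_value h \<tau>}"

definition level :: "(int^2^2) set \<Rightarrow> nat" where
  "level H = (LEAST m. 0 < m \<and> vector [vector [1, int m], vector [0, 1]] \<in> H)"

text \<open>
  The function \<open>f\<close> expresses \<open>h\<close> in the local parameter \<open>exp (2 * pi * \<i> * \<tau> / m)\<close>; it need only
  do so near \<open>\<infinity>\<close>, since \<open>h\<close> may have poles in the half-plane.
\<close>
definition simple_zero_at_infinity :: "nat \<Rightarrow> (complex \<Rightarrow> complex) \<Rightarrow> bool" where
  "simple_zero_at_infinity m h \<longleftrightarrow>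
     (\<exists>f c. f analytic_on {0} \<and> f 0 = 0 \<and> deriv f 0 \<noteq> 0 \<and>
        (\<forall>\<tau>\<in>upper_half_plane. c < Im \<tau> \<longrightarrow> h \<tau> = f (exp (2 * of_real pi * \<i> * \<tau> / of_nat m))))"

end

theory Submission
  imports Defs "HOL-Real_Asymp.Real_Asymp"
begin

text \<open>
  If \<open>h\<close> solves \<open>{h,\<tau>} = s E\<^sub>4\<close>, then \<open>1/h'\<close>, \<open>h/h'\<close> and \<open>h\<^sup>2/h'\<close> are holomorphic on the upper
  half-plane and span the solutions of \<open>v''' + 2 s E\<^sub>4 v' + s E\<^sub>4' v = 0\<close>. By Bol's identity this
  space is stable under the weight \<open>-2\<close> action of \<open>SL\<^sub>2(\<int>)\<close>, and \<open>\<Gamma>\<close> is the kernel of the action;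
  hence \<open>\<Gamma>\<close> is normal, and it contains no elliptic element because at its fixed point all
  solutions would vanish, which contradicts that \<open>h\<close> is locally univalent.

  Every solution is \<open>O(1/q\<^sub>m)\<close> at \<open>\<infinity>\<close>. Let \<open>u \<noteq> 0\<close> be a solution with a zero in the half-plane.
  Its orbit \<open>W\<close> is finite if \<open>\<Gamma>\<close> has finite index, so with a cusp form \<open>D\<close> of weight 12 the product
  of \<open>w\<^sup>6 D\<close> over \<open>w \<in> W\<close> is a modular function. If \<open>m \<ge> 6\<close> it is holomorphic at \<open>\<infinity>\<close>, hence constant,
  hence \<open>0\<close>, which is absurd. So \<open>m \<le> 5\<close>.

  For \<open>m \<le> 5\<close> a Euclidean descent shows that the conjugates of the translation by \<open>m\<close> generate
  \<open>\<Gamma>(m)\<close>, and every class of \<open>SL\<^sub>2(\<int>/m)\<close> other than \<open>\<plusminus>I\<^sub>2\<close> contains an elliptic element or, up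
  to sign, a conjugate of a translation by a number not divisible by \<open>m\<close>; such a class does not
  meet \<open>\<Gamma>\<close>.
\<close>

section \<open>Modularity of the Eisenstein series\<close>

text \<open>The bound 6 is a count of weights and orders. Solutions have weight -2, so their sixth
  powers need a form of weight 12; in terms of q the power \<open>w ^ 6\<close> has order at least
  -6/m and \<open>cusp_form12\<close> has order exactly 1, so the product stays bounded at
  \<infinity> as soon as m \<ge> 6. Taking the product over a whole orbit makes it invariant under
  all of SL_2(Z), so there is only one cusp to control.

  The poles of h are the obstacle to arguing with h itself. The triple (1/h', h/h', h^2/h') extends
  over them, lies on the conic \<open>v0 * v2 = v1 ^ 2\<close>, and is a form of h in projective
  coordinates without common zeros.

  E4 is given by its q-series, which does not show its transformation law. It is identified with a
  lattice sum: the reflection formula of the polygamma function sums each row, and a Lambert series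
  rearrangement collects the rows.

  For 2 \<le> m \<le> 5 the groups PSL_2(Z/m) are S_3, A_4, S_4, A_5. Up to sign the only residues
  are 0, 1, 2, so a few explicit matrices decide which classes can meet \<Gamma>.\<close>

lemma DERIV_eq_on_open:
  fixes f g :: "complex \<Rightarrow> complex"
  assumes "(f has_field_derivative f') (at z)" "(g has_field_derivative g') (at z)"
    and "open U" "z \<in> U" "\<And>w. w \<in> U \<Longrightarrow> f w = g w"
  shows "f' = g'"
  using assms DERIV_unique has_field_derivative_transform_within_open by metis

section \<open>Reflection formulas of the polygamma functions and the value of zeta at 4\<close>

lemma sin_pi_times_nonzero:
  fixes z :: complex
  assumes "z \<notin> \<int>"
  shows "sin (of_real pi * z) \<noteq> 0"
proof
  assume "sin (of_real pi * z) = 0"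
  then obtain n :: int where "of_real pi * z = of_real (of_int n * pi)"
    by (auto simp: sin_eq_0)
  then have "z = of_int n" by (simp add: mult.commute)
  with assms show False by simp
qed

lemma not_Ints_reflection:
  fixes z :: complex
  assumes "z \<notin> \<int>"
  shows "z \<notin> \<int>\<^sub>\<le>\<^sub>0" "1 - z \<notin> \<int>\<^sub>\<le>\<^sub>0" "z \<noteq> 0" "1 - z \<noteq> 0" "1 - z \<notin> \<int>"
proof -
  show *: "1 - z \<notin> \<int>"
    using assms Ints_diff[OF Ints_1, of "1 - z"] by auto
  show "z \<notin> \<int>\<^sub>\<le>\<^sub>0" "1 - z \<notin> \<int>\<^sub>\<le>\<^sub>0" "z \<noteq> 0" "1 - z \<noteq> 0"
    using assms * nonpos_Ints_Int by (auto simp: )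
qed

lemma Digamma_reflection:
  fixes z :: complex
  assumes z: "z \<notin> \<int>"
  shows "Digamma z - Digamma (1 - z) = - of_real pi * cos (of_real pi * z) / sin (of_real pi * z)"
proof -
  note s = sin_pi_times_nonzero[OF z] and i = not_Ints_reflection[OF z]
  have "((\<lambda>z. Gamma z * Gamma (1 - z)) has_field_derivative
          Gamma z * Gamma (1 - z) * (Digamma z - Digamma (1 - z))) (at z)"
    using i by (auto intro!: derivative_eq_intros simp: algebra_simps)
  moreover have "((\<lambda>z. of_real pi / sin (of_real pi * z)) has_field_derivative
          - (of_real pi)\<^sup>2 * cos (of_real pi * z) / (sin (of_real pi * z))\<^sup>2) (at z)"
    using s by (auto intro!: derivative_eq_intros simp: power2_eq_square)
  \<comment> \<open>The two functions agree on all of \<open>UNIV\<close>: at an integer one Gamma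
    factor has the default value 0, and so has the quotient by sin = 0.\<close>
  ultimately have "Gamma z * Gamma (1 - z) * (Digamma z - Digamma (1 - z))
      = - (of_real pi)\<^sup>2 * cos (of_real pi * z) / (sin (of_real pi * z))\<^sup>2"
    by (rule DERIV_eq_on_open[of _ _ _ _ _ "UNIV"]) (auto simp: Gamma_reflection_complex)
  then have "of_real pi * ((Digamma z - Digamma (1 - z)) * sin (of_real pi * z))
      = of_real pi * (- of_real pi * cos (of_real pi * z))"
    using s unfolding Gamma_reflection_complex by (simp add: divide_simps power2_eq_square)
  then have "(Digamma z - Digamma (1 - z)) * sin (of_real pi * z) = - of_real pi * cos (of_real pi * z)"
    by (subst (asm) mult_left_cancel) auto
  then show ?thesis
    using s by (subst nonzero_eq_divide_eq) auto
qed

lemma open_not_Ints: "open (- \<int> :: complex set)"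
  using closed_Ints by (simp add: open_closed)

text \<open>Three derivatives of \<open>Digamma_reflection\<close>, the sign between the terms
  alternating because of the inner derivative of 1 - z. The left side is 6 times the sum of 1/(z +
  n)^4 over all integers n, one row of the lattice sum.\<close>

lemma Polygamma_3_reflection:
  fixes z :: complex
  assumes z: "z \<notin> \<int>"
  shows "Polygamma 3 z + Polygamma 3 (1 - z) =
    2 * of_real pi ^ 4 * (3 - 2 * (sin (of_real pi * z))\<^sup>2) / sin (of_real pi * z) ^ 4"
proof -
  have 1: "Polygamma 1 z + Polygamma 1 (1 - z) = of_real pi ^ 2 / sin (of_real pi * z) ^ 2"
    if z: "z \<notin> \<int>" for z :: complex
  proof (rule DERIV_eq_on_open[of "\<lambda>z. Digamma z - Digamma (1 - z)" _ z _ _ "- \<int>"])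
    note s = sin_pi_times_nonzero[OF z] and i = not_Ints_reflection[OF z]
    show "((\<lambda>z. Digamma z - Digamma (1 - z)) has_field_derivative
       Polygamma 1 z + Polygamma 1 (1 - z)) (at z)"
      using i by (auto intro!: derivative_eq_intros)
    show "((\<lambda>z. - of_real pi * cos (of_real pi * z) / sin (of_real pi * z)) has_field_derivative
        of_real pi ^ 2 / sin (of_real pi * z) ^ 2) (at z)"
      apply (rule derivative_eq_intros refl s)+
      using s sin_cos_squared_add[of "of_real pi * z"] apply (simp add: divide_simps power2_eq_square)
      by algebra
  qed (use that open_not_Ints Digamma_reflection in auto)
  have 2: "Polygamma 2 z - Polygamma 2 (1 - z) =
      - 2 * of_real pi ^ 3 * cos (of_real pi * z) / sin (of_real pi * z) ^ 3"
    if z: "z \<notin> \<int>" for z :: complex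
  proof (rule DERIV_eq_on_open[of "\<lambda>z. Polygamma 1 z + Polygamma 1 (1 - z)" _ z _ _ "- \<int>"])
    note s = sin_pi_times_nonzero[OF z] and i = not_Ints_reflection[OF z]
    show "((\<lambda>z. Polygamma 1 z + Polygamma 1 (1 - z)) has_field_derivative
       Polygamma 2 z - Polygamma 2 (1 - z)) (at z)"
      using i by (auto intro!: derivative_eq_intros simp: numeral_2_eq_2)
    show "((\<lambda>z. of_real pi ^ 2 / sin (of_real pi * z) ^ 2) has_field_derivative
        - 2 * of_real pi ^ 3 * cos (of_real pi * z) / sin (of_real pi * z) ^ 3) (at z)"
      using s by (auto intro!: derivative_eq_intros simp: divide_simps power2_eq_square power3_eq_cube)
  qed (use that open_not_Ints 1 in auto)
  show ?thesis
  proof (rule DERIV_eq_on_open[of "\<lambda>z. Polygamma 2 z - Polygamma 2 (1 - z)" _ z _ _ "- \<int>"])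
    note s = sin_pi_times_nonzero[OF z] and i = not_Ints_reflection[OF z]
    show "((\<lambda>z. Polygamma 2 z - Polygamma 2 (1 - z)) has_field_derivative
       Polygamma 3 z + Polygamma 3 (1 - z)) (at z)"
      using i by (auto intro!: derivative_eq_intros simp: numeral_2_eq_2 numeral_3_eq_3)
    show "((\<lambda>z. - 2 * of_real pi ^ 3 * cos (of_real pi * z) / sin (of_real pi * z) ^ 3) has_field_derivative
        2 * of_real pi ^ 4 * (3 - 2 * (sin (of_real pi * z))\<^sup>2) / sin (of_real pi * z) ^ 4) (at z)"
      apply (rule derivative_eq_intros refl s)+
      using s apply simp
      using s sin_cos_squared_add[of "of_real pi * z"]
      apply (simp add: divide_simps power2_eq_square power3_eq_cube power4_eq_xxxx)
      by algebra
  qed (use z open_not_Ints 2 in auto)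
qed

text \<open>Equivalent to zeta(4) = pi^4/90. The reflection formula has a pole at 0 on both sides;
  the recurrence Polygamma 3 x = Polygamma 3 (1 + x) + 6/x^4 moves it to the right, where it
  cancels. The limit x \<rightarrow> 0 then gives twice the value.\<close>

lemma Polygamma_3_at_1: "Polygamma 3 (1::real) = pi ^ 4 / 15"
proof -
  define S where "S = (\<lambda>x::real. 2 * pi ^ 4 * (3 - 2 * (sin (pi * x))\<^sup>2) / sin (pi * x) ^ 4)"
  have eq: "Polygamma 3 (1 + x) + Polygamma 3 (1 - x) = S x - 6 / x ^ 4" if x: "0 < x" "x < 1" for x :: real
  proof -
    have "of_real x \<notin> (\<int> :: complex set)"
      using x by (auto elim!: Ints_cases simp: complex_eq_iff)
    have sin_pi: "sin (of_real pi * of_real x) = (of_real (sin (pi * x)) :: complex)"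
      by (metis of_real_mult sin_of_real)
    from Polygamma_3_reflection[OF \<open>of_real x \<notin> \<int>\<close>]
    have "of_real (Polygamma 3 x + Polygamma 3 (1 - x)) = (of_real (S x) :: complex)"
      using x Polygamma_of_real[of x 3, where 'a = complex] Polygamma_of_real[of "1 - x" 3, where 'a = complex]
      by (simp add: S_def sin_pi)
    then have "Polygamma 3 x + Polygamma 3 (1 - x) = S x"
      using of_real_eq_iff by blast
    moreover have "Polygamma 3 (x + 1) = Polygamma 3 x - 6 / x ^ 4"
      using x Polygamma_plus1[of x 3] by (simp add: fact_numeral)
    ultimately show ?thesis by (simp add: add.commute)
  qed
  \<comment> \<open>With t = pi x this is \<open>S x - 6 / x ^ 4\<close> up to the factor 6
    pi^4.\<close>
  have "((\<lambda>t. (1 - 2 / 3 * (sin t)\<^sup>2) / sin t ^ 4 - 1 / t ^ 4) \<longlongrightarrow> 1 / 45) (at_right (0::real))"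
    by real_asymp
  moreover have "filterlim (\<lambda>x. pi * x) (at_right 0) (at_right 0)"
    by real_asymp
  ultimately have "((\<lambda>x. 6 * pi ^ 4 * ((1 - 2 / 3 * (sin (pi * x))\<^sup>2) / sin (pi * x) ^ 4 - 1 / (pi * x) ^ 4))
      \<longlongrightarrow> 6 * pi ^ 4 * (1 / 45)) (at_right 0)"
    by (intro tendsto_mult tendsto_const) (rule filterlim_compose)
  moreover have "6 * pi ^ 4 * ((1 - 2 / 3 * (sin (pi * x))\<^sup>2) / sin (pi * x) ^ 4 - 1 / (pi * x) ^ 4)
      = S x - 6 / x ^ 4" for x
    by (cases "x = 0") (simp_all add: S_def right_diff_distrib power_mult_distrib diff_divide_distrib)
  ultimately have lim: "((\<lambda>x. S x - 6 / x ^ 4) \<longlongrightarrow> 2 * pi ^ 4 / 15) (at_right 0)"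
    by simp
  have cont: "((\<lambda>x::real. Polygamma 3 (1 + x) + Polygamma 3 (1 - x)) \<longlongrightarrow>
      Polygamma 3 (1 + 0) + Polygamma 3 (1 - 0)) (at_right 0)"
    by (intro tendsto_intros) auto
  have "\<forall>\<^sub>F x in at_right 0. Polygamma 3 (1 + x) + Polygamma 3 (1 - x) = S x - 6 / x ^ 4"
    using eventually_at_right_real[OF zero_less_one] by (rule eventually_mono) (auto simp: eq)
  then have "((\<lambda>x. Polygamma 3 (1 + x) + Polygamma 3 (1 - x)) \<longlongrightarrow> 2 * pi ^ 4 / 15) (at_right 0)"
    by (subst tendsto_cong) (use lim in auto)
  from tendsto_unique[OF trivial_limit_at_right_real cont this]
  have "Polygamma 3 (1 + 0) + Polygamma 3 (1 - 0) = 2 * pi ^ 4 / (15::real)" .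
  then show ?thesis by simp
qed

section \<open>Unordered sums over the integers and elementary power series\<close>

lemma infsum_nat:
  fixes f :: "nat \<Rightarrow> complex"
  assumes "f summable_on UNIV"
  shows "infsum f UNIV = suminf f"
  using has_sum_imp_sums[OF has_sum_infsum[OF assms]] sums_unique by metis

text \<open>Writing the negative integers as -1 - n indexes both halves by all natural numbers and
  counts 0 once.\<close>

lemma UNIV_int_split: "(UNIV :: int set) = range int \<union> range (\<lambda>n. - 1 - int n)"
proof (intro equalityI subsetI)
  fix x :: int show "x \<in> range int \<union> range (\<lambda>n. - 1 - int n)"
  proof (cases "x \<ge> 0")
    case True then have "x = int (nat x)" by simp
    then show ?thesis by blast
  next
    case False then have "x = - 1 - int (nat (- 1 - x))" by simp
    then show ?thesis by blast
  qed
qed auto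

lemma summable_on_intI:
  fixes f :: "int \<Rightarrow> real"
  assumes "(\<lambda>n::nat. f (int n)) summable_on UNIV" "(\<lambda>n::nat. f (- 1 - int n)) summable_on UNIV"
  shows "f summable_on UNIV"
proof -
  have "f summable_on range int" "f summable_on range (\<lambda>n. - 1 - int n)"
    using assms by (auto simp: summable_on_reindex inj_on_def o_def)
  moreover have "range int \<inter> range (\<lambda>n. - 1 - int n) = {}" by auto
  ultimately show ?thesis
    unfolding UNIV_int_split by (rule summable_on_Un_disjoint)
qed

lemma infsum_int:
  fixes f :: "int \<Rightarrow> complex"
  assumes "f summable_on UNIV"
  shows "infsum f UNIV = (\<Sum>n. f (int n)) + (\<Sum>n. f (- 1 - int n))"
    "(\<lambda>n. f (int n)) summable_on UNIV" "(\<lambda>n. f (- 1 - int n)) summable_on UNIV"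
proof -
  have D: "range int \<inter> range (\<lambda>n. - 1 - int n) = {}" by auto
  have s: "f summable_on range int" "f summable_on range (\<lambda>n. - 1 - int n)"
    using assms summable_on_subset_banach by blast+
  have inj: "inj int" "inj (\<lambda>n. - 1 - int n)" by (auto simp: inj_on_def)
  show s': "(\<lambda>n. f (int n)) summable_on UNIV" "(\<lambda>n. f (- 1 - int n)) summable_on UNIV"
    using s inj by (auto simp: summable_on_reindex o_def)
  have "infsum f UNIV = infsum f (range int) + infsum f (range (\<lambda>n. - 1 - int n))"
    by (subst UNIV_int_split, rule infsum_Un_disjoint[OF s D])
  also have "\<dots> = (\<Sum>n. f (int n)) + (\<Sum>n. f (- 1 - int n))"
    using inj s' by (simp add: infsum_reindex o_def infsum_nat)
  finally show "infsum f UNIV = (\<Sum>n. f (int n)) + (\<Sum>n. f (- 1 - int n))" .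
qed

text \<open>Each factor k comes from applying q d/dq, and a termwise derivative converges in the
  same open disc. The induction varies q because differentiation at q needs convergence at the other
  points of the disc.\<close>

lemma summable_poly_powser:
  fixes q :: "'a :: {real_normed_field,banach}"
  assumes "norm q < 1"
  shows "summable (\<lambda>k. of_nat k ^ j * q ^ k)"
  using assms
proof (induction j arbitrary: q)
  case 0
  then show ?case by (simp add: summable_geometric)
next
  case (Suc j)
  have "summable (\<lambda>n. diffs (\<lambda>k. of_nat k ^ j) n * q ^ n)"
    by (rule termdiff_converges[of _ 1]) (use Suc in auto)
  then have "summable (\<lambda>n. q * (diffs (\<lambda>k. of_nat k ^ j) n * q ^ n))"
    by (rule summable_mult)
  then have "summable (\<lambda>n. of_nat (Suc n) ^ Suc j * q ^ Suc n)"
    by (simp add: diffs_def mult_ac)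
  then show ?case by (subst (asm) summable_Suc_iff)
qed

lemma cubes_powser_suminf:
  fixes q :: complex
  assumes q: "norm q < 1"
  shows "(\<Sum>k. of_nat k ^ 3 * q ^ k) = q * (1 + 4 * q + q\<^sup>2) / (1 - q) ^ 4"
proof -
  define a where "a = (\<lambda>j k. (of_nat k :: complex) ^ j * q ^ k)"
  define A where "A = (\<lambda>j. suminf (a j))"
  have s [simp]: "summable (a j)" for j
    unfolding a_def by (rule summable_poly_powser[OF q])
  have q1: "1 - q \<noteq> 0" using q by auto
  have sums: "a j sums A j" for j
    by (simp add: A_def summable_sums)
  \<comment> \<open>For j > 0 the term at 0 vanishes, so dropping it keeps the sum. Expanding (k +
    1)^j in the shifted series then gives a linear equation for \<open>A j\<close> in terms of the
    lower ones.\<close>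
  have shift: "(\<lambda>k. a j (Suc k)) sums A j" if "j > 0" for j
    using sums[of j] that by (subst sums_Suc_iff) (simp add: a_def power_0_left)
  have 0: "A 0 = 1 / (1 - q)"
    using suminf_geometric[OF q] by (simp add: A_def a_def)
  have "(\<lambda>k. a 1 (Suc k)) sums (q * A 1 + q * A 0)"
    using sums_add[OF sums_mult[OF sums[of 1], of q] sums_mult[OF sums[of 0], of q]]
    by (simp add: a_def algebra_simps)
  from sums_unique2[OF shift this] have 1: "A 1 = q * A 1 + q * A 0" by simp
  have "(\<lambda>k. a 2 (Suc k)) sums (q * A 2 + (2 * q * A 1 + q * A 0))"
    using sums_add[OF sums_mult[OF sums[of 2], of q]
        sums_add[OF sums_mult[OF sums[of 1], of "2 * q"] sums_mult[OF sums[of 0], of q]]]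
    by (simp add: a_def algebra_simps power2_eq_square)
  from sums_unique2[OF shift this] have 2: "A 2 = q * A 2 + (2 * q * A 1 + q * A 0)" by simp
  have "(\<lambda>k. a 3 (Suc k)) sums (q * A 3 + (3 * q * A 2 + (3 * q * A 1 + q * A 0)))"
    using sums_add[OF sums_mult[OF sums[of 3], of q] sums_add[OF sums_mult[OF sums[of 2], of "3 * q"]
        sums_add[OF sums_mult[OF sums[of 1], of "3 * q"] sums_mult[OF sums[of 0], of q]]]]
    by (simp add: a_def algebra_simps power2_eq_square power3_eq_cube)
  from sums_unique2[OF shift this]
  have 3: "A 3 = q * A 3 + (3 * q * A 2 + (3 * q * A 1 + q * A 0))" by simp
  have 1: "A 1 = q / (1 - q) ^ 2"
  proof -
    have "(1 - q) * A 1 = q * A 0" using 1 by (simp add: algebra_simps)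
    then show ?thesis using q1 unfolding 0 by (simp add: divide_simps power2_eq_square mult_ac)
  qed
  have "(1 - q) * A 2 = 2 * q * A 1 + q * A 0" using 2 by (simp add: algebra_simps)
  also have "\<dots> = q * (1 + q) / (1 - q) ^ 2"
    unfolding 1 0 using q1 by (simp add: divide_simps power2_eq_square) (simp add: algebra_simps)
  finally have 2: "A 2 = q * (1 + q) / (1 - q) ^ 3"
    using q1 by (simp add: divide_simps power2_eq_square power3_eq_cube mult_ac)
  have "(1 - q) * A 3 = 3 * q * A 2 + 3 * q * A 1 + q * A 0" using 3 by (simp add: algebra_simps)
  also have "\<dots> = q * (1 + 4 * q + q\<^sup>2) / (1 - q) ^ 3"
    unfolding 2 1 0 using q1 by (simp add: divide_simps power2_eq_square power3_eq_cube) (simp add: algebra_simps)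
  finally have "A 3 = q * (1 + 4 * q + q\<^sup>2) / (1 - q) ^ 4"
    using q1 by (simp add: divide_simps power3_eq_cube power4_eq_xxxx mult_ac)
  then show ?thesis by (simp add: A_def a_def)
qed

lemma summable_on_inverse_squares_int: "(\<lambda>n::int. 1 / (1 + (of_int n)\<^sup>2) :: real) summable_on UNIV"
proof -
  have s: "summable (\<lambda>n::nat. 1 / (real n + 1)\<^sup>2)"
    using inverse_squares_sums by (auto simp: sums_iff add.commute)
  have "summable (\<lambda>n. 1 / (1 + (real n)\<^sup>2))"
  proof (rule summable_comparison_test')
    show "summable (\<lambda>n::nat. 2 * (1 / (real n + 1)\<^sup>2))"
      by (rule summable_mult[OF s])
    fix n :: nat
    have "(real n + 1)\<^sup>2 \<le> 2 * (1 + (real n)\<^sup>2)"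
      using zero_le_power2[of "real n - 1"] by (simp add: power2_eq_square algebra_simps)
    then show "norm (1 / (1 + (real n)\<^sup>2)) \<le> 2 * (1 / (real n + 1)\<^sup>2)"
      by (simp add: divide_simps add_pos_nonneg)
  qed
  then have 1: "(\<lambda>n. 1 / (1 + (real n)\<^sup>2)) summable_on UNIV"
    by (intro norm_summable_imp_summable_on) simp
  have "summable (\<lambda>n. 1 / (1 + (- 1 - real n)\<^sup>2))"
  proof (rule summable_comparison_test'[OF s])
    fix n :: nat
    have "(- 1 - real n)\<^sup>2 = (real n + 1)\<^sup>2" by (simp add: power2_eq_square algebra_simps)
    then show "norm (1 / (1 + (- 1 - real n)\<^sup>2)) \<le> 1 / (real n + 1)\<^sup>2"
      by (simp add: divide_simps add_pos_nonneg)
  qed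
  then have 2: "(\<lambda>n. 1 / (1 + (- 1 - real n)\<^sup>2)) summable_on UNIV"
    by (intro norm_summable_imp_summable_on) simp
  show ?thesis
    by (rule summable_on_intI) (use 1 2 in simp_all)
qed

section \<open>The lattice sum of weight 4 and its Fourier expansion\<close>

lemma lattice_bound:
  fixes \<tau> :: complex
  assumes "Im \<tau> > 0"
  obtains C where "\<And>m n :: int. norm (1 / (of_int m * \<tau> + of_int n) ^ 4)
     \<le> C * (1 / (1 + (of_int m)\<^sup>2) * (1 / (1 + (of_int n)\<^sup>2)))"
proof -
  \<comment> \<open>From N^2 \<le> 2 (M x + N)^2 + 2 (M x)^2 one gets M^2 + N^2 \<le> 2 (M x + N)^2
    + (2 x^2 + 1) M^2. The constant \<open>K\<close> dominates both 2 and (2 x^2 + 1)/y^2, so the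
    right side is at most K times the squared norm of the lattice point.\<close>
  define x y K where "x = Re \<tau>" and "y = Im \<tau>" and "K = 2 + (2 * x\<^sup>2 + 1) / y\<^sup>2"
  have y: "y > 0" using assms by (simp add: y_def)
  have K: "K > 0" unfolding K_def using y by (intro add_pos_nonneg) auto
  have "norm (1 / (of_int m * \<tau> + of_int n) ^ 4)
     \<le> 4 * K\<^sup>2 * (1 / (1 + (of_int m)\<^sup>2) * (1 / (1 + (of_int n)\<^sup>2)))" for m n :: int
  proof (cases "m = 0 \<and> n = 0")
    case True then show ?thesis by simp
  next
    case False
    define M N where "M = (of_int m :: real)" and "N = (of_int n :: real)"
    define s where "s = M\<^sup>2 + N\<^sup>2"
    define w where "w = of_int m * \<tau> + of_int n"
    have "m\<^sup>2 + n\<^sup>2 \<ge> 1" using False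
      by (smt (verit) power2_less_0 sum_power2_eq_zero_iff zero_less_power2)
    then have s1: "s \<ge> 1" unfolding s_def M_def N_def
      by (metis of_int_1_le_iff of_int_add of_int_power)
    have w2: "(norm w)\<^sup>2 = (M * x + N)\<^sup>2 + M\<^sup>2 * y\<^sup>2"
      by (simp add: w_def cmod_power2 M_def N_def x_def y_def power_mult_distrib)
    have "N\<^sup>2 \<le> 2 * (M * x + N)\<^sup>2 + 2 * (M * x)\<^sup>2"
      using zero_le_power2[of "2 * (M * x) + N"] by (simp add: power2_eq_square algebra_simps)
    then have "s \<le> 2 * (M * x + N)\<^sup>2 + (2 * x\<^sup>2 + 1) / y\<^sup>2 * (M\<^sup>2 * y\<^sup>2)"
    proof -
      have "(2 * x\<^sup>2 + 1) / y\<^sup>2 * (M\<^sup>2 * y\<^sup>2) = (2 * x\<^sup>2 + 1) * M\<^sup>2"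
        using y by simp
      then show ?thesis using \<open>N\<^sup>2 \<le> _\<close> by (simp add: s_def power_mult_distrib algebra_simps)
    qed
    also have "\<dots> \<le> K * (M * x + N)\<^sup>2 + K * (M\<^sup>2 * y\<^sup>2)"
      by (intro add_mono mult_right_mono) (auto simp: K_def)
    also have "\<dots> = K * (norm w)\<^sup>2" by (simp add: w2 algebra_simps)
    finally have sK: "s \<le> K * (norm w)\<^sup>2" .
    have w0: "norm w \<noteq> 0" using sK s1 by auto
    have "s\<^sup>2 \<le> (K * (norm w)\<^sup>2)\<^sup>2" using sK s1 by (intro power_mono) auto
    then have s2: "s\<^sup>2 \<le> K\<^sup>2 * norm w ^ 4" by (simp add: power_mult_distrib flip: power_mult)
    have "(1 + M\<^sup>2) * (1 + N\<^sup>2) \<le> (1 + s) * (1 + s)"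
      by (intro mult_mono) (auto simp: s_def)
    also have "\<dots> \<le> (2 * s) * (2 * s)" using s1 by (intro mult_mono) auto
    also have "\<dots> \<le> 4 * K\<^sup>2 * norm w ^ 4" using s2 by (simp add: power2_eq_square)
    finally have *: "(1 + M\<^sup>2) * (1 + N\<^sup>2) \<le> 4 * K\<^sup>2 * norm w ^ 4" .
    have "(1 + M\<^sup>2) * (1 + N\<^sup>2) > 0" by (intro mult_pos_pos add_pos_nonneg) auto
    with * w0 have "1 / norm w ^ 4 \<le> 4 * K\<^sup>2 * (1 / ((1 + M\<^sup>2) * (1 + N\<^sup>2)))"
      by (simp add: divide_simps)
    then show ?thesis
      by (simp add: w_def [symmetric] M_def [symmetric] N_def [symmetric] norm_divide norm_power)
  qed
  then show ?thesis using that by blast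
qed

text \<open>The term at \<open>(0, 0)\<close> vanishes because \<open>1 / 0 = 0\<close>.\<close>

definition G4 :: "complex \<Rightarrow> complex" where
  "G4 \<tau> = (\<Sum>\<^sub>\<infinity>(m, n)\<in>(UNIV :: (int \<times> int) set). 1 / (of_int m * \<tau> + of_int n) ^ 4)"

lemma G4_summable:
  fixes \<tau> :: complex
  assumes "Im \<tau> > 0"
  shows "(\<lambda>(m, n). 1 / (of_int m * \<tau> + of_int n) ^ 4) summable_on (UNIV :: (int \<times> int) set)"
proof -
  obtain C where C: "\<And>m n :: int. norm (1 / (of_int m * \<tau> + of_int n) ^ 4)
     \<le> C * (1 / (1 + (of_int m)\<^sup>2) * (1 / (1 + (of_int n)\<^sup>2)))"
    using lattice_bound[OF assms] by blast
  define g where "g = (\<lambda>n::int. 1 / (1 + (of_int n)\<^sup>2) :: real)"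
  have g: "g summable_on UNIV" unfolding g_def by (rule summable_on_inverse_squares_int)
  have "(\<lambda>(m, n). g m * g n) summable_on (SIGMA m:UNIV. UNIV)"
  proof (rule summable_on_SigmaI)
    show "((\<lambda>n. case (m, n) of (m, n) \<Rightarrow> g m * g n) has_sum g m * infsum g UNIV) UNIV" for m
      using g by (auto intro!: has_sum_cmult_right has_sum_infsum)
    show "(\<lambda>m. g m * infsum g UNIV) summable_on UNIV"
      using g by (rule summable_on_cmult_left)
  qed (auto simp: g_def)
  then have "(\<lambda>p. C * (case p of (m, n) \<Rightarrow> g m * g n)) summable_on (UNIV :: (int \<times> int) set)"
    by (intro summable_on_cmult_right) simp
  then have "(\<lambda>p. norm (case p of (m, n) \<Rightarrow> 1 / (of_int m * \<tau> + of_int n) ^ 4)) summable_on (UNIV :: (int \<times> int) set)"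
  proof (rule Infinite_Sum.abs_summable_on_comparison_test')
    fix p :: "int \<times> int"
    show "norm (case p of (m, n) \<Rightarrow> 1 / (of_int m * \<tau> + of_int n) ^ 4)
      \<le> C * (case p of (m, n) \<Rightarrow> g m * g n)" 
      using C by (cases p) (simp add: g_def)
  qed
  then show ?thesis
    by (rule Infinite_Sum.abs_summable_summable)
qed

lemma upper_half_plane_iff [simp]: "\<tau> \<in> upper_half_plane \<longleftrightarrow> 0 < Im \<tau>"
  by (simp add: upper_half_plane_def)

lemma lattice_row_summable:
  fixes z :: complex
  assumes "Im z > 0"
  shows "(\<lambda>n::int. 1 / (z + of_int n) ^ 4) summable_on UNIV"
proof -
  have "(\<lambda>n::int. 1 / (of_int 1 * z + of_int n) ^ 4) summable_on UNIV"
    by (rule summable_on_SigmaD1[of _ UNIV "\<lambda>_. UNIV" "1::int"]) (use G4_summable[OF assms] in auto)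
  then show ?thesis by simp
qed

lemma Polygamma_3_suminf:
  fixes z :: "'a :: {banach,real_normed_field}"
  assumes "z \<noteq> 0"
  shows "(\<Sum>n. 1 / (z + of_nat n) ^ 4) = Polygamma 3 z / 6"
proof -
  have "(\<lambda>k. inverse ((z + of_nat k) ^ Suc 3)) sums ((- 1) ^ Suc 3 * Polygamma 3 z / fact 3)"
    by (rule Polygamma_LIMSEQ[OF assms]) simp
  moreover have "Suc 3 = 4" "fact 3 = (6 :: 'a)" by (simp_all add: fact_numeral)
  ultimately have "(\<lambda>k. inverse ((z + of_nat k) ^ 4)) sums (Polygamma 3 z / 6)"
    by (simp only: \<open>Suc 3 = 4\<close> \<open>fact 3 = 6\<close>) simp
  from sums_unique[OF this] show ?thesis by (simp only: inverse_eq_divide)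
qed

text \<open>The terms with n \<ge> 0 and those with n < 0 are polygamma series at z and 1 - z. Their
  sum is a rational function of sin^2, hence of q, and is recognised as the generating function of
  the cubes. The constant is (2 pi)^4/3!.\<close>

lemma Lipschitz_4:
  fixes z :: complex
  assumes "Im z > 0"
  shows "(\<Sum>\<^sub>\<infinity>n::int. 1 / (z + of_int n) ^ 4)
     = 8 * of_real pi ^ 4 / 3 * (\<Sum>k. of_nat k ^ 3 * exp (2 * of_real pi * \<i> * of_nat k * z))"
proof -
  have z: "z \<notin> \<int>" using assms by (auto elim!: Ints_cases)
  note nz = not_Ints_reflection[OF z]
  define q where "q = exp (2 * of_real pi * \<i> * z)"
  \<comment> \<open>A square root of q: sin (pi z) is rational in \<open>p\<close>, and its square
    is rational in q.\<close>
  define p where "p = exp (of_real pi * \<i> * z)"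
  have qp: "q = p * p" by (simp add: q_def p_def algebra_simps flip: exp_add)
  have q1: "norm q < 1" using assms by (simp add: q_def)
  have p0: "p \<noteq> 0" by (simp add: p_def)
  have sin: "sin (of_real pi * z) = (p - 1 / p) / (2 * \<i>)"
    by (simp add: sin_exp_eq p_def exp_minus field_simps)
  have *: "q \<noteq> 1" "1 - q \<noteq> 0" using q1 by auto
  have sin2: "(sin (of_real pi * z))\<^sup>2 = - (1 - q)\<^sup>2 / (4 * q)"
    unfolding sin qp using p0 by (simp add: divide_simps power2_eq_square) (simp add: algebra_simps)
  have "(\<Sum>\<^sub>\<infinity>n::int. 1 / (z + of_int n) ^ 4)
     = (\<Sum>n. 1 / (z + of_nat n) ^ 4) + (\<Sum>n. 1 / (z - 1 - of_nat n) ^ 4)"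
    using infsum_int(1)[OF lattice_row_summable[OF assms]] by (simp add: algebra_simps)
  also have "(\<lambda>n. 1 / (z - 1 - of_nat n) ^ 4) = (\<lambda>n. 1 / ((1 - z) + of_nat n) ^ 4)"
  proof
    fix n :: nat
    have "z - 1 - of_nat n = - ((1 - z) + of_nat n)" by simp
    then show "1 / (z - 1 - of_nat n) ^ 4 = 1 / ((1 - z) + of_nat n) ^ 4"
      by (simp only: power_minus_even even_numeral)
  qed
  also have "(\<Sum>n. 1 / (z + of_nat n) ^ 4) + (\<Sum>n. 1 / ((1 - z) + of_nat n) ^ 4)
     = (Polygamma 3 z + Polygamma 3 (1 - z)) / 6"
    using Polygamma_3_suminf[OF nz(3)] Polygamma_3_suminf[OF nz(4)] by simp
  also have "\<dots> = of_real pi ^ 4 / 3 * ((3 - 2 * (sin (of_real pi * z))\<^sup>2) / ((sin (of_real pi * z))\<^sup>2)\<^sup>2)"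
    unfolding Polygamma_3_reflection[OF z] by (simp flip: power_mult)
  also have "(3 - 2 * (sin (of_real pi * z))\<^sup>2) / ((sin (of_real pi * z))\<^sup>2)\<^sup>2
      = 8 * (q * (1 + 4 * q + q\<^sup>2) / (1 - q) ^ 4)"
    unfolding sin2 using * qp p0
    by (simp add: divide_simps power2_eq_square power4_eq_xxxx del: qp) (simp add: algebra_simps)
  also have "q * (1 + 4 * q + q\<^sup>2) / (1 - q) ^ 4 = (\<Sum>k. of_nat k ^ 3 * q ^ k)"
    by (rule cubes_powser_suminf[OF q1, symmetric])
  also have "(\<lambda>k. of_nat k ^ 3 * q ^ k) = (\<lambda>k. of_nat k ^ 3 * exp (2 * of_real pi * \<i> * of_nat k * z))"
    by (simp add: q_def mult_ac flip: exp_of_nat_mult)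
  finally show ?thesis by simp
qed

lemma sum_divisors_cube_le:
  "(\<Sum>d | d dvd Suc n. d ^ 3) \<le> Suc n ^ 4"
proof -
  have "(\<Sum>d | d dvd Suc n. d ^ 3) \<le> (\<Sum>d\<in>{1..Suc n}. Suc n ^ 3)"
  proof (rule order_trans[OF sum_mono sum_mono2])
    show "{d. d dvd Suc n} \<subseteq> {1..Suc n}" by (auto simp: Suc_le_eq dvd_imp_le intro!: dvd_pos_nat[of "Suc n"])
  qed (auto simp: dvd_imp_le power_mono)
  also have "\<dots> = Suc n ^ 4" by (simp add: eval_nat_numeral)
  finally show ?thesis .
qed

lemma summable_sum_divisors_powser:
  fixes q :: "'a :: {real_normed_field,banach}"
  assumes "norm q < 1"
  shows "summable (\<lambda>n. of_nat (\<Sum>d | d dvd Suc n. d ^ 3) * q ^ Suc n)"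
proof (rule summable_comparison_test')
  have "summable (\<lambda>n. of_nat n ^ 4 * norm q ^ n)"
    using summable_poly_powser[of "norm q" 4] assms by simp
  then show "summable (\<lambda>n. of_nat (Suc n) ^ 4 * norm q ^ Suc n)"
    by (subst summable_Suc_iff)
  fix n
  have "norm (of_nat (\<Sum>d | d dvd Suc n. d ^ 3) * q ^ Suc n)
      = of_nat (\<Sum>d | d dvd Suc n. d ^ 3) * norm q ^ Suc n"
    by (simp only: norm_mult norm_power norm_of_nat)
  also have "\<dots> \<le> of_nat (Suc n ^ 4) * norm q ^ Suc n"
    using sum_divisors_cube_le by (intro mult_right_mono of_nat_mono) auto
  finally show "norm (of_nat (\<Sum>d | d dvd Suc n. d ^ 3) * q ^ Suc n) \<le> of_nat (Suc n) ^ 4 * norm q ^ Suc n"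
    by simp
qed

text \<open>A term q^(m k) on the left is collected under n = m k on the right, with k running
  through the divisors of n. Absolute convergence, checked on the divisor side, permits the
  rearrangement.\<close>

lemma Lambert_cubes:
  fixes q :: complex
  assumes q: "norm q < 1"
  shows "(\<Sum>m. \<Sum>k. of_nat k ^ 3 * q ^ (Suc m * k)) = (\<Sum>n. of_nat (\<Sum>d | d dvd Suc n. d ^ 3) * q ^ Suc n)"
proof -
  define D where "D = (\<lambda>n. {d. d dvd Suc n})"
  have fin [simp]: "finite (D n)" for n by (simp add: D_def)
  define f where "f = (\<lambda>(n, d). (of_nat d :: complex) ^ 3 * q ^ Suc n)"
  define g where "g = (\<lambda>(m, k). (of_nat (Suc k) :: complex) ^ 3 * q ^ (Suc m * Suc k))"
  have "(\<lambda>p. norm (f p)) summable_on (SIGMA n:UNIV. D n)"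
  proof (rule summable_on_SigmaI)
    show "((\<lambda>d. norm (f (n, d))) has_sum (of_nat (\<Sum>d\<in>D n. d ^ 3) * norm q ^ Suc n)) (D n)" for n
      by (rule has_sum_finiteI) (simp_all add: f_def norm_mult norm_power sum_distrib_right)
    have "summable (\<lambda>n. real (\<Sum>d\<in>D n. d ^ 3) * norm q ^ Suc n)"
      unfolding D_def using q by (intro summable_sum_divisors_powser) auto
    then show "(\<lambda>n. real (\<Sum>d\<in>D n. d ^ 3) * norm q ^ Suc n) summable_on UNIV"
      by (intro norm_summable_imp_summable_on) (simp only: norm_mult norm_power norm_of_nat real_norm_def abs_mult abs_of_nat power_abs abs_norm_cancel)
  qed auto
  then have f: "f summable_on (SIGMA n:UNIV. D n)"
    by (rule Infinite_Sum.abs_summable_summable)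
  \<comment> \<open>The pair (m, k) of positive integers goes to (m k, k). The first entries and k
    are stored minus one, whereas the divisor in the target is stored as it is.\<close>
  have bij: "bij_betw (\<lambda>(m, k). (Suc m * Suc k - 1, Suc k)) UNIV (SIGMA n:UNIV. D n)"
  proof (rule bij_betwI[where g = "\<lambda>(n, d). (Suc n div d - 1, d - 1)"])
    have S: "Suc (Suc m * Suc k - 1) = Suc m * Suc k" for m k by simp
    show "(\<lambda>(m, k). (Suc m * Suc k - 1, Suc k)) \<in> UNIV \<rightarrow> (SIGMA n:UNIV. D n)"
      unfolding D_def by (auto simp only: case_prod_conv S Pi_I mem_Sigma_iff UNIV_I mem_Collect_eq dvd_triv_right split: prod.split)
    show "(\<lambda>(n, d). (Suc n div d - 1, d - 1)) ((\<lambda>(m, k). (Suc m * Suc k - 1, Suc k)) p) = p" for p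
      by (cases p) (simp only: case_prod_conv S nonzero_mult_div_cancel_right nat.distinct(2) not_False_eq_True diff_Suc_1)
    fix p assume "p \<in> (SIGMA n:UNIV. D n)"
    then obtain n d where p: "p = (n, d)" "d dvd Suc n" by (cases p) (auto simp: D_def)
    then obtain c where c: "Suc n = d * c" by (auto elim: dvdE)
    then have pos: "d > 0" "c > 0" by (auto intro: Nat.gr0I)
    have "Suc n div d = c" unfolding c using pos by simp
    moreover have "n = c * d - 1" using diff_Suc_1[of n] unfolding c by (simp add: mult.commute)
    ultimately show "(\<lambda>(m, k). (Suc m * Suc k - 1, Suc k)) ((\<lambda>(n, d). (Suc n div d - 1, d - 1)) p) = p"
      using pos by (simp add: p(1) del: mult_Suc mult_Suc_right)
  qed auto
  have gf: "g = (\<lambda>x. f ((\<lambda>(m, k). (Suc m * Suc k - 1, Suc k)) x))"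
    by (auto simp: g_def f_def fun_eq_iff)
  have g: "g summable_on UNIV"
    unfolding gf using f summable_on_reindex_bij_betw[OF bij, of f] by blast
  have "(\<Sum>n. of_nat (\<Sum>d\<in>D n. d ^ 3) * q ^ Suc n) = (\<Sum>\<^sub>\<infinity>n. of_nat (\<Sum>d\<in>D n. d ^ 3) * q ^ Suc n)"
  proof (rule infsum_nat[symmetric] norm_summable_imp_summable_on)+
    have "summable (\<lambda>n. real (\<Sum>d\<in>D n. d ^ 3) * norm q ^ Suc n)"
      unfolding D_def using q by (intro summable_sum_divisors_powser) auto
    then show "summable (\<lambda>n. norm (of_nat (\<Sum>d\<in>D n. d ^ 3) * q ^ Suc n))"
      by (simp only: norm_mult norm_power norm_of_nat)
  qed
  also have "\<dots> = (\<Sum>\<^sub>\<infinity>n. \<Sum>\<^sub>\<infinity>d\<in>D n. f (n, d))"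
    by (simp add: f_def sum_distrib_right)
  also have "\<dots> = infsum f (SIGMA n:UNIV. D n)"
    by (rule infsum_Sigma_banach[OF f])
  also have "\<dots> = infsum g UNIV"
    unfolding gf by (rule infsum_reindex_bij_betw[OF bij, symmetric])
  also have "\<dots> = (\<Sum>\<^sub>\<infinity>m. \<Sum>\<^sub>\<infinity>k. g (m, k))"
    using infsum_Sigma_banach[of g UNIV "\<lambda>_. UNIV"] g by simp
  also have "\<dots> = (\<Sum>\<^sub>\<infinity>m. \<Sum>k. g (m, k))"
  proof (rule infsum_cong, rule infsum_nat)
    fix m show "(\<lambda>k. g (m, k)) summable_on UNIV"
      using summable_on_SigmaD1[of "\<lambda>x y. g (x, y)" UNIV "\<lambda>_. UNIV" m] g by simp
  qed
  also have "\<dots> = (\<Sum>m. \<Sum>k. g (m, k))"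
  proof (rule infsum_nat)
    have "(\<lambda>m. \<Sum>\<^sub>\<infinity>k. g (m, k)) summable_on UNIV"
      using summable_on_Sigma_banach[of "\<lambda>x y. g (x, y)" UNIV "\<lambda>_. UNIV"] g by simp
    moreover have "(\<lambda>m. \<Sum>\<^sub>\<infinity>k. g (m, k)) = (\<lambda>m. \<Sum>k. g (m, k))"
    proof (rule ext, rule infsum_nat)
      fix m show "(\<lambda>k. g (m, k)) summable_on UNIV"
        using summable_on_SigmaD1[of "\<lambda>x y. g (x, y)" UNIV "\<lambda>_. UNIV" m] g by simp
    qed
    ultimately show "(\<lambda>m. \<Sum>k. g (m, k)) summable_on UNIV" by simp
  qed
  also have "(\<lambda>m. \<Sum>k. g (m, k)) = (\<lambda>m. \<Sum>k. of_nat k ^ 3 * q ^ (Suc m * k))"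
  proof
    fix m
    have "norm (q ^ Suc m) < 1" 
      using q power_decreasing[of 1 "Suc m" "norm q"] unfolding norm_power by simp
    then have "summable (\<lambda>k. of_nat k ^ 3 * (q ^ Suc m) ^ k)"
      by (rule summable_poly_powser)
    from suminf_split_head[OF this]
    show "(\<Sum>k. g (m, k)) = (\<Sum>k. of_nat k ^ 3 * q ^ (Suc m * k))"
      by (simp only: g_def case_prod_conv power_mult) simp
  qed
  finally show ?thesis by (simp add: D_def)
qed

text \<open>The row m = 0 gives 2 zeta(4) = pi^4/45. The rows m and -m are equal and are summed by
  \<open>Lipschitz_4\<close>, so the other rows have the factor 16 pi^4/3 = 240 pi^4/45, which is
  the coefficient 240 of E4.\<close>

lemma G4_eq_E4:
  assumes \<tau>: "Im \<tau> > 0"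
  shows "G4 \<tau> = of_real pi ^ 4 / 45 * E4 \<tau>"
proof -
  define H where "H = (\<lambda>m::int. \<Sum>\<^sub>\<infinity>n::int. 1 / (of_int m * \<tau> + of_int n) ^ 4)"
  define q where "q = exp (2 * of_real pi * \<i> * \<tau>)"
  have q: "norm q < 1" using \<tau> by (simp add: q_def)
  have qk: "q ^ k = exp (2 * of_real pi * \<i> * of_nat k * \<tau>)" for k
    by (simp add: q_def mult_ac flip: exp_of_nat_mult)
  have G: "(\<lambda>(m, n). 1 / (of_int m * \<tau> + of_int n) ^ 4) summable_on (UNIV :: int set) \<times> (UNIV :: int set)"
    using G4_summable[OF \<tau>] by simp
  have row: "(\<lambda>n::int. 1 / (of_int m * \<tau> + of_int n) ^ 4) summable_on UNIV" for m :: int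
    by (rule summable_on_SigmaD1[of _ UNIV "\<lambda>_. UNIV" m]) (use G in auto)
  have H: "H summable_on UNIV" "G4 \<tau> = infsum H UNIV"
    using summable_on_Sigma_banach[OF G] infsum_Sigma'_banach[OF G]
    by (simp_all add: H_def G4_def)
  have H_minus: "H (- m) = H m" for m
    unfolding H_def
  proof (rule infsum_reindex_bij_witness[of _ uminus uminus])
    fix n :: int
    have "of_int m * \<tau> + of_int (- n) = - (of_int (- m) * \<tau> + of_int n)" by simp
    then show "1 / (of_int m * \<tau> + of_int (- n)) ^ 4 = 1 / (of_int (- m) * \<tau> + of_int n) ^ 4"
      by (simp only: power_minus_even even_numeral)
  qed auto
  have zeta: "(\<Sum>n. 1 / of_nat (Suc n) ^ 4) = of_real pi ^ 4 / (90 :: complex)"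
  proof -
    have "Polygamma 3 (1 :: complex) = of_real (pi ^ 4 / 15)"
      using Polygamma_of_real[of 1 3, where 'a = complex] Polygamma_3_at_1 by simp
    moreover have "(\<Sum>n. 1 / of_nat (Suc n) ^ 4) = Polygamma 3 (1 :: complex) / 6"
      using Polygamma_3_suminf[of "1::complex"] by (simp only: of_nat_Suc) simp
    ultimately show ?thesis by (simp only:) simp
  qed
  have sumz: "summable (\<lambda>n. 1 / of_nat (Suc n) ^ 4 :: complex)"
    using Polygamma_converges'[of "1::complex" 4] by (simp add: divide_inverse add.commute)
  have H0: "H 0 = of_real pi ^ 4 / 45"
  proof -
    have "H 0 = (\<Sum>n. 1 / of_nat n ^ 4) + (\<Sum>n. 1 / (- 1 - of_nat n) ^ 4)"
      using infsum_int(1)[OF row[of 0]] by (simp add: H_def)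
    also have "(\<lambda>n. 1 / (- 1 - of_nat n) ^ 4) = (\<lambda>n. 1 / of_nat (Suc n) ^ 4 :: complex)"
    proof
      fix n :: nat
      have "- 1 - of_nat n = - (of_nat (Suc n) :: complex)" by simp
      then show "1 / (- 1 - of_nat n) ^ 4 = 1 / (of_nat (Suc n) :: complex) ^ 4"
        by (simp only: power_minus_even even_numeral)
    qed
    also have "(\<Sum>n. 1 / of_nat n ^ 4) = (\<Sum>n. 1 / of_nat (Suc n) ^ 4 :: complex)"
      using suminf_split_head[of "\<lambda>n. 1 / of_nat n ^ 4 :: complex"] sumz
      by (subst (asm) summable_Suc_iff) auto
    finally show ?thesis unfolding zeta by simp
  qed
  have HS: "H (int (Suc m)) = 8 * of_real pi ^ 4 / 3 * (\<Sum>k. of_nat k ^ 3 * q ^ (Suc m * k))" for m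
  proof -
    have "H (int (Suc m)) = 8 * of_real pi ^ 4 / 3 *
       (\<Sum>k. of_nat k ^ 3 * exp (2 * of_real pi * \<i> * of_nat k * (of_nat (Suc m) * \<tau>)))"
      unfolding H_def of_int_of_nat_eq by (rule Lipschitz_4) (use \<tau> in simp)
    then show ?thesis by (simp only: qk of_nat_mult mult_ac)
  qed
  have "G4 \<tau> = (\<Sum>m. H (int m)) + (\<Sum>m. H (int (Suc m)))"
  proof -
    have "- 1 - int m = - int (Suc m)" for m by simp
    then show ?thesis unfolding H(2) infsum_int(1)[OF H(1)] by (simp only: H_minus)
  qed
  also have "(\<Sum>m. H (int m)) = H 0 + (\<Sum>m. H (int (Suc m)))"
  proof -
    have "summable (\<lambda>m. H (int m))"
      using infsum_int(2)[OF H(1)] has_sum_imp_sums[OF has_sum_infsum] by (blast intro: sums_summable)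
    from suminf_split_head[OF this] show ?thesis by simp
  qed
  also have "(\<Sum>m. H (int (Suc m))) = 8 * of_real pi ^ 4 / 3 * (\<Sum>m. \<Sum>k. of_nat k ^ 3 * q ^ (Suc m * k))"
  proof -
    have "summable (\<lambda>m. H (int m))"
      using infsum_int(2)[OF H(1)] has_sum_imp_sums[OF has_sum_infsum] by (blast intro: sums_summable)
    then have "summable (\<lambda>m. H (int (Suc m)))" by (subst summable_Suc_iff)
    then have "summable (\<lambda>m. 3 / (8 * of_real pi ^ 4) * H (int (Suc m)))" by (rule summable_mult)
    then have "summable (\<lambda>m. \<Sum>k. of_nat k ^ 3 * q ^ (Suc m * k))"
      unfolding HS by (simp del: of_nat_Suc power_Suc mult_Suc)
    then show ?thesis unfolding HS by (rule suminf_mult)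
  qed
  also have "(\<Sum>m. \<Sum>k. of_nat k ^ 3 * q ^ (Suc m * k)) = (\<Sum>n. of_nat (\<Sum>d | d dvd Suc n. d ^ 3) * q ^ Suc n)"
    by (rule Lambert_cubes[OF q])
  finally have "G4 \<tau> = of_real pi ^ 4 / 45 + 16 * of_real pi ^ 4 / 3 * (\<Sum>n. of_nat (\<Sum>d | d dvd Suc n. d ^ 3) * q ^ Suc n)"
    unfolding H0 by simp
  then show ?thesis unfolding E4_def qk by (simp add: algebra_simps)
qed

section \<open>Transformation laws of E4 and its derivatives\<close>

definition aut_factor :: "int^2^2 \<Rightarrow> complex \<Rightarrow> complex" where
  "aut_factor A \<tau> = of_int (A$2$1) * \<tau> + of_int (A$2$2)"

lemma SL2Z_det: "A \<in> carrier SL2Z \<longleftrightarrow> A$1$1 * A$2$2 - A$1$2 * A$2$1 = 1"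
  by (simp add: SL2Z_def det_2)

lemma aut_factor_nonzero:
  assumes "A \<in> carrier SL2Z" "Im \<tau> > 0"
  shows "aut_factor A \<tau> \<noteq> 0"
proof
  assume "aut_factor A \<tau> = 0"
  then have "Im (aut_factor A \<tau>) = 0" "Re (aut_factor A \<tau>) = 0" by simp_all
  then have "A$2$1 = 0" "A$2$2 = 0" using assms(2) by (auto simp: aut_factor_def)
  then show False using assms(1) by (simp add: SL2Z_det)
qed

lemma G4_moebius:
  assumes A: "A \<in> carrier SL2Z" and \<tau>: "Im \<tau> > 0"
  shows "G4 (moebius A \<tau>) = aut_factor A \<tau> ^ 4 * G4 \<tau>"
proof -
  define a b c d where "a = A$1$1" and "b = A$1$2" and "c = A$2$1" and "d = A$2$2"
  have det: "a * d - b * c = 1" using A by (simp add: SL2Z_det a_def b_def c_def d_def)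
  define j where "j = aut_factor A \<tau>"
  have j: "j \<noteq> 0" using aut_factor_nonzero[OF assms] by (simp add: j_def)
  have jcd: "j = of_int c * \<tau> + of_int d" by (simp add: j_def aut_factor_def c_def d_def)
  define f where "f = (\<lambda>(m, n). 1 / (of_int m * \<tau> + of_int n) ^ 4)"
  have bij: "bij_betw (\<lambda>(m, n). (m * a + n * c, m * b + n * d)) UNIV (UNIV :: (int \<times> int) set)"
  proof (rule bij_betwI[where g = "\<lambda>(x, y). (x * d - y * c, y * a - x * b)"])
    fix p :: "int \<times> int"
    obtain m n where p: "p = (m, n)" by (cases p)
    have "(m * a + n * c) * d - (m * b + n * d) * c = m * (a * d - b * c)"
      "(m * b + n * d) * a - (m * a + n * c) * b = n * (a * d - b * c)"
      "(m * d - n * c) * a + (n * a - m * b) * c = m * (a * d - b * c)"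
      "(m * d - n * c) * b + (n * a - m * b) * d = n * (a * d - b * c)"
      by (simp_all add: algebra_simps)
    then show "(\<lambda>(x, y). (x * d - y * c, y * a - x * b)) ((\<lambda>(m, n). (m * a + n * c, m * b + n * d)) p) = p"
      "(\<lambda>(m, n). (m * a + n * c, m * b + n * d)) ((\<lambda>(x, y). (x * d - y * c, y * a - x * b)) p) = p"
      by (simp_all add: p det)
  qed auto
  have "of_int m * moebius A \<tau> + of_int n = (of_int (m * a + n * c) * \<tau> + of_int (m * b + n * d)) / j" for m n
    using j unfolding moebius_def jcd a_def [symmetric] b_def [symmetric] c_def [symmetric] d_def [symmetric]
    by (simp add: divide_simps) (simp add: algebra_simps)
  then have "G4 (moebius A \<tau>) = (\<Sum>\<^sub>\<infinity>p. j ^ 4 * f ((\<lambda>(m, n). (m * a + n * c, m * b + n * d)) p))"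
    using j unfolding G4_def f_def by (intro infsum_cong) (auto simp: power_divide simp del: of_int_add of_int_mult)
  also have "\<dots> = (\<Sum>\<^sub>\<infinity>p. j ^ 4 * f p)"
    by (rule infsum_reindex_bij_betw[OF bij])
  also have "\<dots> = j ^ 4 * infsum f UNIV"
    by (rule infsum_cmult_right) (use G4_summable[OF \<tau>] f_def in auto)
  finally show ?thesis by (simp add: j_def f_def G4_def)
qed

text \<open>Limits along this filter are uniform in the real part, which is what bounds a function
  on a whole half-plane Im \<tau> \<ge> Y.\<close>

abbreviation im_infinity :: "complex filter" where "im_infinity \<equiv> filtercomap Im at_top"

lemma open_upper_half_plane: "open upper_half_plane"
  unfolding upper_half_plane_def by (rule open_halfspace_Im_gt)

lemma connected_upper_half_plane: "connected upper_half_plane"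
  unfolding upper_half_plane_def by (intro convex_connected convex_halfspace_Im_gt)

lemma moebius_aut_factor:
  assumes "A \<in> carrier SL2Z" "Im \<tau> > 0"
  shows "aut_factor A \<tau> * moebius A \<tau> = of_int (A$1$1) * \<tau> + of_int (A$1$2)"
  using aut_factor_nonzero[OF assms] by (simp add: moebius_def aut_factor_def)

lemma Im_moebius:
  assumes A: "A \<in> carrier SL2Z" and \<tau>: "Im \<tau> > 0"
  shows "Im (moebius A \<tau>) = Im \<tau> / (norm (aut_factor A \<tau>))\<^sup>2"
proof -
  define j where "j = aut_factor A \<tau>"
  have j: "j \<noteq> 0" using aut_factor_nonzero[OF assms] by (simp add: j_def)
  define a b c d where "a = real_of_int (A$1$1)" and "b = real_of_int (A$1$2)"
    and "c = real_of_int (A$2$1)" and "d = real_of_int (A$2$2)"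
  have "a * d - b * c = real_of_int (A$1$1 * A$2$2 - A$1$2 * A$2$1)"
    by (simp add: a_def b_def c_def d_def)
  then have det: "a * d - b * c = 1" using A by (simp only: SL2Z_det of_int_1)
  have jcd: "j = of_real c * \<tau> + of_real d" by (simp add: j_def aut_factor_def c_def d_def)
  have "moebius A \<tau> = (of_real a * \<tau> + of_real b) / j"
    by (simp add: moebius_def j_def aut_factor_def a_def b_def)
  then have "moebius A \<tau> = (of_real a * \<tau> + of_real b) * cnj j / of_real ((norm j)\<^sup>2)"
    using complex_div_cnj[of "of_real a * \<tau> + of_real b" j] by simp
  then have "Im (moebius A \<tau>) = Im ((of_real a * \<tau> + of_real b) * cnj j) / (norm j)\<^sup>2"
    by (simp only: Im_divide_of_real)
  also have "Im ((of_real a * \<tau> + of_real b) * cnj j) = (a * d - b * c) * Im \<tau>"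
    by (simp add: jcd algebra_simps)
  finally show ?thesis by (simp add: det j_def)
qed

lemma Im_moebius_pos:
  assumes "A \<in> carrier SL2Z" "Im \<tau> > 0"
  shows "Im (moebius A \<tau>) > 0"
  using assms aut_factor_nonzero[OF assms] by (simp add: Im_moebius)

lemma has_field_derivative_aut_factor [derivative_intros]:
  "(aut_factor A has_field_derivative of_int (A$2$1)) (at \<tau> within S)"
  unfolding aut_factor_def [abs_def] by (auto intro!: derivative_eq_intros)

lemma has_field_derivative_moebius:
  assumes A: "A \<in> carrier SL2Z" and \<tau>: "Im \<tau> > 0"
  shows "(moebius A has_field_derivative 1 / (aut_factor A \<tau>)\<^sup>2) (at \<tau>)"
proof -
  have "of_int (A$1$1 * A$2$2 - A$1$2 * A$2$1) = (1::complex)"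
    using A unfolding SL2Z_det by simp
  then have det: "of_int (A$1$1) * of_int (A$2$2) - of_int (A$1$2) * of_int (A$2$1) = (1::complex)"
    by simp
  show ?thesis
    unfolding moebius_def [abs_def]
    apply (rule derivative_eq_intros refl)+
    using aut_factor_nonzero[OF assms] unfolding aut_factor_def apply simp
    using aut_factor_nonzero[OF assms] unfolding aut_factor_def
    apply (simp add: divide_simps power2_eq_square)
    using det by algebra
qed

lemma E4_moebius:
  assumes "A \<in> carrier SL2Z" "Im \<tau> > 0"
  shows "E4 (moebius A \<tau>) = aut_factor A \<tau> ^ 4 * E4 \<tau>"
  using G4_moebius[OF assms] G4_eq_E4[OF assms(2)] G4_eq_E4[OF Im_moebius_pos[OF assms]] by simp

text \<open>One factor q is split off the Fourier series, so that the value and the derivative of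
  \<open>E4_fourier\<close> at 0 can be read off.\<close>

definition E4_tail :: "complex \<Rightarrow> complex" where
  "E4_tail q = (\<Sum>n. of_nat (\<Sum>d | d dvd Suc n. d ^ 3) * q ^ n)"

definition E4_fourier :: "complex \<Rightarrow> complex" where
  "E4_fourier q = 1 + 240 * (q * E4_tail q)"

lemma E4_tail_sums:
  assumes "norm q < 1"
  shows "(\<lambda>n. of_nat (\<Sum>d | d dvd Suc n. d ^ 3) * q ^ n) sums E4_tail q"
proof (cases "q = 0")
  case True
  then show ?thesis unfolding E4_tail_def using powser_sums_zero
    by (intro summable_sums sums_summable) auto
next
  case False
  have "summable (\<lambda>n. 1 / q * (of_nat (\<Sum>d | d dvd Suc n. d ^ 3) * q ^ Suc n))"
    by (intro summable_mult summable_sum_divisors_powser assms)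
  then have "summable (\<lambda>n. of_nat (\<Sum>d | d dvd Suc n. d ^ 3) * q ^ n)"
    using False by (simp add: mult_ac del: of_nat_sum of_nat_power)
  then show ?thesis unfolding E4_tail_def by (rule summable_sums)
qed

lemma E4_tail_holomorphic: "E4_tail holomorphic_on ball 0 1"
  by (rule power_series_holomorphic[of _ _ "\<lambda>n. of_nat (\<Sum>d | d dvd Suc n. d ^ 3)"])
     (use E4_tail_sums in \<open>simp del: of_nat_sum of_nat_power\<close>)

lemma E4_fourier_holomorphic: "E4_fourier holomorphic_on ball 0 1"
  unfolding E4_fourier_def [abs_def] by (intro holomorphic_intros E4_tail_holomorphic)

lemma deriv_E4_fourier_0: "deriv E4_fourier 0 = 240"
proof -
  have "E4_tail 0 = 1"
    using powser_zero[of "\<lambda>n. of_nat (\<Sum>d | d dvd Suc n. d ^ 3) :: complex"]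
    by (simp add: E4_tail_def)
  moreover have "(E4_tail has_field_derivative deriv E4_tail 0) (at 0)"
    using E4_tail_holomorphic by (intro holomorphic_derivI[of _ "ball 0 1"]) auto
  then have "(E4_fourier has_field_derivative 240 * E4_tail 0) (at 0)"
    unfolding E4_fourier_def [abs_def] by (auto intro!: derivative_eq_intros)
  ultimately show ?thesis by (simp add: DERIV_imp_deriv)
qed

lemma E4_eq_fourier:
  assumes "Im \<tau> > 0"
  shows "E4 \<tau> = E4_fourier (exp (2 * of_real pi * \<i> * \<tau>))"
proof -
  define q where "q = exp (2 * of_real pi * \<i> * \<tau>)"
  have q: "norm q < 1" using assms by (simp add: q_def)
  have qk: "q ^ k = exp (2 * of_real pi * \<i> * of_nat k * \<tau>)" for k
    by (simp add: q_def mult_ac flip: exp_of_nat_mult)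
  have "(\<lambda>n. q * (of_nat (\<Sum>d | d dvd Suc n. d ^ 3) * q ^ n)) sums (q * E4_tail q)"
    by (rule sums_mult[OF E4_tail_sums[OF q]])
  then have "(\<lambda>n. of_nat (\<Sum>d | d dvd Suc n. d ^ 3) * q ^ Suc n) sums (q * E4_tail q)"
    by (simp add: mult_ac del: of_nat_sum of_nat_power)
  then show ?thesis
    unfolding E4_def E4_fourier_def q_def [symmetric] qk [symmetric] by (simp only: sums_iff)
qed

lemma has_field_derivative_q:
  "((\<lambda>\<tau>. exp (2 * of_real pi * \<i> * \<tau>)) has_field_derivative 2 * of_real pi * \<i> * exp (2 * of_real pi * \<i> * \<tau>)) (at \<tau>)"
  by (auto intro!: derivative_eq_intros)

lemma E4_holomorphic: "E4 holomorphic_on upper_half_plane"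
proof -
  have "(E4_fourier \<circ> (\<lambda>\<tau>. exp (2 * of_real pi * \<i> * \<tau>))) holomorphic_on upper_half_plane"
    by (intro holomorphic_on_compose_gen[OF _ E4_fourier_holomorphic] holomorphic_intros) auto
  then show ?thesis
    by (rule holomorphic_transform) (simp add: E4_eq_fourier)
qed

lemma E4_deriv:
  assumes "Im \<tau> > 0"
  shows "(E4 has_field_derivative deriv E4 \<tau>) (at \<tau>)"
    "(deriv E4 has_field_derivative deriv (deriv E4) \<tau>) (at \<tau>)"
  using assms E4_holomorphic
  by (auto intro!: holomorphic_derivI[of _ upper_half_plane] holomorphic_deriv open_upper_half_plane)

lemma deriv_E4_moebius:
  assumes A: "A \<in> carrier SL2Z" and \<tau>: "Im \<tau> > 0"
  shows "deriv E4 (moebius A \<tau>) = aut_factor A \<tau> ^ 6 * deriv E4 \<tau>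
    + 4 * of_int (A$2$1) * aut_factor A \<tau> ^ 5 * E4 \<tau>"
proof -
  let ?c = "of_int (A$2$1) :: complex"
  have j: "aut_factor A \<tau> \<noteq> 0" using aut_factor_nonzero[OF assms] .
  have "deriv E4 (moebius A \<tau>) * (1 / (aut_factor A \<tau>)\<^sup>2)
      = 4 * ?c * aut_factor A \<tau> ^ 3 * E4 \<tau> + aut_factor A \<tau> ^ 4 * deriv E4 \<tau>"
  proof (rule DERIV_eq_on_open[of "\<lambda>\<tau>. E4 (moebius A \<tau>)" _ \<tau> "\<lambda>\<tau>. aut_factor A \<tau> ^ 4 * E4 \<tau>" _ upper_half_plane])
    show "((\<lambda>\<tau>. E4 (moebius A \<tau>)) has_field_derivative deriv E4 (moebius A \<tau>) * (1 / (aut_factor A \<tau>)\<^sup>2)) (at \<tau>)"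
      by (rule DERIV_chain2[OF E4_deriv(1) has_field_derivative_moebius]) (use assms Im_moebius_pos in auto)
    show "((\<lambda>\<tau>. aut_factor A \<tau> ^ 4 * E4 \<tau>) has_field_derivative
        4 * ?c * aut_factor A \<tau> ^ 3 * E4 \<tau> + aut_factor A \<tau> ^ 4 * deriv E4 \<tau>) (at \<tau>)"
      by (rule derivative_eq_intros E4_deriv \<tau> refl)+ (simp add: algebra_simps)
  qed (use assms open_upper_half_plane E4_moebius in auto)
  then have "deriv E4 (moebius A \<tau>) = (4 * ?c * aut_factor A \<tau> ^ 3 * E4 \<tau> + aut_factor A \<tau> ^ 4 * deriv E4 \<tau>) * (aut_factor A \<tau>)\<^sup>2"
    using j by (simp add: divide_simps)
  then show ?thesis by (simp add: algebra_simps flip: power_add)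
qed

text \<open>Differentiation of \<open>deriv_E4_moebius\<close>: the coefficient 10 is 6 + 4, one
  part from each summand, and 20 is 4 times 5.\<close>

lemma deriv2_E4_moebius:
  assumes A: "A \<in> carrier SL2Z" and \<tau>: "Im \<tau> > 0"
  shows "deriv (deriv E4) (moebius A \<tau>) = aut_factor A \<tau> ^ 8 * deriv (deriv E4) \<tau>
    + 10 * of_int (A$2$1) * aut_factor A \<tau> ^ 7 * deriv E4 \<tau>
    + 20 * (of_int (A$2$1))\<^sup>2 * aut_factor A \<tau> ^ 6 * E4 \<tau>"
proof -
  let ?c = "of_int (A$2$1) :: complex"
  have j: "aut_factor A \<tau> \<noteq> 0" using aut_factor_nonzero[OF assms] .
  have "deriv (deriv E4) (moebius A \<tau>) * (1 / (aut_factor A \<tau>)\<^sup>2)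
      = aut_factor A \<tau> ^ 6 * deriv (deriv E4) \<tau> + 10 * ?c * aut_factor A \<tau> ^ 5 * deriv E4 \<tau> + 20 * ?c\<^sup>2 * aut_factor A \<tau> ^ 4 * E4 \<tau>"
  proof (rule DERIV_eq_on_open[of "\<lambda>\<tau>. deriv E4 (moebius A \<tau>)" _ \<tau>
        "\<lambda>\<tau>. aut_factor A \<tau> ^ 6 * deriv E4 \<tau> + 4 * of_int (A$2$1) * aut_factor A \<tau> ^ 5 * E4 \<tau>" _ upper_half_plane])
    show "((\<lambda>\<tau>. deriv E4 (moebius A \<tau>)) has_field_derivative deriv (deriv E4) (moebius A \<tau>) * (1 / (aut_factor A \<tau>)\<^sup>2)) (at \<tau>)"
      by (rule DERIV_chain2[OF E4_deriv(2) has_field_derivative_moebius]) (use assms Im_moebius_pos in auto)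
    show "((\<lambda>\<tau>. aut_factor A \<tau> ^ 6 * deriv E4 \<tau> + 4 * of_int (A$2$1) * aut_factor A \<tau> ^ 5 * E4 \<tau>) has_field_derivative
        aut_factor A \<tau> ^ 6 * deriv (deriv E4) \<tau> + 10 * ?c * aut_factor A \<tau> ^ 5 * deriv E4 \<tau> + 20 * ?c\<^sup>2 * aut_factor A \<tau> ^ 4 * E4 \<tau>) (at \<tau>)"
      by (rule derivative_eq_intros E4_deriv \<tau> refl)+ (simp add: algebra_simps power2_eq_square)
  qed (use assms open_upper_half_plane deriv_E4_moebius in auto)
  then have "deriv (deriv E4) (moebius A \<tau>) = (aut_factor A \<tau> ^ 6 * deriv (deriv E4) \<tau> + 10 * ?c * aut_factor A \<tau> ^ 5 * deriv E4 \<tau> + 20 * ?c\<^sup>2 * aut_factor A \<tau> ^ 4 * E4 \<tau>) * (aut_factor A \<tau>)\<^sup>2"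
    using j by (simp add: divide_simps)
  then show ?thesis by (simp add: algebra_simps flip: power_add)
qed

text \<open>The second Rankin-Cohen bracket of E4 with itself, in general k f f'' - (k + 1) f'^2 for
  a form f of weight k. It is a constant multiple of the discriminant and is built from E4
  alone.\<close>

definition cusp_form12 :: "complex \<Rightarrow> complex" where
  "cusp_form12 \<tau> = 4 * E4 \<tau> * deriv (deriv E4) \<tau> - 5 * (deriv E4 \<tau>)\<^sup>2"

lemma cusp_form12_holomorphic: "cusp_form12 holomorphic_on upper_half_plane"
  unfolding cusp_form12_def [abs_def]
  by (intro holomorphic_intros holomorphic_deriv E4_holomorphic open_upper_half_plane)

text \<open>The terms with the lower left entry c cancel: 4 times 10 equals 5 times 2 times 4 in
  degree one, and 4 times 20 equals 5 times 4^2 in degree two.\<close>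

lemma cusp_form12_moebius:
  assumes "A \<in> carrier SL2Z" "Im \<tau> > 0"
  shows "cusp_form12 (moebius A \<tau>) = aut_factor A \<tau> ^ 12 * cusp_form12 \<tau>"
  unfolding cusp_form12_def E4_moebius[OF assms] deriv_E4_moebius[OF assms] deriv2_E4_moebius[OF assms]
  by algebra

lemma eventually_im_infinity: "\<forall>\<^sub>F \<tau> in im_infinity. Im \<tau> > c"
  by (rule eventually_filtercomapI[OF eventually_gt_at_top])

lemma im_infinity_nontrivial: "im_infinity \<noteq> bot"
  by (rule filtercomap_neq_bot_surj) (auto intro!: surjI[of _ "\<lambda>y. Complex 0 y"])

text \<open>The width is real rather than integral because the quotient of q by the sixth power of
  the local parameter is again such an exponential, of width m/(m - 6).\<close>

lemma tendsto_q_im_infinity: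
  fixes m :: real
  assumes "m > 0"
  shows "((\<lambda>\<tau>. exp (2 * of_real pi * \<i> * \<tau> / of_real m)) \<longlongrightarrow> 0) im_infinity"
proof (rule tendsto_norm_zero_cancel)
  have "((\<lambda>y. exp (- (2 * pi / m) * y)) \<longlongrightarrow> 0) at_top"
    using assms by real_asymp
  then have "((\<lambda>\<tau>. exp (- (2 * pi / m) * Im \<tau>)) \<longlongrightarrow> 0) im_infinity"
    by (rule filterlim_compose) (rule filterlim_filtercomap)
  then show "((\<lambda>\<tau>. norm (exp (2 * of_real pi * \<i> * \<tau> / of_real m))) \<longlongrightarrow> 0) im_infinity"
    by (simp add: Re_divide_of_real algebra_simps)
qed

text \<open>The zero at \<infinity> is exactly simple in q: each term of \<open>cusp_form12\<close>
  contains a derivative in \<tau>, and every such derivative brings a factor q.\<close>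

lemma cusp_form12_im_infinity:
  obtains L where "L \<noteq> 0" "((\<lambda>\<tau>. cusp_form12 \<tau> / exp (2 * of_real pi * \<i> * \<tau>)) \<longlongrightarrow> L) im_infinity"
proof -
  define e where "e = E4_fourier"
  define Q where "Q = (\<lambda>\<tau>. exp (2 * of_real pi * \<i> * \<tau>))"
  define k where "k = 2 * of_real pi * \<i>"
  have hol: "e holomorphic_on ball 0 1" "deriv e holomorphic_on ball 0 1" "deriv (deriv e) holomorphic_on ball 0 1"
    unfolding e_def by (auto intro!: E4_fourier_holomorphic holomorphic_deriv)
  have der: "(e has_field_derivative deriv e z) (at z)" "(deriv e has_field_derivative deriv (deriv e) z) (at z)"
    if "norm z < 1" for z
    using that hol by (auto intro!: holomorphic_derivI[of _ "ball 0 1"])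
  have Q1: "norm (Q \<tau>) < 1" if "Im \<tau> > 0" for \<tau> using that by (simp add: Q_def)
  have dQ: "(Q has_field_derivative k * Q \<tau>) (at \<tau>)" for \<tau>
    unfolding Q_def k_def by (rule has_field_derivative_q)
  have 1: "deriv E4 \<tau> = deriv e (Q \<tau>) * (k * Q \<tau>)" if "Im \<tau> > 0" for \<tau>
  proof (rule DERIV_eq_on_open[OF E4_deriv(1)[OF that] _ open_upper_half_plane])
    show "((\<lambda>\<tau>. e (Q \<tau>)) has_field_derivative deriv e (Q \<tau>) * (k * Q \<tau>)) (at \<tau>)"
      by (rule DERIV_chain2[OF der(1) dQ]) (use Q1 that in auto)
  qed (use that in \<open>auto simp: E4_eq_fourier e_def Q_def\<close>)
  have 2: "deriv (deriv E4) \<tau> = deriv (deriv e) (Q \<tau>) * (k * Q \<tau>) * (k * Q \<tau>) + k * (k * Q \<tau>) * deriv e (Q \<tau>)"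
    if "Im \<tau> > 0" for \<tau>
  proof (rule DERIV_eq_on_open[OF E4_deriv(2)[OF that] _ open_upper_half_plane])
    have "((\<lambda>\<tau>. deriv e (Q \<tau>)) has_field_derivative deriv (deriv e) (Q \<tau>) * (k * Q \<tau>)) (at \<tau>)"
      by (rule DERIV_chain2[OF der(2) dQ]) (use Q1 that in auto)
    from DERIV_mult[OF this DERIV_cmult[OF dQ, of k]]
    show "((\<lambda>\<tau>. deriv e (Q \<tau>) * (k * Q \<tau>)) has_field_derivative
       deriv (deriv e) (Q \<tau>) * (k * Q \<tau>) * (k * Q \<tau>) + k * (k * Q \<tau>) * deriv e (Q \<tau>)) (at \<tau>)"
      by simp
  qed (use that in \<open>auto simp: 1\<close>)
  \<comment> \<open>What is left of \<open>cusp_form12\<close> after division by q, as a function of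
    q. At 0 it equals 4 times 240 times k^2, which is not 0.\<close>
  define g where "g = (\<lambda>q. k\<^sup>2 * (4 * e q * (deriv e q + q * deriv (deriv e) q) - 5 * q * (deriv e q)\<^sup>2))"
  have g: "cusp_form12 \<tau> / exp (2 * of_real pi * \<i> * \<tau>) = g (Q \<tau>)" if "Im \<tau> > 0" for \<tau>
  proof -
    have E: "E4 \<tau> = e (Q \<tau>)" using that by (simp add: E4_eq_fourier e_def Q_def)
    have "cusp_form12 \<tau> = Q \<tau> * g (Q \<tau>)"
      unfolding cusp_form12_def 1[OF that] 2[OF that] g_def E
      by (simp add: algebra_simps power2_eq_square)
    moreover have "Q \<tau> \<noteq> 0" by (simp add: Q_def)
    ultimately show ?thesis by (simp add: Q_def)
  qed
  have "g holomorphic_on ball 0 1"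
    unfolding g_def by (intro holomorphic_intros hol)
  then have "isCont g 0"
    using continuous_on_eq_continuous_at[OF open_ball, of 0 1 g] holomorphic_on_imp_continuous_on[of g "ball 0 1"] by simp
  moreover have "(Q \<longlongrightarrow> 0) im_infinity"
    using tendsto_q_im_infinity[of 1] by (simp add: Q_def)
  ultimately have "((\<lambda>\<tau>. g (Q \<tau>)) \<longlongrightarrow> g 0) im_infinity"
    by (rule isCont_tendsto_compose)
  moreover have "\<forall>\<^sub>F \<tau> in im_infinity. g (Q \<tau>) = cusp_form12 \<tau> / exp (2 * of_real pi * \<i> * \<tau>)"
    using eventually_im_infinity[of 0] by (rule eventually_mono) (simp add: g)
  ultimately have "((\<lambda>\<tau>. cusp_form12 \<tau> / exp (2 * of_real pi * \<i> * \<tau>)) \<longlongrightarrow> g 0) im_infinity"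
    by (rule Lim_transform_eventually)
  moreover have "g 0 \<noteq> 0"
    using deriv_E4_fourier_0 by (simp add: g_def e_def k_def E4_fourier_def)
  ultimately show ?thesis using that by blast
qed

section \<open>The third-order equation\<close>

text \<open>Weight -2 puts the square of the automorphy factor in the numerator. It is the weight of
  1/h' when h has weight 0. The action is from the right, see \<open>slash_mult\<close>.\<close>

definition slash :: "int^2^2 \<Rightarrow> (complex \<Rightarrow> complex) \<Rightarrow> complex \<Rightarrow> complex" where
  "slash A v \<tau> = (aut_factor A \<tau>)\<^sup>2 * v (moebius A \<tau>)"

definition solves :: "complex \<Rightarrow> (complex \<Rightarrow> complex) \<Rightarrow> bool" where
  "solves s v \<longleftrightarrow> v holomorphic_on upper_half_plane \<and>
     (\<forall>\<tau>\<in>upper_half_plane. deriv (deriv (deriv v)) \<tau> + 2 * s * E4 \<tau> * deriv v \<tau> + s * deriv E4 \<tau> * v \<tau> = 0)"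

lemma mult_SL2Z [simp]: "A \<otimes>\<^bsub>SL2Z\<^esub> B = A ** B"
  by (simp add: SL2Z_def)

lemma matrix_mult_2_nth:
  fixes A B :: "int^2^2"
  shows "(A ** B)$i$j = A$i$1 * B$1$j + A$i$2 * B$2$j"
  by (simp add: matrix_matrix_mult_def sum_2)

lemma SL2Z_mult: "A \<in> carrier SL2Z \<Longrightarrow> B \<in> carrier SL2Z \<Longrightarrow> A ** B \<in> carrier SL2Z"
  by (simp add: SL2Z_def det_mul)

lemma aut_factor_mult:
  assumes "B \<in> carrier SL2Z" "Im \<tau> > 0"
  shows "aut_factor (A ** B) \<tau> = aut_factor A (moebius B \<tau>) * aut_factor B \<tau>"
proof -
  have "aut_factor A (moebius B \<tau>) * aut_factor B \<tau>
    = of_int (A$2$1) * (aut_factor B \<tau> * moebius B \<tau>) + of_int (A$2$2) * aut_factor B \<tau>"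
    by (simp add: aut_factor_def[of A] algebra_simps)
  then show ?thesis
    unfolding moebius_aut_factor[OF assms]
    by (simp add: aut_factor_def matrix_mult_2_nth algebra_simps)
qed

lemma moebius_mult:
  assumes A: "A \<in> carrier SL2Z" and B: "B \<in> carrier SL2Z" "Im \<tau> > 0"
  shows "moebius (A ** B) \<tau> = moebius A (moebius B \<tau>)"
proof -
  define jB where "jB = aut_factor B \<tau>"
  have jB: "jB \<noteq> 0" "jB * moebius B \<tau> = of_int (B$1$1) * \<tau> + of_int (B$1$2)"
    using aut_factor_nonzero[OF B] moebius_aut_factor[OF B] by (simp_all add: jB_def)
  have "aut_factor A (moebius B \<tau>) \<noteq> 0" by (rule aut_factor_nonzero[OF A Im_moebius_pos[OF B]])
  have "moebius (A ** B) \<tau> = (of_int ((A ** B)$1$1) * \<tau> + of_int ((A ** B)$1$2)) / aut_factor (A ** B) \<tau>"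
    by (simp add: moebius_def aut_factor_def)
  also have "of_int ((A ** B)$1$1) * \<tau> + of_int ((A ** B)$1$2) =
      (of_int (A$1$1) * moebius B \<tau> + of_int (A$1$2)) * jB"
  proof -
    have "(of_int (A$1$1) * moebius B \<tau> + of_int (A$1$2)) * jB
      = of_int (A$1$1) * (jB * moebius B \<tau>) + of_int (A$1$2) * jB"
      by (simp add: algebra_simps)
    then show ?thesis unfolding jB(2) by (simp add: jB_def aut_factor_def matrix_mult_2_nth algebra_simps)
  qed
  also have "\<dots> / aut_factor (A ** B) \<tau> = moebius A (moebius B \<tau>)"
    using jB(1) unfolding aut_factor_mult[OF B] jB_def [symmetric]
    by (simp add: moebius_def aut_factor_def)
  finally show ?thesis .
qed

lemma slash_mult:
  assumes "A \<in> carrier SL2Z" "B \<in> carrier SL2Z" "Im \<tau> > 0"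
  shows "slash (A ** B) v \<tau> = slash B (slash A v) \<tau>"
  using assms by (simp add: slash_def aut_factor_mult moebius_mult power_mult_distrib mult_ac)

lemma solves_derivs:
  assumes "solves s v" "Im \<tau> > 0"
  shows "(v has_field_derivative deriv v \<tau>) (at \<tau>)"
    "(deriv v has_field_derivative deriv (deriv v) \<tau>) (at \<tau>)"
    "(deriv (deriv v) has_field_derivative deriv (deriv (deriv v)) \<tau>) (at \<tau>)"
    "deriv (deriv (deriv v)) \<tau> = - 2 * s * E4 \<tau> * deriv v \<tau> - s * deriv E4 \<tau> * v \<tau>"
  using assms unfolding solves_def
  by (auto intro!: holomorphic_derivI[of _ upper_half_plane] holomorphic_deriv open_upper_half_plane
        simp: algebra_simps eq_neg_iff_add_eq_0 diff_eq_eq)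

lemma holomorphic_upper_half_plane_isCont:
  assumes "f holomorphic_on upper_half_plane" "Im z > 0"
  shows "isCont f z"
  using assms by (intro analytic_at_imp_isCont holomorphic_on_imp_analytic_at[OF _ open_upper_half_plane]) auto

text \<open>Serves the solutions built from h, whose derivatives are given by formulas only away
  from the poles of h. Both sides of the equation are continuous, so it extends from a dense
  set.\<close>

lemma solvesI_dense:
  assumes hol: "v holomorphic_on upper_half_plane"
    and \<Omega>: "open \<Omega>" "\<And>z. Im z > 0 \<Longrightarrow> \<forall>\<^sub>F w in at z. w \<in> \<Omega>"
    and d1: "\<And>\<tau>. \<tau> \<in> \<Omega> \<Longrightarrow> (v has_field_derivative v1 \<tau>) (at \<tau>)"
    and d2: "\<And>\<tau>. \<tau> \<in> \<Omega> \<Longrightarrow> (v1 has_field_derivative v2 \<tau>) (at \<tau>)"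
    and d3: "\<And>\<tau>. \<tau> \<in> \<Omega> \<Longrightarrow> (v2 has_field_derivative v3 \<tau>) (at \<tau>)"
    and eq: "\<And>\<tau>. \<tau> \<in> \<Omega> \<Longrightarrow> v3 \<tau> = - 2 * s * E4 \<tau> * v1 \<tau> - s * deriv E4 \<tau> * v \<tau>"
  shows "solves s v"
proof -
  have 1: "deriv v \<tau> = v1 \<tau>" if "\<tau> \<in> \<Omega>" for \<tau>
    using d1[OF that] by (rule DERIV_imp_deriv)
  have 2: "deriv (deriv v) \<tau> = v2 \<tau>" if "\<tau> \<in> \<Omega>" for \<tau>
    by (intro DERIV_imp_deriv has_field_derivative_transform_within_open[OF d2[OF that] \<Omega>(1) that])
       (simp add: 1)
  have 3: "deriv (deriv (deriv v)) \<tau> = v3 \<tau>" if "\<tau> \<in> \<Omega>" for \<tau>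
    by (intro DERIV_imp_deriv has_field_derivative_transform_within_open[OF d3[OF that] \<Omega>(1) that])
       (simp add: 2)
  define Q where "Q = (\<lambda>\<tau>. deriv (deriv (deriv v)) \<tau> + 2 * s * E4 \<tau> * deriv v \<tau> + s * deriv E4 \<tau> * v \<tau>)"
  have holQ: "Q holomorphic_on upper_half_plane"
    unfolding Q_def by (intro holomorphic_intros holomorphic_deriv hol E4_holomorphic open_upper_half_plane)
  have Q0: "Q \<tau> = 0" if "\<tau> \<in> \<Omega>" for \<tau>
    unfolding Q_def 3[OF that] 1[OF that] eq[OF that] by simp
  have "Q z = 0" if z: "Im z > 0" for z
  proof -
    have "isCont Q z" by (rule holomorphic_upper_half_plane_isCont[OF holQ z])
    then have "Q \<midarrow>z\<rightarrow> Q z" by (simp add: isCont_def)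
    moreover have "\<forall>\<^sub>F w in at z. Q w = 0"
      using \<Omega>(2)[OF z] by (rule eventually_mono) (rule Q0)
    then have "Q \<midarrow>z\<rightarrow> 0" by (rule tendsto_eventually)
    ultimately show ?thesis using tendsto_unique trivial_limit_at by blast
  qed
  then show ?thesis using hol by (simp add: solves_def Q_def)
qed

lemma solvesI:
  assumes d1: "\<And>\<tau>. Im \<tau> > 0 \<Longrightarrow> (v has_field_derivative v1 \<tau>) (at \<tau>)"
    and "\<And>\<tau>. Im \<tau> > 0 \<Longrightarrow> (v1 has_field_derivative v2 \<tau>) (at \<tau>)"
    and "\<And>\<tau>. Im \<tau> > 0 \<Longrightarrow> (v2 has_field_derivative v3 \<tau>) (at \<tau>)"
    and "\<And>\<tau>. Im \<tau> > 0 \<Longrightarrow> v3 \<tau> = - 2 * s * E4 \<tau> * v1 \<tau> - s * deriv E4 \<tau> * v \<tau>"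
  shows "solves s v"
proof (rule solvesI_dense[OF _ open_upper_half_plane])
  show "v holomorphic_on upper_half_plane"
    unfolding holomorphic_on_open[OF open_upper_half_plane] using d1 upper_half_plane_iff by blast
  show "\<forall>\<^sub>F w in at z. w \<in> upper_half_plane" if "Im z > 0" for z
    using that by (intro eventually_at_in_open' open_upper_half_plane) simp
qed (use assms in auto)

lemma solves_lincomb:
  assumes "solves s v" "solves s w"
  shows "solves s (\<lambda>\<tau>. a * v \<tau> + b * w \<tau>)"
proof (rule solvesI)
  note d = solves_derivs[OF assms(1)] solves_derivs[OF assms(2)]
  fix \<tau> :: complex assume \<tau>: "Im \<tau> > 0"
  show "((\<lambda>\<tau>. a * v \<tau> + b * w \<tau>) has_field_derivative a * deriv v \<tau> + b * deriv w \<tau>) (at \<tau>)"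
    "((\<lambda>\<tau>. a * deriv v \<tau> + b * deriv w \<tau>) has_field_derivative a * deriv (deriv v) \<tau> + b * deriv (deriv w) \<tau>) (at \<tau>)"
    "((\<lambda>\<tau>. a * deriv (deriv v) \<tau> + b * deriv (deriv w) \<tau>) has_field_derivative
       a * deriv (deriv (deriv v)) \<tau> + b * deriv (deriv (deriv w)) \<tau>) (at \<tau>)"
    using \<tau> by (auto intro!: DERIV_add DERIV_cmult d)
  show "a * deriv (deriv (deriv v)) \<tau> + b * deriv (deriv (deriv w)) \<tau>
    = - 2 * s * E4 \<tau> * (a * deriv v \<tau> + b * deriv w \<tau>) - s * deriv E4 \<tau> * (a * v \<tau> + b * w \<tau>)"
    unfolding d(4)[OF \<tau>] d(8)[OF \<tau>] by (simp add: algebra_simps)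
qed

text \<open>Differentiating the equation k times with the Leibniz rule expresses derivative k + 3 by
  lower ones, so the whole Taylor series at the point vanishes, and the identity theorem does the
  rest.\<close>

lemma solves_unique:
  assumes v: "solves s v" and \<tau>0: "Im \<tau>0 > 0" and 0: "v \<tau>0 = 0" "deriv v \<tau>0 = 0" "deriv (deriv v) \<tau>0 = 0"
    and \<tau>: "Im \<tau> > 0"
  shows "v \<tau> = 0"
proof -
  have hol: "v holomorphic_on upper_half_plane" using v by (simp add: solves_def)
  note hol' = hol E4_holomorphic holomorphic_deriv[OF hol open_upper_half_plane]
    holomorphic_deriv[OF E4_holomorphic open_upper_half_plane]
  define p r where "p = (\<lambda>\<tau>. - s * deriv E4 \<tau>)" and "r = (\<lambda>\<tau>. - 2 * s * E4 \<tau>)"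
  have pr: "p holomorphic_on upper_half_plane" "r holomorphic_on upper_half_plane"
    unfolding p_def r_def by (intro holomorphic_intros hol')+
  have v3: "(deriv ^^ 3) v z = p z * v z + r z * deriv v z" if "z \<in> upper_half_plane" for z
    using solves_derivs(4)[OF v, of z] that by (simp add: p_def r_def numeral_3_eq_3)
  have "(deriv ^^ n) v \<tau>0 = 0" for n
  proof (induction n rule: less_induct)
    case (less n)
    consider "n = 0" | "n = 1" | "n = 2" | k where "n = k + 3"
    proof (cases "n \<ge> 3")
      case True
      then have "n = (n - 3) + 3" by simp
      then show ?thesis using that by blast
    next
      case False
      then have "n = 0 \<or> n = 1 \<or> n = 2" by linarith
      then show ?thesis using that by blast
    qed
    then show ?case
    proof cases
      case 4
      have "(deriv ^^ n) v \<tau>0 = (deriv ^^ k) ((deriv ^^ 3) v) \<tau>0"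
        by (simp only: 4 funpow_add o_apply)
      also have "\<dots> = (deriv ^^ k) (\<lambda>z. p z * v z + r z * deriv v z) \<tau>0"
        using \<tau>0 v3 by (intro higher_deriv_cong_ev eventually_nhds_in_open[OF open_upper_half_plane, THEN eventually_mono]) auto
      also have "\<dots> = (deriv ^^ k) (\<lambda>z. p z * v z) \<tau>0 + (deriv ^^ k) (\<lambda>z. r z * deriv v z) \<tau>0"
        using \<tau>0 by (intro higher_deriv_add[OF _ _ open_upper_half_plane] holomorphic_on_mult pr hol') auto
      also have "(deriv ^^ k) (\<lambda>z. p z * v z) \<tau>0 = 
          (\<Sum>i = 0..k. of_nat (k choose i) * (deriv ^^ i) p \<tau>0 * (deriv ^^ (k - i)) v \<tau>0)"
        using \<tau>0 by (intro higher_deriv_mult[OF _ _ open_upper_half_plane] pr hol') auto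
      also have "\<dots> = 0" using less 4 by (intro sum.neutral) auto
      also have "(deriv ^^ k) (\<lambda>z. r z * deriv v z) \<tau>0 = 
          (\<Sum>i = 0..k. of_nat (k choose i) * (deriv ^^ i) r \<tau>0 * (deriv ^^ (k - i)) (deriv v) \<tau>0)"
        using \<tau>0 by (intro higher_deriv_mult[OF _ _ open_upper_half_plane] pr hol') auto
      also have "\<dots> = (\<Sum>i = 0..k. of_nat (k choose i) * (deriv ^^ i) r \<tau>0 * (deriv ^^ (Suc (k - i))) v \<tau>0)"
        by (simp only: funpow_Suc_right o_apply)
      also have "\<dots> = 0"
      proof (rule sum.neutral, rule ballI)
        fix i
        have "(deriv ^^ (Suc (k - i))) v \<tau>0 = 0" using less 4 by (intro less) auto
        then show "of_nat (k choose i) * (deriv ^^ i) r \<tau>0 * (deriv ^^ (Suc (k - i))) v \<tau>0 = 0"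
          by (simp only: mult_zero_right)
      qed
      finally show ?thesis by simp
    qed (use 0 in \<open>auto simp: numeral_2_eq_2\<close>)
  qed
  then show ?thesis
    using \<tau>0 \<tau>
    by (intro holomorphic_fun_eq_0_on_connected[OF hol open_upper_half_plane connected_upper_half_plane, of \<tau>0]) auto
qed

text \<open>Bol's identity for the third-order operator, which is the symmetric square of \<open>y'' + (s/2) E\<^sub>4 y = 0\<close>.\<close>

lemma solves_slash:
  assumes v: "solves s v" and A: "A \<in> carrier SL2Z"
  shows "solves s (slash A v)"
proof -
  let ?c = "of_int (A$2$1) :: complex"
  define j where "j = aut_factor A"
  define M where "M = moebius A"
  note d = solves_derivs[OF v]
  have j0: "j \<tau> \<noteq> 0" if "Im \<tau> > 0" for \<tau> using aut_factor_nonzero[OF A that] by (simp add: j_def)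
  have M: "Im (M \<tau>) > 0" if "Im \<tau> > 0" for \<tau> using Im_moebius_pos[OF A that] by (simp add: M_def)
  have dj: "(j has_field_derivative ?c) (at \<tau>)" for \<tau>
    unfolding j_def by (rule derivative_intros)
  have dM: "(M has_field_derivative 1 / (j \<tau>)\<^sup>2) (at \<tau>)" if "Im \<tau> > 0" for \<tau>
    unfolding j_def M_def by (rule has_field_derivative_moebius[OF A that])
  have sl: "slash A v = (\<lambda>\<tau>. (j \<tau>)\<^sup>2 * v (M \<tau>))"
    by (simp add: slash_def fun_eq_iff j_def M_def)
  show ?thesis unfolding sl
  proof (rule solvesI)
    fix \<tau> :: complex assume \<tau>: "Im \<tau> > 0"
    note dv = DERIV_chain2[OF d(1)[OF M[OF \<tau>]] dM[OF \<tau>]] DERIV_chain2[OF d(2)[OF M[OF \<tau>]] dM[OF \<tau>]]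
      DERIV_chain2[OF d(3)[OF M[OF \<tau>]] dM[OF \<tau>]]
    show "((\<lambda>\<tau>. (j \<tau>)\<^sup>2 * v (M \<tau>)) has_field_derivative 2 * ?c * j \<tau> * v (M \<tau>) + deriv v (M \<tau>)) (at \<tau>)"
      by (rule derivative_eq_intros dv dj refl)+
        (use j0[OF \<tau>] in \<open>simp add: divide_simps power2_eq_square\<close>)
    show "((\<lambda>\<tau>. 2 * ?c * j \<tau> * v (M \<tau>) + deriv v (M \<tau>)) has_field_derivative
        2 * ?c\<^sup>2 * v (M \<tau>) + 2 * ?c * deriv v (M \<tau>) / j \<tau> + deriv (deriv v) (M \<tau>) / (j \<tau>)\<^sup>2) (at \<tau>)"
      by (rule derivative_eq_intros dv dj refl)+
        (use j0[OF \<tau>] in \<open>simp add: divide_simps power2_eq_square\<close>)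
    \<comment> \<open>At the third derivative all terms in c cancel and only v''' remains, which is
      Bol's identity.\<close>
    show "((\<lambda>\<tau>. 2 * ?c\<^sup>2 * v (M \<tau>) + 2 * ?c * deriv v (M \<tau>) / j \<tau> + deriv (deriv v) (M \<tau>) / (j \<tau>)\<^sup>2)
        has_field_derivative deriv (deriv (deriv v)) (M \<tau>) / j \<tau> ^ 4) (at \<tau>)"
      by (rule derivative_eq_intros dv dj refl j0[OF \<tau>] power_not_zero)+
        (use j0[OF \<tau>] in \<open>simp add: divide_simps power2_eq_square power4_eq_xxxx\<close>)
    have E: "E4 (M \<tau>) = j \<tau> ^ 4 * E4 \<tau>" "deriv E4 (M \<tau>) = j \<tau> ^ 6 * deriv E4 \<tau> + 4 * ?c * j \<tau> ^ 5 * E4 \<tau>"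
      using E4_moebius[OF A \<tau>] deriv_E4_moebius[OF A \<tau>] by (simp_all add: j_def M_def)
    show "deriv (deriv (deriv v)) (M \<tau>) / j \<tau> ^ 4 =
         - 2 * s * E4 \<tau> * (2 * ?c * j \<tau> * v (M \<tau>) + deriv v (M \<tau>)) - s * deriv E4 \<tau> * ((j \<tau>)\<^sup>2 * v (M \<tau>))"
      unfolding d(4)[OF M[OF \<tau>]] E using j0[OF \<tau>]
      by (simp add: divide_simps) (simp add: algebra_simps eval_nat_numeral)
  qed
qed

text \<open>If h' has order n at z, the Schwarz derivative has leading term -(n + n^2/2) (w -
  z)^(-2). Continuity of its value F forces n (n + 2) = 0. So h is locally univalent as a map to the
  sphere: n = 0 means a nonzero derivative, n = -2 a simple pole.\<close>

lemma schwarzian_local: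
  assumes mer: "h meromorphic_on {z}"
    and ev: "\<forall>\<^sub>F w in at z. deriv h w \<noteq> 0 \<and> schwarzian h w = F w" and F: "isCont F z"
  obtains g n r where "r > 0" "g holomorphic_on ball z r" "g z \<noteq> 0" "n = 0 \<or> n = (-2::int)"
    "\<And>w. w \<in> ball z r \<Longrightarrow> w \<noteq> z \<Longrightarrow> deriv h w = g w * (w - z) powi n"
proof -
  define d where "d = deriv h"
  have mer_d: "d meromorphic_on {z}" unfolding d_def by (intro meromorphic_intros mer)
  have "\<forall>\<^sub>F w in at z. d w \<noteq> 0" using ev by (rule eventually_mono) (simp add: d_def)
  then have "\<exists>\<^sub>F w in at z. d w \<noteq> 0" by (intro eventually_frequently) auto
  moreover define n where "n = zorder d z"
  moreover define g where "g = zor_poly d z"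
  ultimately obtain r where g0: "g z \<noteq> 0" and r: "r > 0" "g holomorphic_on cball z r"
    and gd: "\<And>w. w \<in> cball z r - {z} \<Longrightarrow> d w = g w * (w - z) powi n \<and> g w \<noteq> 0"
    using zorder_exist[of d z] mer_d unfolding meromorphic_at_iff by blast
  have holg: "g holomorphic_on ball z r" using r(2) by (rule holomorphic_on_subset) auto
  have gnz: "g w \<noteq> 0" if "w \<in> ball z r" for w using that g0 gd[of w] by (cases "w = z") auto
  define l where "l = (\<lambda>w. deriv g w / g w)"
  have holl: "l holomorphic_on ball z r"
    unfolding l_def by (intro holomorphic_intros holomorphic_deriv holg open_ball) (use gnz in auto)
  define L where "L = (\<lambda>w. of_int n / (w - z) + l w)"
  define U where "U = ball z r - {z}"
  have U: "open U" unfolding U_def by auto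
  have dg: "(g has_field_derivative deriv g w) (at w)" "(l has_field_derivative deriv l w) (at w)" if "w \<in> U" for w
    using that holg holl by (auto intro!: holomorphic_derivI[of _ "ball z r"] simp: U_def)
  have 1: "(d has_field_derivative L w * d w) (at w)" if w: "w \<in> U" for w
  proof (rule has_field_derivative_transform_within_open[OF _ U w])
    have wz: "w \<noteq> z" and gw: "g w \<noteq> 0" using w gnz by (auto simp: U_def)
    have "((\<lambda>w. g w * (w - z) powi n) has_field_derivative
        deriv g w * (w - z) powi n + of_int n * (w - z) powi (n - 1) * 1 * g w) (at w)"
      by (intro DERIV_mult dg[OF w] DERIV_power_int) (use wz in \<open>auto intro!: derivative_eq_intros\<close>)
    moreover have "deriv g w * (w - z) powi n + of_int n * (w - z) powi (n - 1) * 1 * g w = L w * d w"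
      using gd[of w] w wz gw by (simp add: U_def L_def l_def power_int_diff) (simp add: field_simps)
    ultimately show "((\<lambda>w. g w * (w - z) powi n) has_field_derivative L w * d w) (at w)" by simp
  qed (use gd in \<open>auto simp: U_def\<close>)
  have 2: "(deriv d has_field_derivative (- of_int n / (w - z)\<^sup>2 + deriv l w + (L w)\<^sup>2) * d w) (at w)"
    if w: "w \<in> U" for w
  proof (rule has_field_derivative_transform_within_open[OF _ U w])
    have wz: "w \<noteq> z" using w by (auto simp: U_def)
    have "(L has_field_derivative - of_int n / (w - z)\<^sup>2 + deriv l w) (at w)"
      unfolding L_def using wz
      by (auto intro!: derivative_eq_intros dg[OF w] simp: power2_eq_square)
    from DERIV_mult[OF this 1[OF w]]
    show "((\<lambda>w. L w * d w) has_field_derivative (- of_int n / (w - z)\<^sup>2 + deriv l w + (L w)\<^sup>2) * d w) (at w)"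
      by (simp add: algebra_simps power2_eq_square)
  next
    fix y assume "y \<in> U" then show "L y * d y = deriv d y" using DERIV_imp_deriv[OF 1] by simp
  qed
  \<comment> \<open>In terms of L = h''/h' the Schwarz derivative is L' - L^2/2. Multiplication by
    (w - z)^2 makes both sides converge at z, where they are compared below.\<close>
  have S: "(w - z)\<^sup>2 * F w = - of_int n + (w - z)\<^sup>2 * deriv l w - (of_int n + (w - z) * l w)\<^sup>2 / 2"
    if w: "w \<in> U" and Fw: "deriv h w \<noteq> 0 \<and> schwarzian h w = F w" for w
  proof -
    have wz: "w \<noteq> z" using w by (auto simp: U_def)
    have d0: "d w \<noteq> 0" using Fw by (simp add: d_def)
    have "F w = deriv (deriv d) w / d w - 3 / 2 * (deriv d w / d w)\<^sup>2"
      using Fw by (simp add: schwarzian_def d_def numeral_3_eq_3 numeral_2_eq_2)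
    also have "\<dots> = (- of_int n / (w - z)\<^sup>2 + deriv l w + (L w)\<^sup>2) - 3 / 2 * (L w)\<^sup>2"
      using DERIV_imp_deriv[OF 1[OF w]] DERIV_imp_deriv[OF 2[OF w]] d0 by simp
    also have "\<dots> = - of_int n / (w - z)\<^sup>2 + deriv l w - (L w)\<^sup>2 / 2" by (simp add: algebra_simps)
    finally have F: "F w = - of_int n / (w - z)\<^sup>2 + deriv l w - (L w)\<^sup>2 / 2" .
    have u: "u\<^sup>2 * (a / u\<^sup>2 + b - c\<^sup>2 / 2) = a + u\<^sup>2 * b - (u * c)\<^sup>2 / 2" if "u \<noteq> 0" for u a b c :: complex
      using that by (simp add: distrib_left right_diff_distrib power_mult_distrib)
    have "(w - z)\<^sup>2 * F w = - of_int n + (w - z)\<^sup>2 * deriv l w - ((w - z) * L w)\<^sup>2 / 2"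
      unfolding F by (rule u) (use wz in simp)
    also have "(w - z) * L w = of_int n + (w - z) * l w"
      using wz by (simp add: L_def distrib_left)
    finally show ?thesis .
  qed
  have evU: "\<forall>\<^sub>F w in at z. w \<in> U"
    unfolding U_def using r(1) by (intro eventually_at_in_open) auto
  have "isCont l z" "isCont (deriv l) z"
    using holl r(1) by (auto intro!: analytic_at_imp_isCont holomorphic_on_imp_analytic_at[of _ "ball z r"] holomorphic_deriv)
  then have lim1: "(\<lambda>w. - of_int n + (w - z)\<^sup>2 * deriv l w - (of_int n + (w - z) * l w)\<^sup>2 / 2) \<midarrow>z\<rightarrow>
      - of_int n + (z - z)\<^sup>2 * deriv l z - (of_int n + (z - z) * l z)\<^sup>2 / 2"
    by (intro tendsto_intros) (auto simp: isCont_def)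
  have lim2: "(\<lambda>w. (w - z)\<^sup>2 * F w) \<midarrow>z\<rightarrow> (z - z)\<^sup>2 * F z"
    using F by (intro tendsto_intros) (auto simp: isCont_def)
  have eq: "\<forall>\<^sub>F w in at z. (w - z)\<^sup>2 * F w = - of_int n + (w - z)\<^sup>2 * deriv l w - (of_int n + (w - z) * l w)\<^sup>2 / 2"
    using evU ev by eventually_elim (rule S)
  from tendsto_unique[OF trivial_limit_at Lim_transform_eventually[OF lim2 eq] lim1]
  have "(z - z)\<^sup>2 * F z = - of_int n + (z - z)\<^sup>2 * deriv l z - (of_int n + (z - z) * l z)\<^sup>2 / 2" .
  then have "of_int (n * (n + 2)) = (0 :: complex)"
    by (simp add: power2_eq_square field_simps)
  then have "n * (n + 2) = 0" by (simp only: of_int_eq_0_iff)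
  then have "n = 0 \<or> n = - 2" by auto
  then show ?thesis using that[OF r(1) holg g0] gd by (force simp: d_def)
qed

text \<open>Of the two orders in \<open>schwarzian_local\<close>, -2 is impossible because h' is
  continuous at z. Order 0 and continuity give h' the nonzero value g z.\<close>

lemma schwarz_solution_at_regular:
  assumes h: "h analytic_on {z}"
    and ev: "\<forall>\<^sub>F w in at z. deriv h w \<noteq> 0 \<and> schwarzian h w = F w" and F: "isCont F z"
  shows "deriv h z \<noteq> 0"
proof -
  obtain g n r where r: "r > 0" "g holomorphic_on ball z r" "g z \<noteq> 0" "n = 0 \<or> n = (-2::int)"
    and d: "\<And>w. w \<in> ball z r \<Longrightarrow> w \<noteq> z \<Longrightarrow> deriv h w = g w * (w - z) powi n"
    using schwarzian_local[OF analytic_on_imp_meromorphic_on[OF h] ev F] by metis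
  have evb: "\<forall>\<^sub>F w in at z. w \<in> ball z r - {z}" using r(1) by (intro eventually_at_in_open) auto
  have limg: "g \<midarrow>z\<rightarrow> g z"
    using r by (intro isContD analytic_at_imp_isCont holomorphic_on_imp_analytic_at[of _ "ball z r"]) auto
  have limd: "deriv h \<midarrow>z\<rightarrow> deriv h z"
    using h by (intro isContD analytic_at_imp_isCont analytic_deriv)
  have n0: "n = 0"
  proof (rule ccontr)
    assume "n \<noteq> 0"
    then have n: "n = -2" using r(4) by simp
    have "(\<lambda>w. deriv h w * (w - z)\<^sup>2) \<midarrow>z\<rightarrow> deriv h z * (z - z)\<^sup>2"
      by (intro tendsto_intros limd)
    moreover have "\<forall>\<^sub>F w in at z. deriv h w * (w - z)\<^sup>2 = g w"
      using evb by eventually_elim (auto simp: d n power_int_minus field_simps)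
    ultimately have "g \<midarrow>z\<rightarrow> deriv h z * (z - z)\<^sup>2" by (rule Lim_transform_eventually)
    from tendsto_unique[OF trivial_limit_at this limg] r(3) show False by simp
  qed
  have "\<forall>\<^sub>F w in at z. deriv h w = g w" using evb by eventually_elim (auto simp: d n0)
  from Lim_transform_eventually[OF limd this] have "g \<midarrow>z\<rightarrow> deriv h z" .
  from tendsto_unique[OF trivial_limit_at this limg] r(3) show ?thesis by simp
qed

text \<open>Order 0 is impossible because h' has a pole, so h' = g (w - z)^(-2) and h = k (w -
  z)^(-1) with g and k nonzero at z. The three quotients then have the limits 0, 0 and
  k^2/g.\<close>

lemma schwarz_solution_at_pole:
  assumes h: "h meromorphic_on {z}" "is_pole h z"
    and ev: "\<forall>\<^sub>F w in at z. deriv h w \<noteq> 0 \<and> schwarzian h w = F w" and F: "isCont F z"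
  obtains c where "(\<lambda>w. 1 / deriv h w) \<midarrow>z\<rightarrow> 0" "(\<lambda>w. h w / deriv h w) \<midarrow>z\<rightarrow> 0"
    "(\<lambda>w. (h w)\<^sup>2 / deriv h w) \<midarrow>z\<rightarrow> c" "c \<noteq> 0"
proof -
  obtain g n r where r: "r > 0" "g holomorphic_on ball z r" "g z \<noteq> 0" "n = 0 \<or> n = (-2::int)"
    and d: "\<And>w. w \<in> ball z r \<Longrightarrow> w \<noteq> z \<Longrightarrow> deriv h w = g w * (w - z) powi n"
    using schwarzian_local[OF h(1) ev F] by metis
  have evb: "\<forall>\<^sub>F w in at z. w \<in> ball z r - {z}" using r(1) by (intro eventually_at_in_open) auto
  have limg: "g \<midarrow>z\<rightarrow> g z"
    using r by (intro isContD analytic_at_imp_isCont holomorphic_on_imp_analytic_at[of _ "ball z r"]) auto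
  have poled: "is_pole (deriv h) z" using is_pole_deriv_iff[OF h(1)] h(2) by simp
  have n: "n = -2"
  proof (rule ccontr)
    assume "n \<noteq> -2"
    then have n: "n = 0" using r(4) by simp
    have "\<forall>\<^sub>F w in at z. g w = deriv h w" using evb by eventually_elim (auto simp: d n)
    from Lim_transform_eventually[OF limg this] have "deriv h \<midarrow>z\<rightarrow> g z" .
    with poled show False
      unfolding is_pole_def using not_tendsto_and_filterlim_at_infinity[OF trivial_limit_at] by blast
  qed
  have iso: "isolated_singularity_at h z" "not_essential h z" using h(1) by (auto simp: meromorphic_at_iff)
  have isod: "isolated_singularity_at (deriv h) z" "not_essential (deriv h) z"
    using meromorphic_on_deriv[OF h(1)] by (auto simp: meromorphic_at_iff)
  have "zorder (deriv h) z = n"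
    by (rule zorder_eqI[of "ball z r" z g]) (use r d in auto)
  then have zh: "zorder h z = -1" using zorder_deriv[OF h(2) iso(1)] n by simp
  have "\<exists>\<^sub>F w in at z. h w \<noteq> 0"
    using non_zero_neighbour_pole[OF h(2)] by (intro eventually_frequently) auto
  from zorder_exist[OF iso this] obtain k r' where k: "k z \<noteq> 0" and r': "r' > 0" "k holomorphic_on cball z r'"
    and hk: "\<And>w. w \<in> cball z r' - {z} \<Longrightarrow> h w = k w * (w - z) powi (-1)"
    unfolding zh by blast
  have limk: "k \<midarrow>z\<rightarrow> k z"
    using r' by (intro isContD analytic_at_imp_isCont holomorphic_on_imp_analytic_at[of _ "ball z r'"])
      (auto intro: holomorphic_on_subset)
  have evb': "\<forall>\<^sub>F w in at z. w \<in> ball z r' - {z}" using r'(1) by (intro eventually_at_in_open) auto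
  have evg: "\<forall>\<^sub>F w in at z. g w \<noteq> 0" using tendsto_imp_eventually_ne[OF limg r(3)] .
  have l0: "(\<lambda>w. (w - z)\<^sup>2 / g w) \<midarrow>z\<rightarrow> (z - z)\<^sup>2 / g z"
    and l1: "(\<lambda>w. k w * (w - z) / g w) \<midarrow>z\<rightarrow> k z * (z - z) / g z"
    and l2: "(\<lambda>w. (k w)\<^sup>2 / g w) \<midarrow>z\<rightarrow> (k z)\<^sup>2 / g z"
    by (intro tendsto_intros limg limk r(3))+
  have e0: "\<forall>\<^sub>F w in at z. (w - z)\<^sup>2 / g w = 1 / deriv h w"
    using evb evg by eventually_elim (auto simp: d n power_int_minus divide_simps)
  have e1: "\<forall>\<^sub>F w in at z. k w * (w - z) / g w = h w / deriv h w"
    using evb evb' evg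
    by eventually_elim (auto simp: d n hk power_int_minus divide_simps power2_eq_square)
  have e2: "\<forall>\<^sub>F w in at z. (k w)\<^sup>2 / g w = (h w)\<^sup>2 / deriv h w"
    using evb evb' evg
    by eventually_elim (auto simp: d n hk power_int_minus divide_simps power2_eq_square)
  show ?thesis
    by (rule that[of "(k z)\<^sup>2 / g z"])
       (use Lim_transform_eventually[OF l0 e0] Lim_transform_eventually[OF l1 e1]
          Lim_transform_eventually[OF l2 e2] k r(3) in auto)
qed

text \<open>The functions are h^i/h' for i = 0, 1, 2, continued over the poles of h. At a pole
  \<open>v2\<close> takes over from \<open>v0\<close> as the nonvanishing coordinate, so poles and
  regular points can be told apart by the zeros of \<open>v0\<close>.\<close>

lemma schwarz_solution_basis:
  assumes "schwarz_solution s h"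
  obtains v0 v1 v2 where "solves s v0" "solves s v1" "solves s v2"
    "\<And>\<tau>. Im \<tau> > 0 \<Longrightarrow> is_pole h \<tau> \<Longrightarrow> v0 \<tau> = 0 \<and> v2 \<tau> \<noteq> 0"
    "\<And>\<tau>. Im \<tau> > 0 \<Longrightarrow> \<not> is_pole h \<tau> \<Longrightarrow> (h has_field_derivative 1 / v0 \<tau>) (at \<tau>)"
    "\<And>\<tau>. Im \<tau> > 0 \<Longrightarrow> \<not> is_pole h \<tau> \<Longrightarrow>
       v0 \<tau> \<noteq> 0 \<and> v1 \<tau> = h \<tau> * v0 \<tau> \<and> v2 \<tau> = (h \<tau>)\<^sup>2 * v0 \<tau>"
proof -
  define F where "F = (\<lambda>\<tau>. s * E4 \<tau>)"
  have ev: "\<forall>\<^sub>F w in at z. deriv h w \<noteq> 0 \<and> schwarzian h w = F w" if "Im z > 0" for z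
    using assms that by (auto simp: schwarz_solution_def F_def eventually_cosparse_open_eq[OF open_upper_half_plane])
  have F: "isCont F z" if "Im z > 0" for z
    unfolding F_def using that
    by (intro continuous_intros holomorphic_upper_half_plane_isCont[OF E4_holomorphic])
  have nm: "h nicely_meromorphic_on upper_half_plane" using assms by (simp add: schwarz_solution_def)
  have mer: "h meromorphic_on {z}" if "Im z > 0" for z
    using nm that by (auto simp: nicely_meromorphic_on_def intro: meromorphic_on_subset)
  have ana: "h analytic_on {z}" if "Im z > 0" "\<not> is_pole h z" for z
    using nicely_meromorphic_on_imp_analytic_at[OF nm] that by simp
  define \<Omega> where "\<Omega> = {z \<in> upper_half_plane. \<not> is_pole h z}"
  have \<Omega>_eq: "\<Omega> = upper_half_plane \<inter> {z. h analytic_on {z}}"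
    using ana analytic_at_imp_no_pole by (auto simp: \<Omega>_def)
  have open_ana: "open {z. h analytic_on {z}}"
  proof (subst open_subopen, safe)
    fix z assume "h analytic_on {z}"
    then obtain S where "open S" "z \<in> S" "h holomorphic_on S" by (auto simp: analytic_at)
    then show "\<exists>T. open T \<and> z \<in> T \<and> T \<subseteq> {z. h analytic_on {z}}"
      by (intro exI[of _ S]) (auto simp: analytic_at)
  qed
  have op: "open \<Omega>" unfolding \<Omega>_eq by (intro open_Int open_upper_half_plane open_ana)
  have dense: "\<forall>\<^sub>F w in at z. w \<in> \<Omega>" if "Im z > 0" for z
  proof -
    have "\<forall>\<^sub>F w in at z. w \<in> upper_half_plane"
      using that by (intro eventually_at_in_open' open_upper_half_plane) simp
    moreover have "\<forall>\<^sub>F w in at z. h analytic_on {w}"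
      using mer[OF that] isolated_singularity_at_altdef meromorphic_at_iff by blast
    ultimately show ?thesis unfolding \<Omega>_eq by eventually_elim auto
  qed
  have holh: "h holomorphic_on \<Omega>"
    by (rule analytic_imp_holomorphic, subst analytic_on_analytic_at) (auto simp: \<Omega>_eq)
  have h1: "deriv h z \<noteq> 0" if "z \<in> \<Omega>" for z
    by (rule schwarz_solution_at_regular[OF ana ev F]) (use that in \<open>auto simp: \<Omega>_def\<close>)
  have hol1: "deriv h holomorphic_on \<Omega>" by (intro holomorphic_deriv holh op)
  \<comment> \<open>In terms of p = h''/h' the Schwarz equation reads p' - p^2/2 = s E4, and every
    derivative of h^i/h' is a polynomial in h, h', p, its derivatives and h^i/h' itself.\<close>
  define p where "p = (\<lambda>z. deriv (deriv h) z / deriv h z)"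
  have holp: "p holomorphic_on \<Omega>"
    unfolding p_def by (intro holomorphic_intros holomorphic_deriv holh op) (use h1 in auto)
  define p1 where "p1 = deriv p"
  have holp1: "p1 holomorphic_on \<Omega>" unfolding p1_def by (intro holomorphic_deriv holp op)
  define p2 where "p2 = deriv p1"
  have Dh: "(h has_field_derivative deriv h z) (at z)"
    and Dh1: "(deriv h has_field_derivative p z * deriv h z) (at z)"
    and Dp: "(p has_field_derivative p1 z) (at z)" and Dp1: "(p1 has_field_derivative p2 z) (at z)"
    if "z \<in> \<Omega>" for z
    using holomorphic_derivI[OF holh op that] holomorphic_derivI[OF hol1 op that] h1[OF that]
      holomorphic_derivI[OF holp op that] holomorphic_derivI[OF holp1 op that]
    by (simp_all add: p_def p1_def p2_def)
  \<comment> \<open>The hypothesis gives the equation only off a discrete set; by continuity it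
    holds at every regular point and may be differentiated.\<close>
  have schw: "p1 z - (p z)\<^sup>2 / 2 = s * E4 z" if "z \<in> \<Omega>" for z
  proof -
    have z: "Im z > 0" using that by (simp add: \<Omega>_def)
    have S: "schwarzian h w = p1 w - (p w)\<^sup>2 / 2" if "w \<in> \<Omega>" for w
    proof -
      have 2: "deriv (deriv h) w = p w * deriv h w" using DERIV_imp_deriv[OF Dh1[OF that]] .
      have "deriv (deriv (deriv h)) w = (p1 w + (p w)\<^sup>2) * deriv h w"
      proof (rule DERIV_imp_deriv, rule has_field_derivative_transform_within_open[OF _ op that])
        show "((\<lambda>w. p w * deriv h w) has_field_derivative (p1 w + (p w)\<^sup>2) * deriv h w) (at w)"
          using DERIV_mult[OF Dp[OF that] Dh1[OF that]] by (simp add: algebra_simps power2_eq_square)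
        fix y assume "y \<in> \<Omega>"
        then show "p y * deriv h y = deriv (deriv h) y" using DERIV_imp_deriv[OF Dh1] by simp
      qed
      then show ?thesis
        using h1[OF that] 2 by (simp add: schwarzian_def numeral_3_eq_3 numeral_2_eq_2)
    qed
    have "\<forall>\<^sub>F w in at z. p1 w - (p w)\<^sup>2 / 2 = F w"
      using dense[OF z] ev[OF z] by eventually_elim (simp add: S)
    moreover have "(\<lambda>w. p1 w - (p w)\<^sup>2 / 2) \<midarrow>z\<rightarrow> p1 z - (p z)\<^sup>2 / 2"
      using DERIV_isCont[OF Dp[OF that]] DERIV_isCont[OF Dp1[OF that]]
      by (intro tendsto_intros) (auto simp: isCont_def)
    ultimately have "F \<midarrow>z\<rightarrow> p1 z - (p z)\<^sup>2 / 2" by (rule Lim_transform_eventually[rotated])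
    from tendsto_unique[OF trivial_limit_at this isContD[OF F[OF z]]] show ?thesis by (simp add: F_def)
  qed
  have schw': "p2 z - p z * p1 z = s * deriv E4 z" if z: "z \<in> \<Omega>" for z
  proof (rule DERIV_eq_on_open[OF _ _ op z schw])
    show "((\<lambda>z. p1 z - (p z)\<^sup>2 / 2) has_field_derivative p2 z - p z * p1 z) (at z)"
      by (rule derivative_eq_intros Dp[OF z] Dp1[OF z] refl)+ (simp_all add: mult.commute)
    show "((\<lambda>z. s * E4 z) has_field_derivative s * deriv E4 z) (at z)"
      using z by (intro DERIV_cmult E4_deriv) (simp add: \<Omega>_def)
  qed
  have sE: "s * E4 z = p1 z - (p z)\<^sup>2 / 2" "s * deriv E4 z = p2 z - p z * p1 z" if "z \<in> \<Omega>" for z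
    using schw schw' that by simp_all
  define v where "v = (\<lambda>i::nat. remove_sings (\<lambda>w. h w ^ i / deriv h w))"
  have v_eq: "v i z = h z ^ i / deriv h z" if "z \<in> \<Omega>" for i z
    unfolding v_def
  proof (rule remove_sings_at_analytic)
    have "(\<lambda>w. h w ^ i / deriv h w) holomorphic_on \<Omega>"
      by (intro holomorphic_intros holh hol1) (use h1 in auto)
    then show "(\<lambda>w. h w ^ i / deriv h w) analytic_on {z}"
      using holomorphic_on_imp_analytic_at op that by blast
  qed
  have v_pole: "v 0 z = 0 \<and> v 2 z \<noteq> 0 \<and> v 0 analytic_on {z} \<and> v 1 analytic_on {z} \<and> v 2 analytic_on {z}"
    if z: "Im z > 0" "is_pole h z" for z
  proof -
    obtain c where c: "(\<lambda>w. 1 / deriv h w) \<midarrow>z\<rightarrow> 0" "(\<lambda>w. h w / deriv h w) \<midarrow>z\<rightarrow> 0"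
      "(\<lambda>w. (h w)\<^sup>2 / deriv h w) \<midarrow>z\<rightarrow> c" "c \<noteq> 0"
      using schwarz_solution_at_pole[OF mer[OF z(1)] z(2) ev[OF z(1)] F[OF z(1)]] by blast
    have iso: "isolated_singularity_at (\<lambda>w. h w ^ i / deriv h w) z" for i
      using mer[OF z(1)] by (intro meromorphic_on_isolated_singularity meromorphic_intros)
    show ?thesis
      using remove_sings_eqI[OF c(1)] remove_sings_eqI[OF c(3)] c(4)
        remove_sings_analytic_at[OF iso[of 0]] remove_sings_analytic_at[OF iso[of 1]]
        remove_sings_analytic_at[OF iso[of 2]] c(1-3)
      by (simp add: v_def)
  qed
  have v_reg: "v i analytic_on {z}" if "z \<in> \<Omega>" for i z
  proof -
    have "(\<lambda>w. h w ^ i / deriv h w) holomorphic_on \<Omega>"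
      by (intro holomorphic_intros holh hol1) (use h1 in auto)
    then have "v i holomorphic_on \<Omega>"
      by (rule holomorphic_transform) (simp add: v_eq)
    then show ?thesis using holomorphic_on_imp_analytic_at op that by blast
  qed
  have holv: "v i holomorphic_on upper_half_plane" if "i = 0 \<or> i = 1 \<or> i = 2" for i
  proof (rule analytic_imp_holomorphic, subst analytic_on_analytic_at, rule ballI)
    fix z assume "z \<in> upper_half_plane"
    then show "v i analytic_on {z}"
      using v_pole[of z] v_reg[of z i] that by (cases "is_pole h z") (auto simp: \<Omega>_def)
  qed
  have Dv0: "(v 0 has_field_derivative - p z * v 0 z) (at z)"
    and Dv1: "(v 1 has_field_derivative 1 - p z * v 1 z) (at z)"
    and Dv2: "(v 2 has_field_derivative 2 * h z - p z * v 2 z) (at z)" if z: "z \<in> \<Omega>" for z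
  proof -
    have "((\<lambda>w. h w ^ i / deriv h w) has_field_derivative
        (of_nat i * h z ^ (i - 1) * deriv h z * deriv h z - h z ^ i * (p z * deriv h z)) / (deriv h z * deriv h z)) (at z)" for i
      using DERIV_divide[OF DERIV_power[OF Dh[OF z], of i] Dh1[OF z] h1[OF z]] by (simp add: mult_ac)
    also have "(of_nat i * h z ^ (i - 1) * deriv h z * deriv h z - h z ^ i * (p z * deriv h z)) / (deriv h z * deriv h z)
       = of_nat i * h z ^ (i - 1) - p z * v i z" for i
      unfolding v_eq[OF z] using h1[OF z] by (simp add: diff_divide_distrib mult_ac)
    finally have *: "((\<lambda>w. h w ^ i / deriv h w) has_field_derivative of_nat i * h z ^ (i - 1) - p z * v i z) (at z)" for i .
    have "(v i has_field_derivative of_nat i * h z ^ (i - 1) - p z * v i z) (at z)" for i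
      by (rule has_field_derivative_transform_within_open[OF * op z]) (simp add: v_eq)
    from this[of 0] this[of 1] this[of 2]
    show "(v 0 has_field_derivative - p z * v 0 z) (at z)"
      "(v 1 has_field_derivative 1 - p z * v 1 z) (at z)"
      "(v 2 has_field_derivative 2 * h z - p z * v 2 z) (at z)" by simp_all
  qed
  have s0: "solves s (v 0)"
  proof (rule solvesI_dense[OF holv op dense Dv0])
    fix z assume z: "z \<in> \<Omega>"
    show "((\<lambda>z. - p z * v 0 z) has_field_derivative ((p z)\<^sup>2 - p1 z) * v 0 z) (at z)"
      by (rule derivative_eq_intros Dp[OF z] Dv0[OF z] refl)+ (simp add: algebra_simps power2_eq_square)
    show "((\<lambda>z. ((p z)\<^sup>2 - p1 z) * v 0 z) has_field_derivative (3 * p z * p1 z - p2 z - p z ^ 3) * v 0 z) (at z)"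
      by (rule derivative_eq_intros Dp[OF z] Dp1[OF z] Dv0[OF z] refl)+ (simp add: algebra_simps power2_eq_square power3_eq_cube)
    have "- 2 * (s * E4 z) * (- p z * v 0 z) - (s * deriv E4 z) * v 0 z = (3 * p z * p1 z - p2 z - p z ^ 3) * v 0 z"
      unfolding sE[OF z] by (simp add: algebra_simps power2_eq_square power3_eq_cube)
    then show "(3 * p z * p1 z - p2 z - p z ^ 3) * v 0 z = - 2 * s * E4 z * (- p z * v 0 z) - s * deriv E4 z * v 0 z"
      by (simp only: mult.assoc)
  qed auto
  have s1: "solves s (v 1)"
  proof (rule solvesI_dense[OF holv op dense Dv1])
    fix z assume z: "z \<in> \<Omega>"
    show "((\<lambda>z. 1 - p z * v 1 z) has_field_derivative ((p z)\<^sup>2 - p1 z) * v 1 z - p z) (at z)"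
      by (rule derivative_eq_intros Dp[OF z] Dv1[OF z] refl)+ (simp add: algebra_simps power2_eq_square)
    show "((\<lambda>z. ((p z)\<^sup>2 - p1 z) * v 1 z - p z) has_field_derivative
        (3 * p z * p1 z - p2 z - p z ^ 3) * v 1 z + (p z)\<^sup>2 - 2 * p1 z) (at z)"
      by (rule derivative_eq_intros Dp[OF z] Dp1[OF z] Dv1[OF z] refl)+ (simp add: algebra_simps power2_eq_square power3_eq_cube)
    have "- 2 * (s * E4 z) * (1 - p z * v 1 z) - (s * deriv E4 z) * v 1 z
        = (3 * p z * p1 z - p2 z - p z ^ 3) * v 1 z + (p z)\<^sup>2 - 2 * p1 z"
      unfolding sE[OF z] by (simp add: algebra_simps power2_eq_square power3_eq_cube)
    then show "(3 * p z * p1 z - p2 z - p z ^ 3) * v 1 z + (p z)\<^sup>2 - 2 * p1 z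
        = - 2 * s * E4 z * (1 - p z * v 1 z) - s * deriv E4 z * v 1 z"
      by (simp only: mult.assoc)
  qed auto
  have hv: "deriv h z * v 2 z = (h z)\<^sup>2" if "z \<in> \<Omega>" for z
    using h1[OF that] by (simp add: v_eq[OF that])
  have s2: "solves s (v 2)"
  proof (rule solvesI_dense[OF holv op dense Dv2])
    fix z assume z: "z \<in> \<Omega>"
    show "((\<lambda>z. 2 * h z - p z * v 2 z) has_field_derivative
        2 * deriv h z - p1 z * v 2 z - 2 * p z * h z + (p z)\<^sup>2 * v 2 z) (at z)"
      by (rule derivative_eq_intros Dp[OF z] Dv2[OF z] Dh[OF z] refl)+ (simp add: algebra_simps power2_eq_square)
    show "((\<lambda>z. 2 * deriv h z - p1 z * v 2 z - 2 * p z * h z + (p z)\<^sup>2 * v 2 z) has_field_derivative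
        (3 * p z * p1 z - p2 z - p z ^ 3) * v 2 z - 4 * p1 z * h z + 2 * (p z)\<^sup>2 * h z) (at z)"
      by (rule derivative_eq_intros Dp[OF z] Dp1[OF z] Dv2[OF z] Dh[OF z] Dh1[OF z] refl)+
        (simp add: algebra_simps power2_eq_square power3_eq_cube)
    have "- 2 * (s * E4 z) * (2 * h z - p z * v 2 z) - (s * deriv E4 z) * v 2 z
        = (3 * p z * p1 z - p2 z - p z ^ 3) * v 2 z - 4 * p1 z * h z + 2 * (p z)\<^sup>2 * h z"
      unfolding sE[OF z] by (simp add: algebra_simps power2_eq_square power3_eq_cube)
    then show "(3 * p z * p1 z - p2 z - p z ^ 3) * v 2 z - 4 * p1 z * h z + 2 * (p z)\<^sup>2 * h z
        = - 2 * s * E4 z * (2 * h z - p z * v 2 z) - s * deriv E4 z * v 2 z"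
      by (simp only: mult.assoc)
  qed auto
  show ?thesis
  proof (rule that[OF s0 s1 s2])
    fix z assume z: "Im z > 0"
    show "v 0 z = 0 \<and> v 2 z \<noteq> 0" if "is_pole h z" using v_pole[OF z that] by simp
    assume "\<not> is_pole h z"
    then have "z \<in> \<Omega>" using z by (simp add: \<Omega>_def)
    then show "(h has_field_derivative 1 / v 0 z) (at z)"
      "v 0 z \<noteq> 0 \<and> v 1 z = h z * v 0 z \<and> v 2 z = (h z)\<^sup>2 * v 0 z"
      using Dh h1 by (simp_all add: v_eq)
  qed
qed

section \<open>Normal subgroups of level at most five\<close>

lemma dvd_uminus_diff_iff: "k dvd - x - y \<longleftrightarrow> k dvd x + y" for k x y :: int
proof -
  have "- x - y = - (x + y)" by simp
  then show ?thesis by (simp only: dvd_minus_iff)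
qed

lemma closest_multiple: "\<exists>x::int. 2 * \<bar>x * c - a\<bar> \<le> \<bar>c\<bar>" if "c \<noteq> 0" for a c :: int
proof -
  have *: "\<exists>x::int. 2 * \<bar>x * c - a\<bar> \<le> c" if "c > 0" for a c :: int
  proof
    \<comment> \<open>The quotient a/c rounded to a nearest integer.\<close>
    define x where "x = (2 * a + c) div (2 * c)"
    have "(2 * a + c) div (2 * c) * (2 * c) + (2 * a + c) mod (2 * c) = 2 * a + c"
      by (rule div_mult_mod_eq)
    moreover have "0 \<le> (2 * a + c) mod (2 * c)" "(2 * a + c) mod (2 * c) < 2 * c" using that by simp_all
    ultimately show "2 * \<bar>x * c - a\<bar> \<le> c" unfolding x_def [symmetric] by (simp add: abs_if algebra_simps)
  qed
  show ?thesis
  proof (cases "c > 0")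
    case True then show ?thesis using * by simp
  next
    case False
    then have "- c > 0" using that by simp
    from *[OF this, of a] obtain x where "2 * \<bar>x * (- c) - a\<bar> \<le> - c" by blast
    then show ?thesis using False by (intro exI[of _ "- x"]) simp
  qed
qed

text \<open>Adding a nonzero number of modulus less than 2|c| and of sign opposite to c brings c
  closer to 0; \<epsilon> provides the sign. This is the decrease in the Euclidean descent.\<close>

lemma sign_step: "\<exists>\<epsilon>::int. \<bar>\<epsilon>\<bar> = 1 \<and> \<bar>c + k * \<epsilon> * e\<bar> < \<bar>c\<bar>"
  if "0 < k" "e \<noteq> 0" "k * \<bar>e\<bar> < 2 * \<bar>c\<bar>" for c e k :: int
proof -
  define \<epsilon> where "\<epsilon> = (if (c > 0) = (e > 0) then -1 else 1 :: int)"
  have "k * \<epsilon> * e = (if c > 0 then - (k * \<bar>e\<bar>) else k * \<bar>e\<bar>)"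
    using that by (auto simp: \<epsilon>_def abs_if)
  moreover have pos: "k * \<bar>e\<bar> > 0" using that by simp
  moreover have "c \<noteq> 0" using that(3) pos by auto
  ultimately have "\<bar>c + k * \<epsilon> * e\<bar> < \<bar>c\<bar>" using that(3) by (auto simp: abs_if split: if_splits)
  moreover have "\<bar>\<epsilon>\<bar> = 1" by (simp add: \<epsilon>_def)
  ultimately show ?thesis by blast
qed

text \<open>The arithmetic of \<Gamma>, separated from the analysis and stated by matrix entries so
  that identities become polynomial. The assumption \<open>conj\<close> is normality, with the
  inverse of the conjugating matrix written out; \<open>trace\<close> excludes elliptic elements.
  The name refers to the triangle groups (2, 3, m), which are finite exactly for these m.\<close>

locale spherical_level =
  fixes G :: "int \<Rightarrow> int \<Rightarrow> int \<Rightarrow> int \<Rightarrow> bool" and m :: int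
  assumes det: "G a b c d \<Longrightarrow> a * d - b * c = 1"
    and mult: "G a b c d \<Longrightarrow> G a' b' c' d' \<Longrightarrow>
      G (a * a' + b * c') (a * b' + b * d') (c * a' + d * c') (c * b' + d * d')"
    and inverse: "G a b c d \<Longrightarrow> G d (- b) (- c) a"
    and neg: "G a b c d \<Longrightarrow> G (- a) (- b) (- c) (- d)"
    and conj: "p * s - q * r = 1 \<Longrightarrow> G a b c d \<Longrightarrow>
      G ((p * a + q * c) * s - (p * b + q * d) * r) ((p * b + q * d) * p - (p * a + q * c) * q)
        ((r * a + s * c) * s - (r * b + s * d) * r) ((r * b + s * d) * p - (r * a + s * c) * q)"
    and translation: "G 1 k 0 1 \<longleftrightarrow> m dvd k"
    and trace: "G a b c d \<Longrightarrow> \<bar>a + d\<bar> \<ge> 2"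
    and m: "2 \<le> m" "m \<le> 5"
begin

text \<open>The matrix is the conjugate of the translation by n under the matrix with first column
  (x, y), so it fixes the cusp x/y. Conjugating back gives the other direction.\<close>

lemma transvection:
  assumes g: "x * s - q * y = 1"
  shows "G (1 - n * x * y) (n * x\<^sup>2) (- n * y\<^sup>2) (1 + n * x * y) \<longleftrightarrow> m dvd n"
proof
  assume "m dvd n"
  then have "G 1 n 0 1" by (simp add: translation)
  from conj[OF g this]
  show "G (1 - n * x * y) (n * x\<^sup>2) (- n * y\<^sup>2) (1 + n * x * y)"
  proof (rule back_subst[where P = "\<lambda>X. X"])
    have 1: "(x * 1 + q * 0) * s - (x * n + q * 1) * y = (x * s - q * y) - n * x * y" by algebra
    have 2: "(x * n + q * 1) * x - (x * 1 + q * 0) * q = n * x\<^sup>2" by algebra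
    have 3: "(y * 1 + s * 0) * s - (y * n + s * 1) * y = - n * y\<^sup>2" by algebra
    have 4: "(y * n + s * 1) * x - (y * 1 + s * 0) * q = (x * s - q * y) + n * x * y" by algebra
    show "G ((x * 1 + q * 0) * s - (x * n + q * 1) * y) ((x * n + q * 1) * x - (x * 1 + q * 0) * q)
        ((y * 1 + s * 0) * s - (y * n + s * 1) * y) ((y * n + s * 1) * x - (y * 1 + s * 0) * q)
       = G (1 - n * x * y) (n * x\<^sup>2) (- n * y\<^sup>2) (1 + n * x * y)"
      unfolding 1 2 3 4 g ..
  qed
next
  assume *: "G (1 - n * x * y) (n * x\<^sup>2) (- n * y\<^sup>2) (1 + n * x * y)"
  define a b c d where "a = 1 - n * x * y" and "b = n * x\<^sup>2" and "c = - n * y\<^sup>2" and "d = 1 + n * x * y"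
  have g': "s * x - (- q) * (- y) = 1" using g by (simp add: algebra_simps)
  have "G a b c d" using * by (simp only: a_def b_def c_def d_def)
  from conj[OF g' this]
  have "G ((s * a + (- q) * c) * x - (s * b + (- q) * d) * (- y)) ((s * b + (- q) * d) * s - (s * a + (- q) * c) * (- q))
    ((- y * a + x * c) * x - (- y * b + x * d) * (- y)) ((- y * b + x * d) * s - (- y * a + x * c) * (- q))" .
  moreover have "(s * a + (- q) * c) * x - (s * b + (- q) * d) * (- y) = x * s - q * y"
    "(s * b + (- q) * d) * s - (s * a + (- q) * c) * (- q) = n * (x * s - q * y)\<^sup>2"
    "(- y * a + x * c) * x - (- y * b + x * d) * (- y) = 0"
    "(- y * b + x * d) * s - (- y * a + x * c) * (- q) = x * s - q * y"
    unfolding a_def b_def c_def d_def by (simp_all add: algebra_simps power2_eq_square)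
  ultimately have "G 1 n 0 1" by (simp add: g)
  then show "m dvd n" by (simp add: translation)
qed

text \<open>Left multiplication by the transvection at the cusp x/y. The quantity x c - y a measures
  how far x/y is from a/c; it is the handle by which the descent changes c. The converse uses the
  transvection with -n.\<close>

lemma transvection_mult:
  assumes g: "x * s - q * y = 1" and n: "m dvd n"
  shows "G a b c d \<longleftrightarrow> G (a + n * x * (x * c - y * a)) (b + n * x * (x * d - y * b))
    (c + n * y * (x * c - y * a)) (d + n * y * (x * d - y * b))"
proof -
  have *: "G a b c d \<Longrightarrow> G (a + n * x * (x * c - y * a)) (b + n * x * (x * d - y * b))
    (c + n * y * (x * c - y * a)) (d + n * y * (x * d - y * b))" if n: "m dvd n" for n a b c d
  proof -
    assume G: "G a b c d"
    have "G (1 - n * x * y) (n * x\<^sup>2) (- n * y\<^sup>2) (1 + n * x * y)"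
      using transvection[OF g] n by blast
    from mult[OF this G] show ?thesis
      by (simp add: algebra_simps power2_eq_square)
  qed
  show ?thesis
  proof
    assume "G (a + n * x * (x * c - y * a)) (b + n * x * (x * d - y * b))
      (c + n * y * (x * c - y * a)) (d + n * y * (x * d - y * b))"
    moreover have "m dvd - n" using n by simp
    ultimately show "G a b c d" using *[of "- n"] by (fastforce simp: algebra_simps)
  qed (use * n in blast)
qed

lemma translation_mult:
  assumes "m dvd n"
  shows "G a b c d \<longleftrightarrow> G (a + n * c) (b + n * d) c d"
  using transvection_mult[of 1 1 0 0 n a b c d] assms by simp

text \<open>Euclidean descent on the lower left entry, using the conjugates of the translation by \<open>m\<close>
  with fixed cusp \<open>x/1\<close> or \<open>x/2\<close>. It gets stuck at nonzero entries when \<open>m \<ge> 6\<close>.\<close>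

lemma principal_subset:
  assumes "a * d - b * c = 1" "m dvd a - 1" "m dvd d - 1" "m dvd b" "m dvd c"
  shows "G a b c d"
  using assms
proof (induction "nat \<bar>c\<bar>" arbitrary: a b c d rule: less_induct)
  case less
  note det = less.prems(1)
  have dvd1: "\<bar>e\<bar> = 1" if "e dvd a" "e dvd c" for e :: int
  proof -
    have "e dvd a * d - b * c" using that by (intro dvd_diff) auto
    then show ?thesis unfolding det by (simp add: zdvd1_eq)
  qed
  have step: "G a b c d" if g: "x * s - q * y = 1" and n: "m dvd n"
      and lt: "\<bar>c + n * y * (x * c - y * a)\<bar> < \<bar>c\<bar>" for x s q y n
  proof -
    have "G (a + n * x * (x * c - y * a)) (b + n * x * (x * d - y * b))
      (c + n * y * (x * c - y * a)) (d + n * y * (x * d - y * b))"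
    proof (rule less.hyps)
      show "nat \<bar>c + n * y * (x * c - y * a)\<bar> < nat \<bar>c\<bar>" using lt by simp
      show "(a + n * x * (x * c - y * a)) * (d + n * y * (x * d - y * b))
        - (b + n * x * (x * d - y * b)) * (c + n * y * (x * c - y * a)) = 1"
        using det by algebra
      have "a + n * x * (x * c - y * a) - 1 = (a - 1) + n * (x * (x * c - y * a))"
        "d + n * y * (x * d - y * b) - 1 = (d - 1) + n * (y * (x * d - y * b))" by simp_all
      then show "m dvd a + n * x * (x * c - y * a) - 1" "m dvd d + n * y * (x * d - y * b) - 1"
        using n less.prems by (metis dvd_add dvd_mult2)+
      show "m dvd b + n * x * (x * d - y * b)" "m dvd c + n * y * (x * c - y * a)"
        using n less.prems by (simp_all add: mult.assoc)
    qed
    then show ?thesis using transvection_mult[OF g n] by blast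
  qed
  show ?case
  proof (cases "c = 0")
    case True
    then have "a * d = 1" using det by simp
    then consider "a = 1" "d = 1" | "a = -1" "d = -1" by (auto simp: zmult_eq_1_iff)
    then show ?thesis
    proof cases
      case 1 then show ?thesis using True translation less.prems by simp
    next
      case 2
      have "G 1 (- b) 0 1" using translation less.prems by simp
      from neg[OF this] show ?thesis using 2 True by simp
    qed
  next
    case False
    have c2: "\<bar>c\<bar> \<ge> m" using dvd_imp_le_int[OF False, of m] less.prems(5) m by simp
    obtain x where x: "2 * \<bar>x * c - a\<bar> \<le> \<bar>c\<bar>" using closest_multiple[OF False] by blast
    \<comment> \<open>With the cusp x/1 and n = \<epsilon> m the entry c becomes c + \<epsilon> m e,
      which is smaller in modulus as soon as m |e| < 2|c|.\<close>
    define e where "e = x * c - a"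
    have ea: "a = x * c - e" by (simp add: e_def)
    have dvdc: "\<bar>k\<bar> = 1" if "k dvd c" "k dvd e" for k
      using dvd1[of k] that ea by (simp add: dvd_diff)
    have e0: "e \<noteq> 0"
    proof
      assume "e = 0"
      then have "\<bar>c\<bar> = 1" using dvdc[of c] by simp
      then show False using c2 m by simp
    qed
    have c_e: "\<bar>c\<bar> \<noteq> 2 * \<bar>e\<bar>" if "m \<ge> 3"
    proof
      assume "\<bar>c\<bar> = 2 * \<bar>e\<bar>"
      then have "e dvd c" by (metis abs_dvd_iff dvd_abs_iff dvd_triv_right)
      then have "\<bar>e\<bar> = 1" using dvdc by simp
      then show False using c2 that \<open>\<bar>c\<bar> = 2 * \<bar>e\<bar>\<close> by simp
    qed
    show ?thesis
    proof (cases "m * \<bar>e\<bar> < 2 * \<bar>c\<bar>")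
      case True
      obtain \<epsilon> where "\<bar>\<epsilon>\<bar> = 1" "\<bar>c + m * \<epsilon> * e\<bar> < \<bar>c\<bar>"
        using sign_step[of m e c] True e0 m by auto
      then show ?thesis by (intro step[of x 0 "-1" 1 "m * \<epsilon>"]) (auto simp: e_def)
    next
      case F: False
      have "2 * \<bar>e\<bar> \<le> \<bar>c\<bar>" using x by (simp add: e_def)
      \<comment> \<open>As 2|e| \<le> |c|, the first kind of step can fail only for m \<ge> 4. For m
        = 4 failure would mean 2|e| = |c|, which is excluded by \<open>c_e\<close>.\<close>
      consider "m = 2" | "m = 3" | "m = 4" | "m = 5" using m by linarith
      then have m5: "m = 5"
        using F \<open>2 * \<bar>e\<bar> \<le> \<bar>c\<bar>\<close> c_e False by cases auto
      \<comment> \<open>Since c and e are coprime, equality would give |c| = 5 and |e| = 2, hence a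
        \<equiv> \<plusminus>2 modulo 5, contrary to a \<equiv> 1.\<close>
      have ne: "5 * \<bar>e\<bar> \<noteq> 2 * \<bar>c\<bar>"
      proof
        assume eq: "5 * \<bar>e\<bar> = 2 * \<bar>c\<bar>"
        obtain c1 where c1: "c = 5 * c1" using less.prems(5) m5 by (auto elim: dvdE)
        then have e1: "\<bar>e\<bar> = 2 * \<bar>c1\<bar>" using eq by simp
        then have "c1 dvd e" by (metis abs_dvd_iff dvd_abs_iff dvd_triv_right)
        then have "\<bar>c1\<bar> = 1" using dvdc[of c1] c1 by simp
        then have "\<bar>e\<bar> = 2" using e1 by simp
        moreover have "5 dvd x * c - e - 1" using less.prems(2) m5 ea by simp
        moreover have "5 dvd x * c" using less.prems(5) m5 by simp
        ultimately have "\<bar>e\<bar> = 2" "5 dvd x * c - (x * c - e - 1)" using dvd_diff by blast+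
        then have "e = 2 \<or> e = - 2" "5 dvd e + 1" by (auto simp: abs_if split: if_splits)
        then show False by (elim disjE) simp_all
      qed
      \<comment> \<open>Now 2/5 < |e|/|c| < 1/2, so a/c is close to the half-integer x'/2 next to x.
        The new distance is |c| - 2|e| < |c|/5, and the transvection at x'/2 with n = \<plusminus>5
        changes c by 10 e', which is less than 2|c|.\<close>
      define x' where "x' = (if (c > 0) = (e > 0) then 2 * x - 1 else 2 * x + 1)"
      define e' where "e' = x' * c - 2 * a"
      have "e' = (if (c > 0) = (e > 0) then 2 * e - c else 2 * e + c)"
        by (simp add: e'_def x'_def e_def algebra_simps)
      then have e': "\<bar>e'\<bar> = \<bar>c\<bar> - 2 * \<bar>e\<bar>"
        using \<open>2 * \<bar>e\<bar> \<le> \<bar>c\<bar>\<close> e0 False by (auto simp: abs_if split: if_splits)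
      have "e' \<noteq> 0" using e' c_e m5 by auto
      moreover have "10 * \<bar>e'\<bar> < 2 * \<bar>c\<bar>" using e' F ne unfolding m5 by linarith
      ultimately obtain \<epsilon> where \<epsilon>: "\<bar>\<epsilon>\<bar> = 1" "\<bar>c + 10 * \<epsilon> * e'\<bar> < \<bar>c\<bar>"
        using sign_step[of 10 e' c] by auto
      obtain q where "x' = 2 * q + 1"
        by (rule that[of "if (c > 0) = (e > 0) then x - 1 else x"]) (simp add: x'_def)
      then have "x' * 1 - q * 2 = 1" by simp
      then show ?thesis
        by (rule step[where n = "5 * \<epsilon>"]) (use \<epsilon>(2) m5 in \<open>simp_all add: e'_def mult_ac\<close>)
    qed
  qed
qed

text \<open>If A' is congruent to A, then A' A^-1 is congruent to the identity and lies in the group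
  by \<open>principal_subset\<close>. From here on, membership may be tested on any representative
  of a residue class.\<close>

lemma residue:
  assumes A: "G a b c d" and det': "a' * d' - b' * c' = 1"
    and "m dvd a' - a" "m dvd b' - b" "m dvd c' - c" "m dvd d' - d"
  shows "G a' b' c' d'"
proof -
  note det = det[OF A]
  obtain p q r s where e: "a' = a + m * p" "b' = b + m * q" "c' = c + m * r" "d' = d + m * s"
    using assms(3-6) by (metis dvdE add.commute diff_add_cancel)
  have "G (a' * d - b' * c) (b' * a - a' * b) (c' * d - d' * c) (d' * a - c' * b)"
  proof (rule principal_subset)
    show "(a' * d - b' * c) * (d' * a - c' * b) - (b' * a - a' * b) * (c' * d - d' * c) = 1"
      using det det' by algebra
    have "a' * d - b' * c - 1 = m * (p * d - q * c)" "d' * a - c' * b - 1 = m * (s * a - r * b)"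
      "b' * a - a' * b = m * (q * a - p * b)" "c' * d - d' * c = m * (r * d - s * c)"
      using det unfolding e by (simp_all add: algebra_simps)
    then show "m dvd a' * d - b' * c - 1" "m dvd d' * a - c' * b - 1"
      "m dvd b' * a - a' * b" "m dvd c' * d - d' * c" by simp_all
  qed
  from mult[OF this A]
  have "G ((a' * d - b' * c) * a + (b' * a - a' * b) * c) ((a' * d - b' * c) * b + (b' * a - a' * b) * d)
     ((c' * d - d' * c) * a + (d' * a - c' * b) * c) ((c' * d - d' * c) * b + (d' * a - c' * b) * d)" .
  moreover have "(a' * d - b' * c) * a + (b' * a - a' * b) * c = a'"
    "(a' * d - b' * c) * b + (b' * a - a' * b) * d = b'"
    "(c' * d - d' * c) * a + (d' * a - c' * b) * c = c'"
    "(c' * d - d' * c) * b + (d' * a - c' * b) * d = d'"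
    using det by algebra+
  ultimately show ?thesis by simp
qed

text \<open>A matrix of trace \<plusminus>2 is, up to sign, a transvection. The entry b is forced by
  the determinant because c is nonzero, which is where y and n nonzero enter; then
  \<open>transvection\<close> applies.\<close>

lemma parabolic:
  assumes "G a b c d" "g = 1 \<or> g = -1" "a + d = 2 * g" "c = - g * n * y\<^sup>2" "a = g * (1 - n * x * y)" "x * s - q * y = 1" "y \<noteq> 0" "n \<noteq> 0"
  shows "m dvd n"
proof -
  have gg: "g * g = 1" using assms(2) by auto
  have d: "d = g * (1 + n * x * y)" using assms(3,5) by (simp add: algebra_simps)
  have "b * c = (a * d - 1)" using det[OF assms(1)] by simp
  also have "\<dots> = - (n * x * y)\<^sup>2" unfolding assms(5) d using gg by algebra
  also have "\<dots> = (g * n * x\<^sup>2) * c" unfolding assms(4) using gg by algebra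
  finally have "b = g * n * x\<^sup>2"
    using assms(2,4,7,8) by auto
  then have *: "G (g * (1 - n * x * y)) (g * (n * x\<^sup>2)) (g * (- n * y\<^sup>2)) (g * (1 + n * x * y))"
    using assms(1,4,5) d by (simp add: mult_ac)
  have "G (1 - n * x * y) (n * x\<^sup>2) (- n * y\<^sup>2) (1 + n * x * y)"
    using assms(2)
  proof
    assume "g = 1"
    show ?thesis using * unfolding \<open>g = 1\<close> by (simp only: mult_1)
  next
    assume "g = -1"
    show ?thesis using neg[OF *] unfolding \<open>g = -1\<close> by (simp only: mult_minus1 minus_minus)
  qed
  then show ?thesis using transvection[OF assms(6)] by blast
qed

text \<open>With c = 1, multiplying by translations changes the trace by multiples of m, so it can
  be made at most m/2 < 3 in modulus. Not being elliptic, the matrix has trace \<plusminus>2 and is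
  up to sign a transvection with |n| = 1, which m does not divide.\<close>

lemma lower_left_1: "\<not> G a b 1 d"
proof
  assume G: "G a b 1 d"
  obtain x where x: "2 * \<bar>x * m - (a + d)\<bar> \<le> \<bar>m\<bar>" using closest_multiple[of m "a + d"] m by auto
  define a' b' where "a' = a - x * m" and "b' = b - x * m * d"
  have G': "G a' b' 1 d" using translation_mult[of "- (x * m)" a b 1 d] G by (simp add: a'_def b'_def)
  have "\<bar>a' + d\<bar> \<le> 2" using x m by (simp add: a'_def abs_if split: if_splits)
  then have "a' + d = 2 \<or> a' + d = -2" using trace[OF G'] by linarith
  then have "m dvd 1 \<or> m dvd - 1"
  proof
    assume "a' + d = 2"
    then have "m dvd - 1" by (intro parabolic[OF G', of 1 "-1" 1 "a' - 1" 0 "-1"]) auto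
    then show ?thesis by simp
  next
    assume "a' + d = -2"
    then have "m dvd 1" by (intro parabolic[OF G', of "-1" 1 1 "a' + 1" 0 "-1"]) auto
    then show ?thesis by simp
  qed
  then show False using m by (auto dest: zdvd_imp_le)
qed

text \<open>With c = 2 the trace can be changed by multiples of 2m, and the determinant makes it
  even. This leaves 0, \<plusminus>2 and \<plusminus>4. Trace 0 is elliptic, trace \<plusminus>2
  gives a transvection with |n| = 2 up to sign, and trace \<plusminus>4 is carried to an elliptic
  matrix.\<close>

lemma lower_left_2:
  assumes "m \<ge> 4"
  shows "\<not> G a b 2 d"
proof
  assume G: "G a b 2 d"
  have m45: "m = 4 \<or> m = 5" using assms m by auto
  obtain x where x: "2 * \<bar>x * (2 * m) - (a + d)\<bar> \<le> \<bar>2 * m\<bar>"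
    using closest_multiple[of "2 * m" "a + d"] m by auto
  define a' b' where "a' = a - x * m * 2" and "b' = b - x * m * d"
  have G': "G a' b' 2 d" using translation_mult[of "- (x * m)" a b 2 d] G by (simp add: a'_def b'_def)
  have dt: "a' * d - 2 * b' = 1" using det[OF G'] by simp
  then have "a' * d = 2 * b' + 1" by simp
  then have "odd (a' * d)" by simp
  then have odd: "odd a'" "odd d" by simp_all
  have "\<bar>a' + d\<bar> \<le> 5" using x m by (simp add: a'_def abs_if split: if_splits)
  moreover have "even (a' + d)" using odd by simp
  then obtain k where k: "a' + d = 2 * k" by (rule evenE)
  ultimately have "k = -2 \<or> k = -1 \<or> k = 0 \<or> k = 1 \<or> k = 2" by linarith
  then have "a' + d = -4 \<or> a' + d = -2 \<or> a' + d = 0 \<or> a' + d = 2 \<or> a' + d = 4" using k by auto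
  then consider "a' + d = 0" | "a' + d = 2" | "a' + d = -2" | "a' + d = 4" | "a' + d = -4" by auto
  then show False
  proof cases
    case 1 then show ?thesis using trace[OF G'] by simp
  next
    case 2
    obtain p where p: "a' = 2 * p + 1" using odd(1) by (auto elim: oddE)
    have "m dvd - 2" by (rule parabolic[OF G', of 1 "-2" 1 p 0 "-1"]) (use 2 p in auto)
    then show ?thesis using m45 by auto
  next
    case 3
    obtain p where p: "a' = 2 * p + 1" using odd(1) by (auto elim: oddE)
    have "m dvd 2" by (rule parabolic[OF G', of "-1" 2 1 "p + 1" 0 "-1"]) (use 3 p in auto)
    then show ?thesis using m45 by auto
  next
    case 4
    obtain p where p: "a' = 2 * p + 1" using odd(1) by (auto elim: oddE)
    have d: "d = 3 - 2 * p" using 4 p by simp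
    have b: "b' = - 2 * p\<^sup>2 + 2 * p + 1" using dt unfolding p d by (simp add: algebra_simps power2_eq_square)
    \<comment> \<open>The transvection at the cusp p/1 with n = m turns the trace 4 into 4 - m,
      which is 0 or -1.\<close>
    have "G (a' + m * p * (p * 2 - 1 * a')) (b' + m * p * (p * d - 1 * b'))
      (2 + m * 1 * (p * 2 - 1 * a')) (d + m * 1 * (p * d - 1 * b'))"
      using transvection_mult[of p 0 "-1" 1 m a' b' 2 d] G' by simp
    from trace[OF this] show ?thesis
      using m45 unfolding p d b by (auto simp: algebra_simps power2_eq_square)
  next
    case 5
    obtain p where p: "a' = 2 * p - 1"
    proof -
      obtain p where "a' = 2 * p + 1" using odd(1) by (auto elim: oddE)
      then have "a' = 2 * (p + 1) - 1" by simp
      then show ?thesis using that by blast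
    qed
    have d: "d = - 3 - 2 * p" using 5 p by simp
    have b: "b' = - 2 * p\<^sup>2 - 2 * p + 1" using dt unfolding p d by (simp add: algebra_simps power2_eq_square)
    \<comment> \<open>Here n = -m, and the trace -4 becomes m - 4, which is 0 or 1.\<close>
    have "G (a' + (- m) * p * (p * 2 - 1 * a')) (b' + (- m) * p * (p * d - 1 * b'))
      (2 + (- m) * 1 * (p * 2 - 1 * a')) (d + (- m) * 1 * (p * d - 1 * b'))"
      using transvection_mult[of p 0 "-1" 1 "- m" a' b' 2 d] G' by simp
    from trace[OF this] show ?thesis
      using m45 unfolding p d b by (auto simp: algebra_simps power2_eq_square)
  qed
qed

lemma lower_left_not_cong_1:
  assumes G: "G a b c d"
  shows "\<not> m dvd c - 1"
proof
  assume c: "m dvd c - 1"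
  have "G a (a * d - 1) 1 d"
  proof (rule residue[OF G])
    have "a * d - 1 - b = b * (c - 1)" using det[OF G] by (simp add: algebra_simps)
    then show "m dvd a * d - 1 - b" using c by simp
    show "m dvd 1 - c" using c by (simp add: dvd_diff_commute)
  qed auto
  then show False using lower_left_1 by blast
qed

text \<open>The difficulty is to lift the class to determinant exactly 1 with lower left entry
  exactly 2: this requires odd diagonal entries.\<close>

lemma lower_left_not_cong_2:
  assumes G: "G a b c d" and m4: "m \<ge> 4"
  shows "\<not> m dvd c - 2"
proof
  assume c: "m dvd c - 2"
  note D = det[OF G]
  consider "m = 4" | "m = 5" using m4 m by linarith
  then have "\<exists>a b d. G a b 2 d"
  proof cases
    case 1
    then obtain k where "c - 2 = 4 * k" using c by (auto elim: dvdE)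
    then have k: "c = 2 + 4 * k" by simp
    have "a * d = 2 * (b * (1 + 2 * k)) + 1" using D unfolding k by (simp add: algebra_simps)
    then have "odd (a * d)" by simp
    then have "even (1 + a)" by simp
    then obtain l where l: "1 + a = 2 * l" by (rule evenE)
    \<comment> \<open>Replacing c = 2 + 4 k by 2 is compensated by adding 4 b k to d. The
      determinant then fixes the change of b, and it is divisible by 4 because a is odd.\<close>
    have "G a (b + 2 * b * k * (1 + a)) 2 (d + 4 * b * k)"
    proof (rule residue[OF G])
      show "a * (d + 4 * b * k) - (b + 2 * b * k * (1 + a)) * 2 = 1"
        using D unfolding k by (simp add: algebra_simps)
      show "m dvd b + 2 * b * k * (1 + a) - b" unfolding l 1 by simp
    qed (use 1 k in simp_all)
    then show ?thesis by blast
  next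
    case 2
    \<comment> \<open>Adding 5 repairs the parity without changing the class; b' is congruent to b
      because 2 is invertible modulo 5.\<close>
    define a' d' where "a' = (if odd a then a else a + 5)" and "d' = (if odd d then d else d + 5)"
    have "odd (a' * d')" by (simp add: a'_def d'_def)
    then obtain b' where b': "a' * d' = 2 * b' + 1" by (rule oddE)
    have 5: "5 dvd a' - a" "5 dvd d' - d" by (simp_all add: a'_def d'_def)
    have "G a' b' 2 d'"
    proof (rule residue[OF G])
      have "2 * (b' - b) = (a' - a) * d' + a * (d' - d) + b * (c - 2)"
        using b' D by (simp add: algebra_simps)
      moreover have "5 dvd (a' - a) * d' + a * (d' - d) + b * (c - 2)"
        using 5 c 2 by (intro dvd_add) auto
      ultimately have "5 dvd 2 * (b' - b)" by simp
      then show "m dvd b' - b" unfolding 2 by presburger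
      show "m dvd 2 - c" using c by (simp add: dvd_diff_commute)
    qed (use 5 b' 2 in simp_all)
    then show ?thesis by blast
  qed
  then show False using lower_left_2[OF m4] by blast
qed

text \<open>The residues \<plusminus>1, together with \<plusminus>2 when m \<ge> 4, are all the
  nonzero residues modulo m. The negative ones are excluded by passing to the negative
  matrix.\<close>

lemma lower_left:
  assumes G: "G a b c d"
  shows "m dvd c"
proof -
  have 1: "\<not> m dvd c - 1" "\<not> m dvd c + 1"
    using lower_left_not_cong_1[OF G] lower_left_not_cong_1[OF neg[OF G]] by (simp_all only: dvd_uminus_diff_iff not_False_eq_True)
  have 2: "\<not> m dvd c - 2" "\<not> m dvd c + 2" if "m \<ge> 4"
    using lower_left_not_cong_2[OF G that] lower_left_not_cong_2[OF neg[OF G] that] by (simp_all only: dvd_uminus_diff_iff not_False_eq_True)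
  consider "m = 2" | "m = 3" | "m = 4" | "m = 5" using m by linarith
  then show ?thesis
  proof cases
    case 1 show ?thesis using \<open>\<not> m dvd c - 1\<close> unfolding 1 by presburger
  next
    case 2 show ?thesis using \<open>\<not> m dvd c - 1\<close> \<open>\<not> m dvd c + 1\<close> unfolding 2 by presburger
  next
    case 3 show ?thesis using 1 2 unfolding 3 by presburger
  next
    case 4 show ?thesis using 1 2 unfolding 4 by presburger
  qed
qed

lemma upper_left_1:
  assumes G: "G a b c d" and a: "m dvd a - 1"
  shows "m dvd b \<and> m dvd c \<and> m dvd d - 1"
proof -
  have c: "m dvd c" by (rule lower_left[OF G])
  have "d - 1 = b * c - (a - 1) * d" using det[OF G] by (simp add: algebra_simps)
  then have d: "m dvd d - 1" using a c by simp
  have "G 1 b 0 1"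
    by (rule residue[OF G]) (use a c d in \<open>simp_all add: dvd_diff_commute\<close>)
  then show ?thesis using c d translation by blast
qed

text \<open>The determinant gives d \<equiv> -2 modulo 5, so the trace is divisible by 5; after a
  conjugation the class contains an integral matrix of trace 0.\<close>

lemma upper_left_not_2:
  assumes G: "G a b c d" and m5: "m = 5"
  shows "\<not> m dvd a - 2"
proof
  assume a: "m dvd a - 2"
  have c: "m dvd c" by (rule lower_left[OF G])
  have "2 * (d + 2) = b * c - (a - 2) * d + 5" using det[OF G] by (simp add: algebra_simps)
  moreover have "5 dvd b * c - (a - 2) * d + 5" using a c m5 by (intro dvd_add dvd_diff) auto
  ultimately have "5 dvd 2 * (d + 2)" by simp
  then have d: "5 dvd d + 2" by presburger
  \<comment> \<open>Conjugation by the translation by x changes b by x (d - a) modulo 5, and d - a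
    \<equiv> 1. So this x moves the upper right entry to the residue 1.\<close>
  define x where "x = 1 - b"
  from conj[of 1 1 x 0, OF _ G]
  have "G (a + x * c) (b + x * d - (a + x * c) * x) c (d - c * x)" by simp
  then have "G 2 1 (- 5) (- 2)"
  proof (rule residue)
    have "1 - (b + x * d - (a + x * c) * x) = x * x * c + x * (a - 2) - x * (d + 2) + 5 * x"
      by (simp add: x_def algebra_simps)
    moreover have "5 dvd x * x * c + x * (a - 2) - x * (d + 2) + 5 * x"
      using a c d m5 by (intro dvd_add dvd_diff) auto
    ultimately show "m dvd 1 - (b + x * d - (a + x * c) * x)" unfolding m5 by simp
    have "2 - (a + x * c) = - (a - 2) - x * c" by simp
    then show "m dvd 2 - (a + x * c)" using a c by (metis dvd_diff dvd_minus_iff dvd_mult)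
    have "- 2 - (d - c * x) = c * x - (d + 2)" by simp
    then show "m dvd - 2 - (d - c * x)" using c d m5 by (metis dvd_diff dvd_mult2)
    show "m dvd - 5 - c" using c m5 by (intro dvd_diff) auto
  qed simp
  from trace[OF this] show False by simp
qed

text \<open>As m divides c, the entry a is a unit modulo m. The units are \<plusminus>1 for m \<le>
  4, and for m = 5 the further units \<plusminus>2 are excluded by
  \<open>upper_left_not_2\<close>.\<close>

lemma congruence_mod_level:
  assumes G: "G a b c d"
  shows "m dvd b \<and> m dvd c \<and> (m dvd a - 1 \<and> m dvd d - 1 \<or> m dvd a + 1 \<and> m dvd d + 1)"
proof -
  have c: "m dvd c" by (rule lower_left[OF G])
  note D = det[OF G]
  note G' = neg[OF G]
  have cop: "\<bar>e\<bar> = 1" if "e dvd a" "e dvd m" for e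
  proof -
    have "e dvd a * d - b * c" using that c by (meson dvd_diff dvd_mult dvd_mult2 dvd_trans)
    then show ?thesis unfolding D by (simp add: zdvd1_eq)
  qed
  have not_2: "\<not> 5 dvd a - 2" "\<not> 5 dvd a + 2" if "m = 5"
    using upper_left_not_2[OF G that] upper_left_not_2[OF G' that] that by (simp_all add: dvd_uminus_diff_iff)
  consider "m = 2" | "m = 3" | "m = 4" | "m = 5" using m by linarith
  then have "m dvd a - 1 \<or> m dvd a + 1"
  proof cases
    case 1
    have "\<not> 2 dvd a" using cop[of 2] 1 by auto
    then show ?thesis unfolding 1 by presburger
  next
    case 2
    have "\<not> 3 dvd a" using cop[of 3] 2 by auto
    then show ?thesis unfolding 2 by presburger
  next
    case 3
    have "\<not> 2 dvd a" using cop[of 2] 3 by auto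
    then show ?thesis unfolding 3 by presburger
  next
    case 4
    have "\<not> 5 dvd a" using cop[of 5] 4 by auto
    then show ?thesis using not_2[OF 4] unfolding 4 by presburger
  qed
  then show ?thesis
  proof
    assume "m dvd a - 1"
    then show ?thesis using upper_left_1[OF G] by blast
  next
    assume "m dvd a + 1"
    then show ?thesis using upper_left_1[OF G'] by (simp add: dvd_uminus_diff_iff)
  qed
qed

end

section \<open>The invariance group\<close>

lemma schwarz_solution_nonpole:
  assumes "schwarz_solution s h" "Im z > 0"
  shows "\<forall>\<^sub>F w in at z. \<not> is_pole h w"
proof -
  have "h meromorphic_on upper_half_plane"
    using assms by (simp add: schwarz_solution_def nicely_meromorphic_on_def)
  from meromorphic_on_imp_not_pole_cosparse[OF this] show ?thesis
    using assms by (simp add: eventually_cosparse_open_eq[OF open_upper_half_plane])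
qed

section \<open>The kernel of the slash action on the solutions\<close>

lemma SL2Z_inverse:
  assumes "A \<in> carrier SL2Z"
  obtains B where "B \<in> carrier SL2Z" "A ** B = mat 1" "B ** A = mat 1"
  using group.inv_closed[OF group_SL2Z assms] group.r_inv[OF group_SL2Z assms] group.l_inv[OF group_SL2Z assms]
  by (auto simp: SL2Z_def intro: that[of "inv\<^bsub>SL2Z\<^esub> A"])

lemma aut_factor_mat_1 [simp]: "aut_factor (mat 1) \<tau> = 1"
  by (simp add: aut_factor_def mat_def)

lemma moebius_mat_1 [simp]: "moebius (mat 1) \<tau> = \<tau>"
  by (simp add: moebius_def mat_def)

lemma slash_mat_1 [simp]: "slash (mat 1) v = v"
  by (simp add: slash_def fun_eq_iff)

lemma mat_1_SL2Z [simp]: "mat 1 \<in> carrier SL2Z"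
  by (simp add: SL2Z_def)

text \<open>Equality is required on the half-plane only, as solutions are total functions with
  arbitrary values elsewhere.\<close>

definition acts_trivially :: "complex \<Rightarrow> int^2^2 \<Rightarrow> bool" where
  "acts_trivially s A \<longleftrightarrow> A \<in> carrier SL2Z \<and> (\<forall>v \<tau>. solves s v \<longrightarrow> Im \<tau> > 0 \<longrightarrow> slash A v \<tau> = v \<tau>)"

lemma slash_cong:
  assumes "A \<in> carrier SL2Z" "Im \<tau> > 0" "\<And>z. Im z > 0 \<Longrightarrow> v z = w z"
  shows "slash A v \<tau> = slash A w \<tau>"
  using assms Im_moebius_pos[OF assms(1,2)] by (simp add: slash_def)

lemma acts_trivially_mult:
  assumes A: "acts_trivially s A" and B: "acts_trivially s B"
  shows "acts_trivially s (A ** B)"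
  unfolding acts_trivially_def
proof (intro conjI allI impI)
  have AB: "A \<in> carrier SL2Z" "B \<in> carrier SL2Z" using A B by (simp_all add: acts_trivially_def)
  then show "A ** B \<in> carrier SL2Z" by (rule SL2Z_mult)
  fix v \<tau> assume v: "solves s v" and \<tau>: "Im \<tau> > 0"
  have "slash (A ** B) v \<tau> = slash B (slash A v) \<tau>" by (rule slash_mult[OF AB \<tau>])
  also have "\<dots> = slash A v \<tau>" using B solves_slash[OF v AB(1)] \<tau> by (simp add: acts_trivially_def)
  also have "\<dots> = v \<tau>" using A v \<tau> by (simp add: acts_trivially_def)
  finally show "slash (A ** B) v \<tau> = v \<tau>" .
qed

text \<open>Normality: the space of solutions is stable under \<open>slash g\<close>, so A also
  fixes the solution \<open>slash g v\<close>.\<close>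

lemma acts_trivially_conj:
  assumes A: "acts_trivially s A" and g: "g \<in> carrier SL2Z" "g' \<in> carrier SL2Z" "g ** g' = mat 1"
  shows "acts_trivially s (g ** A ** g')"
  unfolding acts_trivially_def
proof (intro conjI allI impI)
  have A': "A \<in> carrier SL2Z" using A by (simp add: acts_trivially_def)
  note gA = SL2Z_mult[OF g(1) A']
  show "g ** A ** g' \<in> carrier SL2Z" by (rule SL2Z_mult[OF gA g(2)])
  fix v \<tau> assume v: "solves s v" and \<tau>: "Im \<tau> > 0"
  have "slash (g ** A ** g') v \<tau> = slash g' (slash (g ** A) v) \<tau>" by (rule slash_mult[OF gA g(2) \<tau>])
  also have "\<dots> = slash g' (slash g v) \<tau>"
  proof (rule slash_cong[OF g(2) \<tau>])
    fix z :: complex assume z: "Im z > 0"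
    have "slash (g ** A) v z = slash A (slash g v) z" by (rule slash_mult[OF g(1) A' z])
    also have "\<dots> = slash g v z" using A solves_slash[OF v g(1)] z by (simp add: acts_trivially_def)
    finally show "slash (g ** A) v z = slash g v z" .
  qed
  also have "\<dots> = slash (g ** g') v \<tau>" by (rule slash_mult[OF g(1,2) \<tau>, symmetric])
  finally show "slash (g ** A ** g') v \<tau> = v \<tau>" by (simp add: g(3))
qed

lemma acts_trivially_inverse:
  assumes A: "acts_trivially s A" and B: "B \<in> carrier SL2Z" "A ** B = mat 1"
  shows "acts_trivially s B"
  unfolding acts_trivially_def
proof (intro conjI allI impI)
  fix v \<tau> assume v: "solves s v" and \<tau>: "Im \<tau> > 0"
  have A': "A \<in> carrier SL2Z" using A by (simp add: acts_trivially_def)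
  have "slash B v \<tau> = slash B (slash A v) \<tau>"
    using A v by (intro slash_cong[OF B(1) \<tau>]) (simp add: acts_trivially_def)
  also have "\<dots> = slash (A ** B) v \<tau>" by (rule slash_mult[OF A' B(1) \<tau>, symmetric])
  finally show "slash B v \<tau> = v \<tau>" by (simp add: B(2))
qed (rule B(1))

text \<open>All that is retained of the Schwarz equation: h = v1/v0 with derivative 1/v0, and
  coordinates without common zero. Symmetries of h become linear statements about solutions.\<close>

locale schwarz_basis =
  fixes s :: complex and h v0 v1 v2 :: "complex \<Rightarrow> complex"
  assumes v0: "solves s v0" and v1: "solves s v1" and v2: "solves s v2"
    and at_pole: "\<And>\<tau>. Im \<tau> > 0 \<Longrightarrow> is_pole h \<tau> \<Longrightarrow> v0 \<tau> = 0 \<and> v2 \<tau> \<noteq> 0"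
    and has_deriv: "\<And>\<tau>. Im \<tau> > 0 \<Longrightarrow> \<not> is_pole h \<tau> \<Longrightarrow> (h has_field_derivative 1 / v0 \<tau>) (at \<tau>)"
    and at_regular: "\<And>\<tau>. Im \<tau> > 0 \<Longrightarrow> \<not> is_pole h \<tau> \<Longrightarrow>
       v0 \<tau> \<noteq> 0 \<and> v1 \<tau> = h \<tau> * v0 \<tau> \<and> v2 \<tau> = (h \<tau>)\<^sup>2 * v0 \<tau>"
    and nonpole: "\<And>z. Im z > 0 \<Longrightarrow> \<forall>\<^sub>F w in at z. \<not> is_pole h w"
begin

definition regular :: "complex set" where
  "regular = {\<tau>. Im \<tau> > 0 \<and> \<not> is_pole h \<tau>}"

text \<open>The poles of h in the half-plane are exactly the zeros of \<open>v0\<close>.\<close>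

lemma open_regular: "open regular"
proof -
  have "regular = upper_half_plane \<inter> v0 -` (- {0})"
    using at_pole at_regular by (auto simp: regular_def)
  moreover have "open (upper_half_plane \<inter> v0 -` (- {0}))"
    using v0 by (intro continuous_open_preimage holomorphic_on_imp_continuous_on open_upper_half_plane)
      (auto simp: solves_def)
  ultimately show ?thesis by simp
qed

lemma eventually_regular: "Im z > 0 \<Longrightarrow> \<forall>\<^sub>F w in at z. w \<in> regular"
proof -
  assume z: "Im z > 0"
  have "\<forall>\<^sub>F w in at z. w \<in> upper_half_plane"
    using z by (intro eventually_at_in_open' open_upper_half_plane) simp
  with nonpole[OF z] show ?thesis by eventually_elim (simp add: regular_def)
qed

lemma regular_nonempty: obtains \<tau>0 where "\<tau>0 \<in> regular"
  using eventually_happens'[OF trivial_limit_at eventually_regular[of \<i>]] by auto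

lemma eq_on_regular_imp_eq:
  assumes "f holomorphic_on upper_half_plane" "g holomorphic_on upper_half_plane"
    and eq: "\<And>\<tau>. \<tau> \<in> regular \<Longrightarrow> f \<tau> = g \<tau>" and z: "Im z > 0"
  shows "f z = g z"
proof -
  have "\<forall>\<^sub>F w in at z. f w = g w" using eventually_regular[OF z] by (rule eventually_mono) (rule eq)
  moreover have "f \<midarrow>z\<rightarrow> f z" "g \<midarrow>z\<rightarrow> g z"
    using assms holomorphic_upper_half_plane_isCont by (auto intro!: isContD)
  ultimately show ?thesis using tendsto_unique[OF trivial_limit_at] Lim_transform_eventually by fast
qed

text \<open>For k = h \<tau>0 the solutions v0, (h - k) v0, (h - k)^2 v0 have a triangular matrix of
  2-jets at \<tau>0, with diagonal v0, 1, 2/v0. So any 2-jet can be matched there, and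
  \<open>solves_unique\<close> makes the match global.\<close>

lemma solution_span:
  assumes v: "solves s v"
  obtains a b c where "\<And>\<tau>. Im \<tau> > 0 \<Longrightarrow> v \<tau> = a * v0 \<tau> + b * v1 \<tau> + c * v2 \<tau>"
proof -
  obtain \<tau>0 where \<tau>0: "\<tau>0 \<in> regular" using regular_nonempty .
  then have Im0: "Im \<tau>0 > 0" by (simp add: regular_def)
  define k where "k = h \<tau>0"
  define w1 where "w1 = (\<lambda>\<tau>. 1 * v1 \<tau> + (- k) * v0 \<tau>)"
  define w2 where "w2 = (\<lambda>\<tau>. 1 * v2 \<tau> + 1 * ((- 2 * k) * v1 \<tau> + k\<^sup>2 * v0 \<tau>))"
  have sw1: "solves s w1" unfolding w1_def by (intro solves_lincomb v0 v1)
  have sw2: "solves s w2" unfolding w2_def by (intro solves_lincomb v0 v1 v2)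
  have w1_eq: "w1 \<tau> = (h \<tau> - k) * v0 \<tau>" and w2_eq: "w2 \<tau> = (h \<tau> - k)\<^sup>2 * v0 \<tau>"
    and v0_nz: "v0 \<tau> \<noteq> 0" if "\<tau> \<in> regular" for \<tau>
    using at_regular[of \<tau>] that by (simp_all add: regular_def w1_def w2_def power2_eq_square algebra_simps)
  have Dh: "(h has_field_derivative 1 / v0 \<tau>) (at \<tau>)" if "\<tau> \<in> regular" for \<tau>
    using has_deriv[of \<tau>] that by (simp add: regular_def)
  have Dv0: "(v0 has_field_derivative deriv v0 \<tau>) (at \<tau>)"
    "(deriv v0 has_field_derivative deriv (deriv v0) \<tau>) (at \<tau>)" if "\<tau> \<in> regular" for \<tau>
    using solves_derivs(1,2)[OF v0, of \<tau>] that by (simp_all add: regular_def)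
  have d1: "deriv w1 \<tau> = 1 + (h \<tau> - k) * deriv v0 \<tau>" if "\<tau> \<in> regular" for \<tau>
  proof (rule DERIV_imp_deriv, rule has_field_derivative_transform_within_open[OF _ open_regular that])
    show "((\<lambda>\<tau>. (h \<tau> - k) * v0 \<tau>) has_field_derivative 1 + (h \<tau> - k) * deriv v0 \<tau>) (at \<tau>)"
      by (rule derivative_eq_intros Dh[OF that] Dv0[OF that] refl)+ (use v0_nz[OF that] in simp)
  qed (simp add: w1_eq)
  have d2: "deriv w2 \<tau> = 2 * (h \<tau> - k) + (h \<tau> - k)\<^sup>2 * deriv v0 \<tau>" if "\<tau> \<in> regular" for \<tau>
  proof (rule DERIV_imp_deriv, rule has_field_derivative_transform_within_open[OF _ open_regular that])
    show "((\<lambda>\<tau>. (h \<tau> - k)\<^sup>2 * v0 \<tau>) has_field_derivative 2 * (h \<tau> - k) + (h \<tau> - k)\<^sup>2 * deriv v0 \<tau>) (at \<tau>)"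
      by (rule derivative_eq_intros Dh[OF that] Dv0[OF that] refl)+ (use v0_nz[OF that] in simp)
  qed (simp add: w2_eq)
  have d22: "deriv (deriv w2) \<tau>0 = 2 / v0 \<tau>0"
  proof (rule DERIV_imp_deriv, rule has_field_derivative_transform_within_open[OF _ open_regular \<tau>0])
    show "((\<lambda>\<tau>. 2 * (h \<tau> - k) + (h \<tau> - k)\<^sup>2 * deriv v0 \<tau>) has_field_derivative 2 / v0 \<tau>0) (at \<tau>0)"
      by (rule derivative_eq_intros Dh[OF \<tau>0] Dv0[OF \<tau>0] refl)+ (simp add: k_def)
  qed (simp add: d2)
  define a b c where "a = v \<tau>0 / v0 \<tau>0" and "b = deriv v \<tau>0 - a * deriv v0 \<tau>0"
    and "c = (deriv (deriv v) \<tau>0 - a * deriv (deriv v0) \<tau>0 - b * deriv (deriv w1) \<tau>0) / (2 / v0 \<tau>0)"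
  define u where "u = (\<lambda>\<tau>. 1 * v \<tau> + (- 1) * (1 * (a * v0 \<tau> + b * w1 \<tau>) + c * w2 \<tau>))"
  have su: "solves s u" unfolding u_def by (intro solves_lincomb v v0 sw1 sw2)
  note D = solves_derivs(1,2)[OF v] solves_derivs(1,2)[OF v0] solves_derivs(1,2)[OF sw1] solves_derivs(1,2)[OF sw2]
  have du: "deriv u \<tau> = deriv v \<tau> - (a * deriv v0 \<tau> + b * deriv w1 \<tau> + c * deriv w2 \<tau>)" if "Im \<tau> > 0" for \<tau>
    unfolding u_def by (rule DERIV_imp_deriv) (rule derivative_eq_intros D that refl | simp)+
  have du2: "deriv (deriv u) \<tau>0 = deriv (deriv v) \<tau>0 - (a * deriv (deriv v0) \<tau>0 + b * deriv (deriv w1) \<tau>0 + c * deriv (deriv w2) \<tau>0)"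
  proof (rule DERIV_imp_deriv, rule has_field_derivative_transform_within_open[OF _ open_upper_half_plane])
    show "((\<lambda>\<tau>. deriv v \<tau> - (a * deriv v0 \<tau> + b * deriv w1 \<tau> + c * deriv w2 \<tau>)) has_field_derivative
      deriv (deriv v) \<tau>0 - (a * deriv (deriv v0) \<tau>0 + b * deriv (deriv w1) \<tau>0 + c * deriv (deriv w2) \<tau>0)) (at \<tau>0)"
      by (rule derivative_eq_intros D Im0 refl | simp)+
  qed (use Im0 in \<open>simp_all add: du\<close>)
  have "u \<tau> = 0" if "Im \<tau> > 0" for \<tau>
  proof (rule solves_unique[OF su Im0 _ _ _ that])
    show "u \<tau>0 = 0" using v0_nz[OF \<tau>0] by (simp add: u_def w1_eq[OF \<tau>0] w2_eq[OF \<tau>0] a_def k_def)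
    show "deriv u \<tau>0 = 0" unfolding du[OF Im0] d1[OF \<tau>0] d2[OF \<tau>0] by (simp add: k_def b_def)
    show "deriv (deriv u) \<tau>0 = 0" unfolding du2 d22 using v0_nz[OF \<tau>0] by (simp add: c_def)
  qed
  then have "v \<tau> = (a - b * k + c * k\<^sup>2) * v0 \<tau> + (b - 2 * c * k) * v1 \<tau> + c * v2 \<tau>" if "Im \<tau> > 0" for \<tau>
    using that by (simp add: u_def w1_def w2_def algebra_simps)
  then show ?thesis using that by blast
qed

text \<open>Differentiating h(A\<tau>) = h(\<tau>) shows that v0 = 1/h' is fixed, and then so are h
  v0 and h^2 v0. Conversely h is the quotient of two fixed solutions, whose automorphy factors
  cancel, and the zeros of \<open>v0\<close> locate its poles.\<close>

lemma invariance_group_iff: "A \<in> invariance_group h \<longleftrightarrow> acts_trivially s A"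
proof
  assume "A \<in> invariance_group h"
  then have A: "A \<in> carrier SL2Z" and inv: "\<And>\<tau>. Im \<tau> > 0 \<Longrightarrow> sphere_value h (moebius A \<tau>) = sphere_value h \<tau>"
    by (auto simp: invariance_group_def)
  have hol: "slash A v holomorphic_on upper_half_plane" "v holomorphic_on upper_half_plane" if "solves s v" for v
    using that solves_slash[OF that A] by (auto simp: solves_def)
  have reg: "moebius A \<tau> \<in> regular" "h (moebius A \<tau>) = h \<tau>" if "\<tau> \<in> regular" for \<tau>
    using inv[of \<tau>] Im_moebius_pos[OF A, of \<tau>] that
    by (auto simp: regular_def sphere_value_def split: if_splits)
  have 0: "slash A v0 \<tau> = v0 \<tau>" if \<tau>: "\<tau> \<in> regular" for \<tau>
  proof -
    have Im: "Im \<tau> > 0" using that by (simp add: regular_def)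
    have nz: "v0 \<tau> \<noteq> 0" "v0 (moebius A \<tau>) \<noteq> 0" "aut_factor A \<tau> \<noteq> 0"
      using at_regular that reg(1)[OF that] aut_factor_nonzero[OF A Im] by (auto simp: regular_def)
    have "1 / v0 (moebius A \<tau>) * (1 / (aut_factor A \<tau>)\<^sup>2) = 1 / v0 \<tau>"
    proof (rule DERIV_eq_on_open[OF _ _ open_regular \<tau> reg(2)])
      show "((\<lambda>\<tau>. h (moebius A \<tau>)) has_field_derivative 1 / v0 (moebius A \<tau>) * (1 / (aut_factor A \<tau>)\<^sup>2)) (at \<tau>)"
        by (rule DERIV_chain2[OF has_deriv has_field_derivative_moebius[OF A Im]])
           (use reg(1)[OF that] in \<open>auto simp: regular_def\<close>)
      show "(h has_field_derivative 1 / v0 \<tau>) (at \<tau>)"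
        using has_deriv \<tau> by (simp add: regular_def)
    qed
    then show ?thesis using nz by (simp add: slash_def divide_simps mult_ac)
  qed
  have 12: "slash A v1 \<tau> = v1 \<tau>" "slash A v2 \<tau> = v2 \<tau>" if \<tau>: "\<tau> \<in> regular" for \<tau>
    using 0[OF that] at_regular[of \<tau>] at_regular[of "moebius A \<tau>"] that reg[OF that]
    by (simp_all add: slash_def regular_def) 
  show "acts_trivially s A" unfolding acts_trivially_def
  proof (intro conjI allI impI A)
    fix v \<tau> assume v: "solves s v" and \<tau>: "Im \<tau> > 0"
    obtain a b c where abc: "\<And>\<tau>. Im \<tau> > 0 \<Longrightarrow> v \<tau> = a * v0 \<tau> + b * v1 \<tau> + c * v2 \<tau>"
      using solution_span[OF v] by blast
    show "slash A v \<tau> = v \<tau>"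
    proof (rule eq_on_regular_imp_eq[OF hol[OF v] _ \<tau>])
      fix z assume z: "z \<in> regular"
      then have Im: "Im z > 0" by (simp add: regular_def)
      have "slash A v z = a * slash A v0 z + b * slash A v1 z + c * slash A v2 z"
        using Im_moebius_pos[OF A Im] by (simp add: slash_def abc algebra_simps)
      then show "slash A v z = v z" using 0[OF z] 12[OF z] by (simp add: abc[OF Im])
    qed
  qed
next
  assume *: "acts_trivially s A"
  then have A: "A \<in> carrier SL2Z" by (simp add: acts_trivially_def)
  have "sphere_value h (moebius A \<tau>) = sphere_value h \<tau>" if \<tau>: "Im \<tau> > 0" for \<tau>
  proof -
    have M: "Im (moebius A \<tau>) > 0" by (rule Im_moebius_pos[OF A \<tau>])
    have j: "aut_factor A \<tau> \<noteq> 0" by (rule aut_factor_nonzero[OF A \<tau>])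
    have e: "(aut_factor A \<tau>)\<^sup>2 * v0 (moebius A \<tau>) = v0 \<tau>" "(aut_factor A \<tau>)\<^sup>2 * v1 (moebius A \<tau>) = v1 \<tau>"
      using * v0 v1 \<tau> by (simp_all add: acts_trivially_def slash_def)
    have z: "v0 (moebius A \<tau>) = 0 \<longleftrightarrow> v0 \<tau> = 0" using e(1) j by auto
    have p: "is_pole h (moebius A \<tau>) \<longleftrightarrow> is_pole h \<tau>"
      using z at_pole[OF M] at_regular[OF M] at_pole[OF \<tau>] at_regular[OF \<tau>] by blast
    show ?thesis
    proof (cases "is_pole h \<tau>")
      case True then show ?thesis using p by (simp add: sphere_value_def)
    next
      case False
      have r: "v0 \<tau> \<noteq> 0" "v1 \<tau> = h \<tau> * v0 \<tau>" "v1 (moebius A \<tau>) = h (moebius A \<tau>) * v0 (moebius A \<tau>)"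
        using at_regular[OF \<tau>] at_regular[OF M] False p by auto
      have "h (moebius A \<tau>) * v0 \<tau> = h \<tau> * v0 \<tau>"
        using e r by (simp add: mult_ac flip: e(1)) 
      then show ?thesis using r(1) False p by (simp add: sphere_value_def)
    qed
  qed
  then show "A \<in> invariance_group h" using A by (simp add: invariance_group_def)
qed

text \<open>An element with trace of modulus at most one fixes a point, where the multiplier is a
  root of unity of order 3, 4 or 6, so every solution would vanish there.\<close>

lemma acts_trivially_trace:
  fixes A :: "int^2^2"
  assumes "acts_trivially s A"
  shows "\<bar>A$1$1 + A$2$2\<bar> \<ge> 2"
proof (rule ccontr)
  assume t2: "\<not> \<bar>A$1$1 + A$2$2\<bar> \<ge> 2"
  have A: "A \<in> carrier SL2Z" using assms by (simp add: acts_trivially_def)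
  define a b c d where "a = real_of_int (A$1$1)" and "b = real_of_int (A$1$2)"
    and "c = real_of_int (A$2$1)" and "d = real_of_int (A$2$2)"
  have "a * d - b * c = real_of_int (A$1$1 * A$2$2 - A$1$2 * A$2$1)"
    by (simp add: a_def b_def c_def d_def)
  then have det: "a * d - b * c = 1" using A by (simp only: SL2Z_det of_int_1)
  define t where "t = a + d"
  have "\<bar>A$1$1 + A$2$2\<bar> \<le> 1" using t2 by simp
  then have "\<bar>real_of_int (A$1$1 + A$2$2)\<bar> \<le> 1" by linarith
  then have t: "\<bar>t\<bar> \<le> 1" by (simp add: t_def a_def d_def)
  then have tt: "t\<^sup>2 \<le> 1" using abs_square_le_1 by blast
  have c0: "c \<noteq> 0"
  proof
    assume "c = 0"
    then have "t\<^sup>2 = (a - d)\<^sup>2 + 4" using det by (simp add: t_def power2_eq_square algebra_simps)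
    then show False using tt zero_le_power2[of "a - d"] by linarith
  qed
  \<comment> \<open>The fixed point is chosen so that its automorphy factor is the eigenvalue (t + i
    r)/2 of A. The sign of c places the point in the upper half-plane.\<close>
  define r where "r = sgn c * sqrt (4 - t\<^sup>2)"
  have rr: "r\<^sup>2 = 4 - t\<^sup>2" using tt c0 by (simp add: r_def power_mult_distrib sgn_if)
  define \<tau> where "\<tau> = Complex ((a - d) / (2 * c)) (r / (2 * c))"
  have Im: "Im \<tau> > 0"
    using tt c0 by (auto simp: \<tau>_def r_def sgn_if zero_less_divide_iff)
  define j where "j = aut_factor A \<tau>"
  have j: "j = Complex (t / 2) (r / 2)"
    using c0 by (simp add: j_def aut_factor_def complex_eq_iff \<tau>_def t_def flip: c_def d_def) (simp add: field_simps)
  have fixp: "moebius A \<tau> = \<tau>"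
  proof -
    have "of_int (A$1$1) * \<tau> + of_int (A$1$2) = of_real a * \<tau> + of_real b"
      by (simp add: a_def b_def)
    also have "\<dots> = \<tau> * j"
    proof -
      have "4 * c * (a * ((a - d) / (2 * c)) + b) = (a - d) * t - r\<^sup>2"
      proof -
        have "4 * c * (a * ((a - d) / (2 * c)) + b) = 2 * (a * (a - d)) + 4 * (b * c)"
          using c0 by (simp add: distrib_left)
        also have "b * c = a * d - 1" using det by simp
        finally show ?thesis unfolding rr by (simp add: t_def power2_eq_square algebra_simps)
      qed
      then have "a * ((a - d) / (2 * c)) + b = ((a - d) * t - r\<^sup>2) / (4 * c)"
        using c0 by (subst nonzero_eq_divide_eq) (simp_all only: mult.commute mult_eq_0_iff, simp_all)
      also have "\<dots> = ((a - d) / (2 * c)) * (t / 2) - r / (2 * c) * (r / 2)"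
        using c0 by (simp add: field_simps power2_eq_square)
      finally have "a * ((a - d) / (2 * c)) + b = ((a - d) / (2 * c)) * (t / 2) - r / (2 * c) * (r / 2)" .
      moreover have "a * (r / (2 * c)) = (a - d) / (2 * c) * (r / 2) + r / (2 * c) * (t / 2)"
        using c0 by (simp add: t_def field_simps)
      ultimately show ?thesis unfolding j by (simp add: complex_eq_iff \<tau>_def)
    qed
    finally have "aut_factor A \<tau> * moebius A \<tau> = \<tau> * j" using moebius_aut_factor[OF A Im] by simp
    then show ?thesis using aut_factor_nonzero[OF A Im] by (simp add: j_def)
  qed
  \<comment> \<open>By r^2 = 4 - t^2 the real part of j^2 is t^2/2 - 1, which is at most
    -1/2.\<close>
  have "j\<^sup>2 \<noteq> 1"
  proof
    assume "j\<^sup>2 = 1"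
    then have "Re (j\<^sup>2) = 1" by simp
    then have "t\<^sup>2 / 4 - r\<^sup>2 / 4 = 1" unfolding j by (simp add: power2_eq_square)
    then show False using rr tt by linarith
  qed
  moreover have "j\<^sup>2 * v \<tau> = v \<tau>" if "solves s v" for v
  proof -
    have "slash A v \<tau> = v \<tau>" using assms that Im by (simp add: acts_trivially_def)
    then show ?thesis by (simp only: slash_def j_def fixp)
  qed
  \<comment> \<open>This is impossible: \<open>v0\<close> vanishes only at poles of h, and there
    \<open>v2\<close> does not.\<close>
  ultimately have "v0 \<tau> = 0" "v2 \<tau> = 0" using v0 v2 by auto
  then show False using at_pole[OF Im] at_regular[OF Im] by blast
qed

end

section \<open>The bound on the level\<close>

definition mat2 :: "int \<Rightarrow> int \<Rightarrow> int \<Rightarrow> int \<Rightarrow> int^2^2" where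
  "mat2 a b c d = vector [vector [a, b], vector [c, d]]"

lemma mat2_nth [simp]:
  "mat2 a b c d $ 1 $ 1 = a" "mat2 a b c d $ 1 $ 2 = b" "mat2 a b c d $ 2 $ 1 = c" "mat2 a b c d $ 2 $ 2 = d"
  by (simp_all add: mat2_def)

lemma mat2_SL2Z [simp]: "mat2 a b c d \<in> carrier SL2Z \<longleftrightarrow> a * d - b * c = 1"
  by (simp add: SL2Z_det)

section \<open>Reduction to a box and the vanishing of modular functions\<close>

lemma upper_half_plane_reduction_Re:
  assumes "Im \<tau> > 0"
  shows "\<exists>A\<in>carrier SL2Z. \<bar>Re (moebius A \<tau>)\<bar> \<le> 1/2 \<and> Im (moebius A \<tau>) = Im \<tau>"
proof (rule bexI)
  define n where "n = - round (Re \<tau>)"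
  have "moebius (mat2 1 n 0 1) \<tau> = \<tau> + of_int n" by (simp add: moebius_def)
  then show "\<bar>Re (moebius (mat2 1 n 0 1) \<tau>)\<bar> \<le> 1/2 \<and> Im (moebius (mat2 1 n 0 1) \<tau>) = Im \<tau>"
    using of_int_round_abs_le[of "Re \<tau>"] by (simp add: n_def abs_minus_commute)
qed simp

text \<open>A box larger than the fundamental domain is enough here. If |Re z| \<le> 1/2 and Im z <
  1/2, then |z|^2 \<le> 1/2, and the inversion z \<mapsto> -1/z at least doubles the imaginary part;
  k bounds the number of doublings.\<close>

lemma upper_half_plane_reduction:
  assumes "Im \<tau> > 0"
  obtains A where "A \<in> carrier SL2Z" "\<bar>Re (moebius A \<tau>)\<bar> \<le> 1/2" "1/2 \<le> Im (moebius A \<tau>)"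
proof -
  have *: "\<exists>A\<in>carrier SL2Z. \<bar>Re (moebius A \<tau>)\<bar> \<le> 1/2 \<and> 1/2 \<le> Im (moebius A \<tau>)"
    if "Im \<tau> > 0" "1/2 \<le> Im \<tau> * 2 ^ k" for k :: nat and \<tau>
    using that
  proof (induction k arbitrary: \<tau>)
    case 0
    then show ?case using upper_half_plane_reduction_Re[of \<tau>] by auto
  next
    case (Suc k)
    obtain A where A: "A \<in> carrier SL2Z" "\<bar>Re (moebius A \<tau>)\<bar> \<le> 1/2" "Im (moebius A \<tau>) = Im \<tau>"
      using upper_half_plane_reduction_Re[OF Suc.prems(1)] by blast
    define z where "z = moebius A \<tau>"
    show ?case
    proof (cases "1/2 \<le> Im z")
      case True then show ?thesis using A by (auto simp: z_def)
    next
      case False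
      have z: "Im z > 0" using A(3) Suc.prems(1) by (simp add: z_def)
      let ?S = "mat2 0 (-1) 1 0"
      have "(norm z)\<^sup>2 = (Re z)\<^sup>2 + (Im z)\<^sup>2" by (rule cmod_power2)
      moreover have "(Re z)\<^sup>2 \<le> (1/2)\<^sup>2" "(Im z)\<^sup>2 \<le> (1/2)\<^sup>2"
        unfolding abs_le_square_iff [symmetric] using A(2) False z by (simp_all add: z_def)
      ultimately have "(norm z)\<^sup>2 \<le> 1/2" by (simp add: power2_eq_square)
      moreover have "z \<noteq> 0" using z by auto
      then have "(norm z)\<^sup>2 > 0" by simp
      moreover have "Im (moebius ?S z) = Im z / (norm z)\<^sup>2"
        using Im_moebius[of ?S z] z by (simp add: aut_factor_def)
      ultimately have "2 * Im z \<le> Im (moebius ?S z)"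
        using z mult_left_mono[of "(norm z)\<^sup>2" "1/2" "2 * Im z"] by (simp add: pos_le_divide_eq)
      moreover have "1/2 \<le> 2 * Im z * 2 ^ k" using Suc.prems(2) A(3) by (simp add: z_def mult_ac)
      ultimately have "1/2 \<le> Im (moebius ?S z) * 2 ^ k"
        by (meson mult_right_mono order_trans zero_le_numeral zero_le_power)
      moreover have "Im (moebius ?S z) > 0" by (rule Im_moebius_pos) (use z in auto)
      ultimately obtain B where B: "B \<in> carrier SL2Z" "\<bar>Re (moebius B (moebius ?S z))\<bar> \<le> 1/2"
          "1/2 \<le> Im (moebius B (moebius ?S z))"
        using Suc.IH by blast
      have S: "?S \<in> carrier SL2Z" by simp
      have "moebius (B ** (?S ** A)) \<tau> = moebius B (moebius ?S z)"
        unfolding z_def using A(1) B(1) S Suc.prems(1) by (simp add: moebius_mult SL2Z_mult Im_moebius_pos)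
      then show ?thesis using B A(1) S SL2Z_mult by metis
    qed
  qed
  obtain k where "1 / (2 * Im \<tau>) < 2 ^ k" using real_arch_pow[of 2] by auto
  then have "1/2 \<le> Im \<tau> * 2 ^ k" using assms by (simp add: divide_less_eq mult_ac)
  then show ?thesis using *[OF assms] that by blast
qed

text \<open>If the value at p were nonzero, then above some height Y the modulus stays below it.
  Every orbit has a point in the compact box \<open>K\<close> or above that height, so the maximum
  over the half-plane is attained in \<open>K\<close>. The maximum principle makes the function
  constant, equal to its limit 0.\<close>

lemma invariant_holomorphic_eq_0:
  assumes hol: "G holomorphic_on upper_half_plane"
    and inv: "\<And>A \<tau>. A \<in> carrier SL2Z \<Longrightarrow> Im \<tau> > 0 \<Longrightarrow> G (moebius A \<tau>) = G \<tau>"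
    and lim: "(G \<longlongrightarrow> 0) im_infinity" and p: "Im p > 0"
  shows "G p = 0"
proof (rule ccontr)
  assume "G p \<noteq> 0"
  then have "\<forall>\<^sub>F \<tau> in im_infinity. dist (G \<tau>) 0 < norm (G p)" using lim by (intro tendstoD) auto
  then obtain P where P: "eventually P at_top" "\<And>\<tau>. P (Im \<tau>) \<Longrightarrow> norm (G \<tau>) < norm (G p)"
    by (auto simp: eventually_filtercomap)
  then obtain Y where "\<And>y. y \<ge> Y \<Longrightarrow> P y" by (auto simp: eventually_at_top_linorder)
  then have Y: "norm (G \<tau>) < norm (G p)" if "Im \<tau> \<ge> Y" for \<tau> using that P(2) by blast
  define K where "K = cbox (Complex (-1/2) (1/2)) (Complex (1/2) Y)"
  have K_iff: "z \<in> K \<longleftrightarrow> \<bar>Re z\<bar> \<le> 1/2 \<and> 1/2 \<le> Im z \<and> Im z \<le> Y" for z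
    by (auto simp: K_def in_cbox_complex_iff)
  have K_sub: "K \<subseteq> upper_half_plane" by (auto simp: K_iff)
  have red: "\<exists>z. Im z > 0 \<and> G z = G \<tau> \<and> (z \<in> K \<or> norm (G z) < norm (G p))" if \<tau>: "Im \<tau> > 0" for \<tau>
  proof -
    obtain A where A: "A \<in> carrier SL2Z" "\<bar>Re (moebius A \<tau>)\<bar> \<le> 1/2" "1/2 \<le> Im (moebius A \<tau>)"
      using upper_half_plane_reduction[OF \<tau>] .
    show ?thesis
      using A Y[of "moebius A \<tau>"] inv[OF A(1) \<tau>]
      by (intro exI[of _ "moebius A \<tau>"]) (cases "Y \<le> Im (moebius A \<tau>)"; auto simp: K_iff)
  qed
  obtain p' where p': "p' \<in> K" "G p' = G p" using red[OF p] by auto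
  have "\<exists>z\<in>K. \<forall>y\<in>K. norm (G y) \<le> norm (G z)"
  proof (rule continuous_attains_sup)
    show "compact K" "K \<noteq> {}" using p' by (auto simp: K_def)
    show "continuous_on K (\<lambda>z. norm (G z))"
      using holomorphic_on_imp_continuous_on[OF hol] K_sub
      by (intro continuous_on_norm) (rule continuous_on_subset)
  qed
  then obtain z where z: "z \<in> K" "\<And>y. y \<in> K \<Longrightarrow> norm (G y) \<le> norm (G z)" by blast
  have "G constant_on upper_half_plane"
  proof (rule maximum_modulus_principle[OF hol open_upper_half_plane connected_upper_half_plane open_upper_half_plane order_refl])
    show "z \<in> upper_half_plane" using z(1) K_sub by blast
    fix \<tau> assume "\<tau> \<in> upper_half_plane"
    then obtain w where "G w = G \<tau>" "w \<in> K \<or> norm (G w) < norm (G p)" using red[of \<tau>] by auto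
    moreover have "norm (G p) \<le> norm (G z)" using z(2)[OF p'(1)] p'(2) by simp
    ultimately show "norm (G \<tau>) \<le> norm (G z)" using z(2)[of w] by auto
  qed
  then obtain c where c: "\<And>\<tau>. Im \<tau> > 0 \<Longrightarrow> G \<tau> = c" by (auto simp: constant_on_def)
  have "\<forall>\<^sub>F \<tau> in im_infinity. G \<tau> = c"
    using eventually_im_infinity[of 0] by (rule eventually_mono) (rule c)
  then have "(G \<longlongrightarrow> c) im_infinity" by (rule tendsto_eventually)
  from tendsto_unique[OF im_infinity_nontrivial this lim] c[OF p] \<open>G p \<noteq> 0\<close> show False by simp
qed

lemma tendsto_cong_im_infinity:
  assumes "(f \<longlongrightarrow> l) im_infinity" "\<And>\<tau>. Im \<tau> > c \<Longrightarrow> f \<tau> = g \<tau>"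
  shows "(g \<longlongrightarrow> l) im_infinity"
  using assms(1) by (rule Lim_transform_eventually)
    (use eventually_im_infinity[of c] in \<open>rule eventually_mono, simp add: assms(2)\<close>)

section \<open>Growth of the solutions at \<infinity>\<close>

context schwarz_basis
begin

text \<open>The zero of h being simple, h' is q times a function with nonzero limit, where q is the
  local parameter. So v0 = 1/h' has growth 1/q, and v1 and v2 differ from it by the bounded factors
  h and h^2.\<close>

lemma solution_im_infinity:
  assumes zero: "simple_zero_at_infinity m h" and m: "m > 0" and v: "solves s v"
  shows "\<exists>L. ((\<lambda>\<tau>. exp (2 * of_real pi * \<i> * \<tau> / of_nat m) * v \<tau>) \<longlongrightarrow> L) im_infinity"
proof -
  obtain f c where f: "f analytic_on {0}" "f 0 = 0" "deriv f 0 \<noteq> 0"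
    and hf: "\<And>\<tau>. Im \<tau> > 0 \<Longrightarrow> c < Im \<tau> \<Longrightarrow> h \<tau> = f (exp (2 * of_real pi * \<i> * \<tau> / of_nat m))"
    using zero unfolding simple_zero_at_infinity_def Ball_def upper_half_plane_iff by blast
  define q where "q = (\<lambda>\<tau>. exp (2 * of_real pi * \<i> * \<tau> / of_nat m))"
  define k where "k = 2 * of_real pi * \<i> / (of_nat m :: complex)"
  have k: "k \<noteq> 0" using m by (simp add: k_def)
  have Dq: "(q has_field_derivative k * q \<tau>) (at \<tau>)" for \<tau>
    unfolding q_def k_def using m by (auto intro!: derivative_eq_intros)
  have limq: "(q \<longlongrightarrow> 0) im_infinity" using tendsto_q_im_infinity[of "real m"] m by (simp add: q_def)
  obtain r where r: "r > 0" "f holomorphic_on ball 0 r"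
    using f(1) by (auto simp: analytic_on_def)
  have "\<forall>\<^sub>F \<tau> in im_infinity. dist (q \<tau>) 0 < r" using limq r(1) by (rule tendstoD)
  then obtain P where P: "eventually P at_top" "\<And>\<tau>. P (Im \<tau>) \<Longrightarrow> norm (q \<tau>) < r"
    by (auto simp: eventually_filtercomap)
  then obtain Y where "\<And>y. y \<ge> Y \<Longrightarrow> P y" by (auto simp: eventually_at_top_linorder)
  then have Y: "norm (q \<tau>) < r" if "Im \<tau> \<ge> Y" for \<tau> using that P(2) by blast
  define C where "C = max 0 (max c Y)"
  have C: "Im \<tau> > 0" "Im \<tau> > c" "norm (q \<tau>) < r" if "Im \<tau> > C" for \<tau>
    using that Y[of \<tau>] by (auto simp: C_def)
  have opC: "open {\<tau>. Im \<tau> > C}" by (rule open_halfspace_Im_gt)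
  have main: "\<not> is_pole h \<tau> \<and> 1 / v0 \<tau> = deriv f (q \<tau>) * (k * q \<tau>)" if \<tau>: "Im \<tau> > C" for \<tau>
  proof -
    have Df: "(f has_field_derivative deriv f (q \<tau>)) (at (q \<tau>))"
      using r C(3)[OF \<tau>] by (intro holomorphic_derivI[of _ "ball 0 r"]) auto
    have D: "(h has_field_derivative deriv f (q \<tau>) * (k * q \<tau>)) (at \<tau>)"
    proof (rule has_field_derivative_transform_within_open[OF DERIV_chain2[OF Df Dq] opC])
      fix x assume "x \<in> {\<tau>. C < Im \<tau>}"
      then show "f (q x) = h x" using hf[of x] C[of x] by (simp add: q_def)
    qed (use \<tau> in auto)
    have np: "\<not> is_pole h \<tau>"
      using DERIV_isCont[OF D] unfolding isCont_def is_pole_def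
      using not_tendsto_and_filterlim_at_infinity[OF trivial_limit_at] by blast
    from DERIV_unique[OF has_deriv[OF C(1)[OF \<tau>] np] D] np show ?thesis by simp
  qed
  have cont: "isCont f 0" "isCont (deriv f) 0"
    using f(1) by (auto intro!: analytic_at_imp_isCont analytic_deriv)
  have L0: "((\<lambda>\<tau>. q \<tau> * v0 \<tau>) \<longlongrightarrow> 1 / (deriv f 0 * k)) im_infinity"
  proof (rule tendsto_cong_im_infinity[of "\<lambda>\<tau>. 1 / (deriv f (q \<tau>) * k)" _ C])
    show "((\<lambda>\<tau>. 1 / (deriv f (q \<tau>) * k)) \<longlongrightarrow> 1 / (deriv f 0 * k)) im_infinity"
      using f(3) k by (intro tendsto_intros isCont_tendsto_compose[OF cont(2) limq]) auto
    fix \<tau> assume \<tau>: "Im \<tau> > C"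
    have "v0 \<tau> \<noteq> 0" using at_regular[of \<tau>] main[OF \<tau>] C(1)[OF \<tau>] by blast
    moreover have "q \<tau> \<noteq> 0" by (simp add: q_def)
    moreover have "v0 \<tau> = 1 / (deriv f (q \<tau>) * (k * q \<tau>))" using main[OF \<tau>] by (metis divide_divide_eq_right div_by_1 mult_1)
    ultimately show "1 / (deriv f (q \<tau>) * k) = q \<tau> * v0 \<tau>" by simp
  qed
  have fq: "h \<tau> = f (q \<tau>)" "v1 \<tau> = h \<tau> * v0 \<tau>" "v2 \<tau> = (h \<tau>)\<^sup>2 * v0 \<tau>" if "Im \<tau> > C" for \<tau>
    using hf[of \<tau>] C[OF that] at_regular[of \<tau>] main[OF that] by (simp_all add: q_def)
  have limf: "((\<lambda>\<tau>. f (q \<tau>)) \<longlongrightarrow> f 0) im_infinity"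
    by (rule isCont_tendsto_compose[OF cont(1) limq])
  have L1: "((\<lambda>\<tau>. q \<tau> * v1 \<tau>) \<longlongrightarrow> f 0 * (1 / (deriv f 0 * k))) im_infinity"
    by (rule tendsto_cong_im_infinity[OF tendsto_mult[OF limf L0], of C]) (simp add: fq)
  have L2: "((\<lambda>\<tau>. q \<tau> * v2 \<tau>) \<longlongrightarrow> (f 0)\<^sup>2 * (1 / (deriv f 0 * k))) im_infinity"
    by (rule tendsto_cong_im_infinity[OF tendsto_mult[OF tendsto_power[OF limf] L0], of C]) (simp add: fq)
  obtain x y z where xyz: "\<And>\<tau>. Im \<tau> > 0 \<Longrightarrow> v \<tau> = x * v0 \<tau> + y * v1 \<tau> + z * v2 \<tau>"
    using solution_span[OF v] by blast
  have "((\<lambda>\<tau>. x * (q \<tau> * v0 \<tau>) + y * (q \<tau> * v1 \<tau>) + z * (q \<tau> * v2 \<tau>)) \<longlongrightarrow>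
     x * (1 / (deriv f 0 * k)) + y * (f 0 * (1 / (deriv f 0 * k))) + z * ((f 0)\<^sup>2 * (1 / (deriv f 0 * k)))) im_infinity"
    by (intro tendsto_intros L0 L1 L2)
  then have "((\<lambda>\<tau>. q \<tau> * v \<tau>) \<longlongrightarrow>
     x * (1 / (deriv f 0 * k)) + y * (f 0 * (1 / (deriv f 0 * k))) + z * ((f 0)\<^sup>2 * (1 / (deriv f 0 * k)))) im_infinity"
    by (rule tendsto_cong_im_infinity[of _ _ 0]) (simp add: xyz algebra_simps)
  then show ?thesis unfolding q_def by blast
qed

end

section \<open>The product over the orbit of a solution\<close>

context schwarz_basis
begin

text \<open>The function (h - h \<tau>0) v0 vanishes at \<tau>0, and not identically because h' is
  nonzero at \<tau>0.\<close>

lemma solution_with_zero: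
  obtains u \<tau>0 \<tau>1 where "solves s u" "Im \<tau>0 > 0" "u \<tau>0 = 0" "Im \<tau>1 > 0" "u \<tau>1 \<noteq> 0"
proof -
  obtain \<tau>0 where \<tau>0: "\<tau>0 \<in> regular" using regular_nonempty .
  then have Im0: "Im \<tau>0 > 0" by (simp add: regular_def)
  define u where "u = (\<lambda>\<tau>. 1 * v1 \<tau> + (- h \<tau>0) * v0 \<tau>)"
  have u_eq: "u \<tau> = (h \<tau> - h \<tau>0) * v0 \<tau>" "v0 \<tau> \<noteq> 0" if "\<tau> \<in> regular" for \<tau>
    using at_regular[of \<tau>] that by (simp_all add: u_def regular_def algebra_simps)
  have "\<exists>\<tau>1. Im \<tau>1 > 0 \<and> u \<tau>1 \<noteq> 0"
  proof (rule ccontr)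
    assume "\<not> ?thesis"
    then have const: "h \<tau> = h \<tau>0" if "\<tau> \<in> regular" for \<tau>
      using u_eq[OF that] that by (auto simp: regular_def)
    have "1 / v0 \<tau>0 = 0"
    proof (rule DERIV_eq_on_open[of h _ \<tau>0 "\<lambda>_. h \<tau>0" _ regular])
      show "(h has_field_derivative 1 / v0 \<tau>0) (at \<tau>0)" using has_deriv[of \<tau>0] \<tau>0 by (simp add: regular_def)
      show "h w = h \<tau>0" if "w \<in> regular" for w by (rule const[OF that])
    qed (simp_all add: \<tau>0 open_regular)
    then show False using u_eq(2)[OF \<tau>0] by simp
  qed
  moreover have "solves s u" unfolding u_def by (intro solves_lincomb v0 v1)
  moreover have "u \<tau>0 = 0" using u_eq(1)[OF \<tau>0] by simp
  ultimately show ?thesis using that Im0 by blast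
qed

text \<open>Without a fixed value off the half-plane, functions with equal restrictions would count
  as different orbit elements, and neither the finiteness of the orbit nor its permutation by the
  group could be stated for sets of total functions.\<close>

definition zero_ext :: "(complex \<Rightarrow> complex) \<Rightarrow> complex \<Rightarrow> complex" where
  "zero_ext v = (\<lambda>\<tau>. if Im \<tau> > 0 then v \<tau> else 0)"

lemma slash_zero_ext:
  "A \<in> carrier SL2Z \<Longrightarrow> zero_ext (slash A (zero_ext v)) = zero_ext (slash A v)"
  by (auto simp: zero_ext_def fun_eq_iff slash_def Im_moebius_pos)

lemma zero_ext_slash_mult:
  "A \<in> carrier SL2Z \<Longrightarrow> B \<in> carrier SL2Z \<Longrightarrow> zero_ext (slash B (slash A v)) = zero_ext (slash (A ** B) v)"
  by (auto simp: zero_ext_def fun_eq_iff slash_mult)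

text \<open>As \<open>slash\<close> is a right action with \<Gamma> acting trivially, the image of u
  under A depends only on the right coset \<Gamma> A.\<close>

lemma finite_orbit:
  assumes fin: "finite (rcosets\<^bsub>SL2Z\<^esub> (invariance_group h))" and u: "solves s u"
  shows "finite ((\<lambda>A. zero_ext (slash A u)) ` carrier SL2Z)"
proof (rule finite_subset)
  let ?f = "\<lambda>C. zero_ext (slash (SOME B. B \<in> C) u)"
  show "finite (?f ` (rcosets\<^bsub>SL2Z\<^esub> (invariance_group h)))" using fin by (rule finite_imageI)
  show "(\<lambda>A. zero_ext (slash A u)) ` carrier SL2Z \<subseteq> ?f ` (rcosets\<^bsub>SL2Z\<^esub> (invariance_group h))"
  proof
    fix w assume "w \<in> (\<lambda>A. zero_ext (slash A u)) ` carrier SL2Z"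
    then obtain A where A: "A \<in> carrier SL2Z" "w = zero_ext (slash A u)" by blast
    define C where "C = invariance_group h #>\<^bsub>SL2Z\<^esub> A"
    have "mat 1 \<in> invariance_group h" by (simp add: invariance_group_def)
    then have "A \<in> C" by (auto simp: C_def r_coset_def intro: bexI[of _ "mat 1"])
    then have "(SOME B. B \<in> C) \<in> C" by (rule someI)
    then obtain g where g: "g \<in> invariance_group h" "(SOME B. B \<in> C) = g ** A"
      by (auto simp: C_def r_coset_def)
    then have gt: "acts_trivially s g" by (simp add: invariance_group_iff)
    then have g': "g \<in> carrier SL2Z" by (simp add: acts_trivially_def)
    have "zero_ext (slash (g ** A) u) = zero_ext (slash A (slash g u))"
      by (rule zero_ext_slash_mult[OF g' A(1), symmetric])
    also have "\<dots> = zero_ext (slash A (zero_ext (slash g u)))" by (rule slash_zero_ext[OF A(1), symmetric])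
    also have "zero_ext (slash g u) = zero_ext u"
      using gt u by (auto simp: acts_trivially_def zero_ext_def fun_eq_iff)
    also have "zero_ext (slash A (zero_ext u)) = w" using A by (simp add: slash_zero_ext)
    finally have "w = ?f C" by (simp add: g(2))
    moreover have "C \<in> rcosets\<^bsub>SL2Z\<^esub> (invariance_group h)"
      using A(1) by (auto simp: C_def RCOSETS_def)
    ultimately show "w \<in> ?f ` (rcosets\<^bsub>SL2Z\<^esub> (invariance_group h))" by blast
  qed
qed

text \<open>The sixth power of the solution costs at most 6/m powers of q and the cusp form supplies
  one. The remaining q^(1 - 6/m) has a limit because m \<ge> 6.\<close>

lemma tendsto_solution_power_cusp_form12:
  assumes zero: "simple_zero_at_infinity m h" and m: "m \<ge> 6" and v: "solves s v"
  shows "\<exists>L. ((\<lambda>\<tau>. v \<tau> ^ 6 * cusp_form12 \<tau>) \<longlongrightarrow> L) im_infinity"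
proof -
  define q where "q = (\<lambda>\<tau>. exp (2 * of_real pi * \<i> * \<tau> / of_nat m))"
  define Q where "Q = (\<lambda>\<tau>. exp (2 * of_real pi * \<i> * \<tau>))"
  obtain L where L: "((\<lambda>\<tau>. q \<tau> * v \<tau>) \<longlongrightarrow> L) im_infinity"
    using solution_im_infinity[OF zero _ v] m by (auto simp: q_def)
  obtain M where M: "((\<lambda>\<tau>. cusp_form12 \<tau> / Q \<tau>) \<longlongrightarrow> M) im_infinity"
    using cusp_form12_im_infinity unfolding Q_def by blast
  have "\<exists>N. ((\<lambda>\<tau>. Q \<tau> / q \<tau> ^ 6) \<longlongrightarrow> N) im_infinity"
  proof (cases "m = 6")
    case True
    have "Q \<tau> / q \<tau> ^ 6 = 1" for \<tau>
      by (simp add: Q_def q_def True mult_ac flip: exp_of_nat_mult)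
    then show ?thesis by auto
  next
    case False
    \<comment> \<open>The width for which q^(1 - 6/m) is exp(2 pi i \<tau>/m').\<close>
    define m' where "m' = real m / (real m - 6)"
    have m': "m' > 0" using m False by (simp add: m'_def)
    have "Q \<tau> / q \<tau> ^ 6 = exp (2 * of_real pi * \<i> * \<tau> / of_real m')" for \<tau>
    proof -
      have "2 * of_real pi * \<i> * \<tau> - 6 * (2 * of_real pi * \<i> * \<tau> / of_nat m) = 2 * of_real pi * \<i> * \<tau> / of_real m'"
        using m False by (simp add: m'_def divide_simps) (simp add: algebra_simps)
      then show ?thesis by (simp add: Q_def q_def flip: exp_of_nat_mult exp_diff)
    qed
    then show ?thesis using tendsto_q_im_infinity[OF m'] by auto
  qed
  then obtain N where N: "((\<lambda>\<tau>. Q \<tau> / q \<tau> ^ 6) \<longlongrightarrow> N) im_infinity" by blast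
  have "(q \<tau> * v \<tau>) ^ 6 * (cusp_form12 \<tau> / Q \<tau>) * (Q \<tau> / q \<tau> ^ 6) = v \<tau> ^ 6 * cusp_form12 \<tau>" for \<tau>
    by (simp add: Q_def q_def power_mult_distrib)
  moreover have "((\<lambda>\<tau>. (q \<tau> * v \<tau>) ^ 6 * (cusp_form12 \<tau> / Q \<tau>) * (Q \<tau> / q \<tau> ^ 6)) \<longlongrightarrow> L ^ 6 * M * N) im_infinity"
    by (intro tendsto_intros L M N)
  ultimately show ?thesis by auto
qed

lemma cusp_form12_nonzero: obtains \<tau> where "Im \<tau> > 0" "cusp_form12 \<tau> \<noteq> 0"
proof -
  obtain L where L: "L \<noteq> 0" "((\<lambda>\<tau>. cusp_form12 \<tau> / exp (2 * of_real pi * \<i> * \<tau>)) \<longlongrightarrow> L) im_infinity"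
    by (rule cusp_form12_im_infinity)
  have "\<forall>\<^sub>F \<tau> in im_infinity. cusp_form12 \<tau> / exp (2 * of_real pi * \<i> * \<tau>) \<noteq> 0 \<and> Im \<tau> > 0"
    using tendsto_imp_eventually_ne[OF L(2,1)] eventually_im_infinity[of 0] by eventually_elim simp
  from eventually_happens'[OF im_infinity_nontrivial this] show ?thesis using that by auto
qed

lemma level_less_6:
  assumes fin: "finite (rcosets\<^bsub>SL2Z\<^esub> (invariance_group h))" and zero: "simple_zero_at_infinity m h"
  shows "m < 6"
proof (rule ccontr)
  assume "\<not> m < 6"
  then have m: "m \<ge> 6" by simp
  obtain u \<tau>0 \<tau>1 where u: "solves s u" "Im \<tau>0 > 0" "u \<tau>0 = 0" "Im \<tau>1 > 0" "u \<tau>1 \<noteq> 0"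
    by (rule solution_with_zero)
  define W where "W = (\<lambda>A. zero_ext (slash A u)) ` carrier SL2Z"
  have finW: "finite W" unfolding W_def by (rule finite_orbit[OF fin u(1)])
  \<comment> \<open>Each factor has weight 6 (-2) + 12 = 0 but is permuted with the others by the
    group; only the product over \<open>W\<close> is invariant.\<close>
  define F where "F = (\<lambda>\<tau>. \<Prod>w\<in>W. w \<tau> ^ 6 * cusp_form12 \<tau>)"
  have W_eq: "\<exists>v. solves s v \<and> (\<forall>\<tau>. Im \<tau> > 0 \<longrightarrow> w \<tau> = v \<tau>)" if w: "w \<in> W" for w
  proof -
    obtain A where "A \<in> carrier SL2Z" "w = zero_ext (slash A u)" using w by (auto simp: W_def)
    then show ?thesis using solves_slash[OF u(1)] by (intro exI[of _ "slash A u"]) (simp add: zero_ext_def)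
  qed
  have holW: "w holomorphic_on upper_half_plane" if w: "w \<in> W" for w
  proof -
    obtain v where v: "solves s v" "\<And>\<tau>. Im \<tau> > 0 \<Longrightarrow> w \<tau> = v \<tau>" using W_eq[OF w] by blast
    then have "v holomorphic_on upper_half_plane" by (simp add: solves_def)
    then show ?thesis by (rule holomorphic_transform) (simp add: v(2))
  qed
  have holF: "F holomorphic_on upper_half_plane"
    unfolding F_def by (intro holomorphic_intros holW cusp_form12_holomorphic)
  have bij: "bij_betw (\<lambda>w. zero_ext (slash B w)) W W" if B: "B \<in> carrier SL2Z" for B
  proof -
    obtain C where C: "C \<in> carrier SL2Z" "B ** C = mat 1" "C ** B = mat 1"
      using SL2Z_inverse[OF B] by blast
    have act: "zero_ext (slash E (zero_ext (slash A u))) = zero_ext (slash (A ** E) u)"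
      if "A \<in> carrier SL2Z" "E \<in> carrier SL2Z" for A E
      using that by (simp add: slash_zero_ext zero_ext_slash_mult)
    show ?thesis
    proof (rule bij_betwI[where g = "\<lambda>w. zero_ext (slash C w)"])
      show "(\<lambda>w. zero_ext (slash B w)) \<in> W \<rightarrow> W" "(\<lambda>w. zero_ext (slash C w)) \<in> W \<rightarrow> W"
        using B C(1) by (auto simp: W_def act SL2Z_mult)
      fix w assume "w \<in> W"
      then obtain A where A: "A \<in> carrier SL2Z" "w = zero_ext (slash A u)" by (auto simp: W_def)
      have "A ** B ** C = A" "A ** C ** B = A"
        using C by (simp_all flip: matrix_mul_assoc)
      then show "zero_ext (slash C (zero_ext (slash B w))) = w" "zero_ext (slash B (zero_ext (slash C w))) = w"
        using A B C(1) by (simp_all add: act SL2Z_mult)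
    qed
  qed
  have inv: "F (moebius B \<tau>) = F \<tau>" if B: "B \<in> carrier SL2Z" and \<tau>: "Im \<tau> > 0" for B \<tau>
  proof -
    have "w (moebius B \<tau>) ^ 6 * cusp_form12 (moebius B \<tau>) = zero_ext (slash B w) \<tau> ^ 6 * cusp_form12 \<tau>" for w
      using \<tau> by (simp add: cusp_form12_moebius[OF B \<tau>] zero_ext_def slash_def power_mult_distrib flip: power_mult)
    then have "F (moebius B \<tau>) = (\<Prod>w\<in>W. zero_ext (slash B w) \<tau> ^ 6 * cusp_form12 \<tau>)"
      by (simp add: F_def)
    also have "\<dots> = F \<tau>" unfolding F_def by (rule prod.reindex_bij_betw[OF bij[OF B]])
    finally show ?thesis .
  qed
  have "\<exists>L. ((\<lambda>\<tau>. w \<tau> ^ 6 * cusp_form12 \<tau>) \<longlongrightarrow> L) im_infinity" if w: "w \<in> W" for w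
  proof -
    obtain v where v: "solves s v" "\<And>\<tau>. Im \<tau> > 0 \<Longrightarrow> w \<tau> = v \<tau>" using W_eq[OF w] by blast
    obtain L where "((\<lambda>\<tau>. v \<tau> ^ 6 * cusp_form12 \<tau>) \<longlongrightarrow> L) im_infinity"
      using tendsto_solution_power_cusp_form12[OF zero m v(1)] by blast
    then have "((\<lambda>\<tau>. w \<tau> ^ 6 * cusp_form12 \<tau>) \<longlongrightarrow> L) im_infinity"
      by (rule tendsto_cong_im_infinity[of _ _ 0]) (simp add: v(2))
    then show ?thesis by blast
  qed
  then obtain L where "\<And>w. w \<in> W \<Longrightarrow> ((\<lambda>\<tau>. w \<tau> ^ 6 * cusp_form12 \<tau>) \<longlongrightarrow> L w) im_infinity" by metis
  then have "(F \<longlongrightarrow> (\<Prod>w\<in>W. L w)) im_infinity" unfolding F_def by (rule tendsto_prod)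
  then have lim: "((\<lambda>\<tau>. F \<tau> - (\<Prod>w\<in>W. L w)) \<longlongrightarrow> 0) im_infinity" by (simp add: LIM_zero_iff)
  have const: "F \<tau> = (\<Prod>w\<in>W. L w)" if "Im \<tau> > 0" for \<tau>
    using invariant_holomorphic_eq_0[OF holomorphic_on_diff[OF holF holomorphic_on_const] _ lim that] inv by simp
  have "zero_ext u \<in> W" unfolding W_def by (rule image_eqI[of _ _ "mat 1"]) simp_all
  then have "F \<tau>0 = 0" unfolding F_def using finW u by (auto simp: prod_zero_iff zero_ext_def intro!: bexI[of _ "zero_ext u"])
  then have F0: "F \<tau> = 0" if "Im \<tau> > 0" for \<tau> using const[OF that] const[OF u(2)] by simp
  have nzW: "\<exists>\<tau>. Im \<tau> > 0 \<and> w \<tau> \<noteq> 0" if w: "w \<in> W" for w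
  proof -
    obtain A where A: "A \<in> carrier SL2Z" "w = zero_ext (slash A u)" using w by (auto simp: W_def)
    obtain C where C: "C \<in> carrier SL2Z" "A ** C = mat 1" using SL2Z_inverse[OF A(1)] by blast
    have M: "Im (moebius C \<tau>1) > 0" by (rule Im_moebius_pos[OF C(1) u(4)])
    have "moebius A (moebius C \<tau>1) = \<tau>1" using moebius_mult[OF A(1) C(1) u(4)] by (simp add: C(2))
    then have "w (moebius C \<tau>1) \<noteq> 0"
      using u(5) M aut_factor_nonzero[OF A(1) M] by (simp add: A(2) zero_ext_def slash_def)
    then show ?thesis using M by blast
  qed
  obtain \<tau>2 where \<tau>2: "Im \<tau>2 > 0" "cusp_form12 \<tau>2 \<noteq> 0" by (rule cusp_form12_nonzero)
  \<comment> \<open>Finitely many holomorphic functions, none identically zero, have no zeros in a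
    punctured neighbourhood of the point i of the half-plane, so F cannot be identically 0.\<close>
  have "\<forall>\<^sub>F \<tau> in at \<i>. \<forall>w\<in>W. w \<tau> \<noteq> 0"
  proof (intro eventually_ball_finite finW ballI)
    fix w assume w: "w \<in> W"
    obtain \<beta> where "Im \<beta> > 0" "w \<beta> \<noteq> 0" using nzW[OF w] by blast
    then have "\<forall>\<^sub>F \<tau> in at \<i>. w \<tau> \<noteq> 0 \<and> \<tau> \<in> upper_half_plane"
      by (intro non_zero_neighbour_alt[OF holW[OF w] open_upper_half_plane connected_upper_half_plane, of _ \<beta>]) auto
    then show "\<forall>\<^sub>F \<tau> in at \<i>. w \<tau> \<noteq> 0" by (rule eventually_mono) simp
  qed
  moreover have "\<forall>\<^sub>F \<tau> in at \<i>. cusp_form12 \<tau> \<noteq> 0 \<and> \<tau> \<in> upper_half_plane"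
    using \<tau>2 by (intro non_zero_neighbour_alt[OF cusp_form12_holomorphic open_upper_half_plane connected_upper_half_plane, of _ \<tau>2]) auto
  ultimately have "\<forall>\<^sub>F \<tau> in at \<i>. F \<tau> \<noteq> 0 \<and> Im \<tau> > 0"
    by eventually_elim (simp add: F_def finW)
  from eventually_happens'[OF trivial_limit_at this] F0 show False by blast
qed

end

section \<open>The main theorem\<close>

lemma mat2_eta: "mat2 (A$1$1) (A$1$2) (A$2$1) (A$2$2) = A"
  by (simp add: vec_eq_iff forall_2)

lemma mat2_mult: "mat2 a b c d ** mat2 a' b' c' d' =
    mat2 (a * a' + b * c') (a * b' + b * d') (c * a' + d * c') (c * b' + d * d')"
  by (simp add: vec_eq_iff forall_2 matrix_mult_2_nth)

lemma mat2_1: "mat 1 = mat2 1 0 0 1"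
  by (simp add: vec_eq_iff forall_2 mat_def)

lemma minus_mat2: "- mat2 a b c d = mat2 (- a) (- b) (- c) (- d)"
  by (simp add: vec_eq_iff forall_2)

lemma PSL2_coset: "{mat 1, - mat 1} #>\<^bsub>SL2Z\<^esub> A = {A, - A}"
proof -
  have "- mat 1 ** A = - A"
    by (simp add: vec_eq_iff forall_2 matrix_mult_2_nth mat_def)
  then show ?thesis by (auto simp: r_coset_def)
qed

lemma principal_congruence_mat2:
  "mat2 a b c d \<in> principal_congruence m \<longleftrightarrow>
    a * d - b * c = 1 \<and> int m dvd a - 1 \<and> int m dvd b \<and> int m dvd c \<and> int m dvd d - 1"
  by (auto simp: principal_congruence_def forall_2 mat_def mod_eq_dvd_iff mod_eq_0_iff_dvd)

lemma minus_invariance_group: "A \<in> invariance_group h \<Longrightarrow> - A \<in> invariance_group h"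
proof -
  assume A: "A \<in> invariance_group h"
  have "moebius (- A) \<tau> = moebius A \<tau>" for \<tau>
  proof -
    have "moebius (- A) \<tau> = - (of_int (A$1$1) * \<tau> + of_int (A$1$2)) / - (of_int (A$2$1) * \<tau> + of_int (A$2$2))"
      by (simp add: moebius_def)
    then show ?thesis by (simp only: minus_divide_divide moebius_def)
  qed
  moreover have "- A \<in> carrier SL2Z" using A by (simp add: invariance_group_def SL2Z_det)
  ultimately show ?thesis using A by (simp add: invariance_group_def)
qed

text \<open>Pigeonhole: two of the infinitely many translations by natural numbers lie in the same
  right coset, and their difference is a translation in H.\<close>

lemma exists_translation:
  assumes fin: "finite (rcosets\<^bsub>SL2Z\<^esub> H)" and 1: "mat 1 \<in> H"
  shows "\<exists>m>0. mat2 1 (int m) 0 1 \<in> H"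
proof -
  define T where "T = (\<lambda>k. mat2 1 k 0 1)"
  have T: "T k \<in> carrier SL2Z" for k by (simp add: T_def)
  have TT: "T k ** T l = T (k + l)" for k l by (simp add: T_def mat2_mult add.commute)
  define C where "C = (\<lambda>n::nat. H #>\<^bsub>SL2Z\<^esub> T (int n))"
  have "range C \<subseteq> rcosets\<^bsub>SL2Z\<^esub> H" using T by (auto simp: C_def RCOSETS_def)
  then have "finite (range C)" using fin finite_subset by blast
  then have "\<not> inj C" using finite_imageD infinite_UNIV_nat by blast
  then obtain i j where "i \<noteq> j" "C i = C j" by (auto simp: inj_def)
  then obtain i j where ij: "i < j" "C i = C j" by (metis nat_neq_iff)
  have "T (int j) \<in> C j" using 1 by (auto simp: C_def r_coset_def intro: bexI[of _ "mat 1"])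
  then obtain g where g: "g \<in> H" "T (int j) = g ** T (int i)"
    unfolding ij(2) [symmetric] by (auto simp: C_def r_coset_def)
  have "g = g ** (T (int i) ** T (- int i))" unfolding TT by (simp add: T_def flip: mat2_1)
  also have "\<dots> = T (int j) ** T (- int i)" by (simp add: g(2) matrix_mul_assoc)
  also have "\<dots> = T (int (j - i))" unfolding TT using ij(1) by (simp add: of_nat_diff)
  finally show ?thesis using g(1) ij(1) by (intro exI[of _ "j - i"]) (simp add: T_def)
qed

theorem theorem6p6:
  fixes s :: complex and h :: "complex \<Rightarrow> complex"
  assumes "schwarz_solution s h"
    and "simple_zero_at_infinity (level (invariance_group h)) h"
    and "finite (rcosets\<^bsub>SL2Z\<^esub> (invariance_group h))"
  shows "\<exists>m\<in>{2..5}. PSL2_image (invariance_group h) = PSL2_image (principal_congruence m)"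
proof -
  obtain v0 v1 v2 where "solves s v0" "solves s v1" "solves s v2"
    "\<And>\<tau>. Im \<tau> > 0 \<Longrightarrow> is_pole h \<tau> \<Longrightarrow> v0 \<tau> = 0 \<and> v2 \<tau> \<noteq> 0"
    "\<And>\<tau>. Im \<tau> > 0 \<Longrightarrow> \<not> is_pole h \<tau> \<Longrightarrow> (h has_field_derivative 1 / v0 \<tau>) (at \<tau>)"
    "\<And>\<tau>. Im \<tau> > 0 \<Longrightarrow> \<not> is_pole h \<tau> \<Longrightarrow>
       v0 \<tau> \<noteq> 0 \<and> v1 \<tau> = h \<tau> * v0 \<tau> \<and> v2 \<tau> = (h \<tau>)\<^sup>2 * v0 \<tau>"
    using schwarz_solution_basis[OF assms(1)] by blast
  then interpret schwarz_basis s h v0 v1 v2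
    using schwarz_solution_nonpole[OF assms(1)] by unfold_locales
  define G where "G = (\<lambda>a b c d. mat2 a b c d \<in> invariance_group h)"
  define m where "m = level (invariance_group h)"
  have G_iff: "G a b c d \<longleftrightarrow> acts_trivially s (mat2 a b c d)" for a b c d
    by (simp add: G_def invariance_group_iff)
  have det: "a * d - b * c = 1" if "G a b c d" for a b c d
    using that by (simp add: G_iff acts_trivially_def)
  have mult: "G (a * a' + b * c') (a * b' + b * d') (c * a' + d * c') (c * b' + d * d')"
    if "G a b c d" "G a' b' c' d'" for a b c d a' b' c' d'
    using acts_trivially_mult that by (simp add: G_iff flip: mat2_mult)
  have conj: "G ((p * a + q * c) * s' - (p * b + q * d) * r) ((p * b + q * d) * p - (p * a + q * c) * q)
        ((r * a + s' * c) * s' - (r * b + s' * d) * r) ((r * b + s' * d) * p - (r * a + s' * c) * q)"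
    if g: "p * s' - q * r = 1" and G: "G a b c d" for p q r s' a b c d
  proof -
    have "mat2 p q r s' ** mat2 s' (- q) (- r) p = mat 1"
      using g by (simp add: mat2_mult mat2_1 algebra_simps)
    then have "acts_trivially s (mat2 p q r s' ** mat2 a b c d ** mat2 s' (- q) (- r) p)"
      using G g by (intro acts_trivially_conj) (simp_all add: G_iff algebra_simps)
    then show ?thesis by (simp add: G_iff mat2_mult algebra_simps)
  qed
  have inverse: "G d (- b) (- c) a" if "G a b c d" for a b c d
  proof -
    have "mat2 a b c d ** mat2 d (- b) (- c) a = mat 1"
      using det[OF that] by (simp add: mat2_mult mat2_1 algebra_simps)
    then show ?thesis using det[OF that] that
      by (auto simp: G_iff algebra_simps intro: acts_trivially_inverse)
  qed
  have neg: "G (- a) (- b) (- c) (- d)" if "G a b c d" for a b c d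
    using minus_invariance_group[of "mat2 a b c d"] that by (simp add: G_def minus_mat2)
  have trace: "\<bar>a + d\<bar> \<ge> 2" if "G a b c d" for a b c d
    using acts_trivially_trace[of "mat2 a b c d"] that by (simp add: G_iff)
  have level_eq: "m = (LEAST m. 0 < m \<and> G 1 (int m) 0 1)"
    by (simp add: m_def level_def G_def mat2_def)
  have G1: "G 1 0 0 1" by (simp add: G_def invariance_group_def flip: mat2_1)
  have "\<exists>m>0. G 1 (int m) 0 1"
    unfolding G_def using exists_translation[OF assms(3)] G1 by (simp add: G_def mat2_1)
  then have m: "0 < m" "G 1 (int m) 0 1"
    using LeastI_ex[of "\<lambda>m. 0 < m \<and> G 1 (int m) 0 1"] by (simp_all add: level_eq)
  have T_add: "G 1 (k + l) 0 1" if "G 1 k 0 1" "G 1 l 0 1" for k l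
    using mult[OF that] by (simp add: add.commute)
  have T_minus: "G 1 (- k) 0 1" if "G 1 k 0 1" for k using inverse[OF that] by simp
  have T_nat: "G 1 (int m * int n) 0 1" for n
  proof (induction n)
    case 0 then show ?case using G1 by simp
  next
    case (Suc n)
    from T_add[OF m(2) this] show ?case by (simp add: algebra_simps)
  qed
  have T_int: "G 1 (int m * k) 0 1" for k
    using T_nat[of "nat k"] T_minus[OF T_nat[of "nat (- k)"]] by (cases "k \<ge> 0") simp_all
  have translation: "G 1 k 0 1 \<longleftrightarrow> int m dvd k" for k
  proof
    assume "int m dvd k" then show "G 1 k 0 1" using T_int by (auto elim: dvdE)
  next
    assume k: "G 1 k 0 1"
    \<comment> \<open>The remainder of k modulo m is again a translation in the group, and m is the
      least positive one.\<close>
    define r where "r = nat (k mod int m)"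
    have r: "int r = k mod int m" "r < m" using m(1) by (simp_all add: r_def nat_less_iff)
    have "k + int m * (- (k div int m)) = int r"
      unfolding r(1) by (simp add: minus_mult_div_eq_mod)
    then have "G 1 (int r) 0 1" using T_add[OF k T_int[of "- (k div int m)"]] by simp
    then have "r = 0" using not_less_Least[of r "\<lambda>m. 0 < m \<and> G 1 (int m) 0 1"] r(2) by (auto simp: level_eq)
    then show "int m dvd k" using r(1) by (simp add: dvd_eq_mod_eq_0)
  qed
  \<comment> \<open>With all translations and, by normality, the lower unipotent U in the group,
    T^-1 U T^-1 would be the inversion, an element of trace 0.\<close>
  have "m \<noteq> 1"
  proof
    assume "m = 1"
    then have T: "G 1 k 0 1" for k using translation by simp
    have "G 1 0 1 1" using conj[of 0 0 "-1" 1, OF _ T[of "-1"]] by simp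
    from mult[OF mult[OF T[of "-1"] this] T[of "-1"]] have "G 0 (- 1) 1 0" by simp
    from trace[OF this] show False by simp
  qed
  moreover have "m < 6" using level_less_6[OF assms(3,2)] by (simp add: m_def)
  ultimately have m25: "m \<in> {2..5}" using m(1) by simp
  interpret spherical_level G "int m"
    by unfold_locales (fact det mult inverse neg conj translation trace | use m25 in simp)+
  have "PSL2_image (invariance_group h) = PSL2_image (principal_congruence m)"
  proof (rule equalityI; rule subsetI)
    fix X assume "X \<in> PSL2_image (invariance_group h)"
    then obtain A where A: "A \<in> invariance_group h" "X = {A, - A}"
      by (auto simp: PSL2_image_def PSL2_coset)
    obtain a b c d where abcd: "A = mat2 a b c d" using mat2_eta[of A] by metis
    have G: "G a b c d" using A by (simp add: G_def abcd)
    have "\<exists>B\<in>principal_congruence m. {B, - B} = X"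
      using congruence_mod_level[OF G]
    proof (elim conjE disjE)
      assume "int m dvd b" "int m dvd c" "int m dvd a - 1" "int m dvd d - 1"
      then show ?thesis using det[OF G] A(2)
        by (intro bexI[of _ A]) (simp_all add: principal_congruence_mat2 abcd)
    next
      \<comment> \<open>A congruent to -I_2: the class {A, -A} is represented in \<Gamma>(m) by
        -A.\<close>
      assume "int m dvd b" "int m dvd c" "int m dvd a + 1" "int m dvd d + 1"
      then show ?thesis using det[OF G] A(2)
        by (intro bexI[of _ "- A"])
           (auto simp add: principal_congruence_mat2 abcd minus_mat2 dvd_uminus_diff_iff)
    qed
    then show "X \<in> PSL2_image (principal_congruence m)"
      by (auto simp: PSL2_image_def PSL2_coset)
  next
    fix X assume "X \<in> PSL2_image (principal_congruence m)"
    then obtain A where A: "A \<in> principal_congruence m" "X = {A, - A}"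
      by (auto simp: PSL2_image_def PSL2_coset)
    obtain a b c d where abcd: "A = mat2 a b c d" using mat2_eta[of A] by metis
    have "G a b c d"
      using A(1) unfolding abcd principal_congruence_mat2 by (intro principal_subset) auto
    then have "A \<in> invariance_group h" by (simp add: G_def abcd)
    then show "X \<in> PSL2_image (invariance_group h)"
      using A(2) by (auto simp: PSL2_image_def PSL2_coset)
  qed
  then show ?thesis using m25 by blast
qed

end
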